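(* Let $X$ and $U$ be Hilbert spaces, let $\mathcal A$ (with domain $D(\mathcal A)\subset X$) be the infinitesimal generator of a $C_0$-semigroup $(e^{\mathcal A t})_{t\ge 0}$ on $X$, and let $\mathcal B\in\mathcal L(U,X)$ be a bounded linear operator. If the system $\dot x=\mathcal A x+\mathcal B u$ is exactly null controllable, then it is completely stabilizable by bounded feedback; that is, for every $\omega>0$ there exist a bounded linear operator $\mathcal F_\omega\in\mathcal L(X,U)$ and a constant $M_\omega\ge 1$ such that $$\left\Vert e^{(\mathcal A+\mathcal B\mathcal F_\omega)t}\right\Vert\le M_\omega e^{-\omega t}\qquad\text{for all } t\ge 0 .$$
   Context: For $x_0\in X$ and $u\in L_2^{\mathrm{loc}}(\mathbb R^+;U)$, the solution of $\dot x=\mathcal A x+\mathcal B u$ with $x(0)=x_0$ is the mild solution $x(t)=e^{\mathcal A t}x_0+\int_0^t e^{\mathcal A(t-\tau)}\mathcal B u(\tau)\,d\tau$. The system is exactly null controllable if there is a time $T>0$ such that for every $x_0\in X$ there is a control $u\in L_2(0,T;U)$ whose corresponding solution satisfies $x(T)=0$. For $\mathcal F\in\mathcal L(X,U)$, $e^{(\mathcal A+\mathcal B\mathcal F)t}$ denotes the $C_0$-semigroup on $X$ generated by $\mathcal A+\mathcal B\mathcal F$ with domain $D(\mathcal A)$. *)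

theory Defs
  imports "HOL-Analysis.Analysis"
begin

text \<open>
  A Hilbert space over a scalar field \<open>'k\<close>, which may be the reals or the complex numbers (by the
  Gelfand-Mazur theorem these are the only types of class \<open>real_normed_field\<close>, up to isometric
  isomorphism). The class \<open>real_inner\<close> supplies the norm and the real part of the inner product.
  For complex scalars, \<open>norm_scale\<close> says precisely that the real inner product is invariant under
  multiplication by the imaginary unit, that is, that
  \<open>\<langle>x, y\<rangle> = x \<bullet> y + \<i> * (x \<bullet> scale \<i> y)\<close> is a complex inner product
  (linear in the first argument) with the given norm.
\<close>

locale hilbert_space = vector_space scale
  for scale :: "'k::real_normed_field \<Rightarrow> 'x::{real_inner,banach} \<Rightarrow> 'x" +
  assumes scale_of_real: "scale (of_real r) x = r *\<^sub>R x"
    and norm_scale: "norm (scale c x) = norm c * norm x"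

lemma hilbert_space_real:
  "hilbert_space (scaleR :: real \<Rightarrow> 'x::{real_inner,banach} \<Rightarrow> 'x)"
  by unfold_locales (simp_all add: algebra_simps)

lemma hilbert_space_complex: "hilbert_space ((*) :: complex \<Rightarrow> complex \<Rightarrow> complex)"
  by unfold_locales (simp_all add: algebra_simps norm_mult scaleR_conv_of_real)

text \<open>
  The type of bounded operators only records real linearity; this predicate adds linearity over the
  scalar field. The operator norm is the same over either field.
\<close>

definition bounded_op ::
  "('k::real_normed_field \<Rightarrow> 'x::{real_inner,banach} \<Rightarrow> 'x) \<Rightarrow>
   ('k \<Rightarrow> 'y::{real_inner,banach} \<Rightarrow> 'y) \<Rightarrow> ('x \<Rightarrow>\<^sub>L 'y) \<Rightarrow> bool"
  where "bounded_op sX sY L \<longleftrightarrow> Vector_Spaces.linear sX sY (blinfun_apply L)"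

text \<open>Only the values at nonnegative times are meaningful.\<close>

definition C0_semigroup ::
  "('k::real_normed_field \<Rightarrow> 'x::{real_inner,banach} \<Rightarrow> 'x) \<Rightarrow> (real \<Rightarrow> 'x \<Rightarrow>\<^sub>L 'x) \<Rightarrow> bool"
  where "C0_semigroup sX S \<longleftrightarrow>
    (\<forall>t\<ge>0. bounded_op sX sX (S t)) \<and>
    S 0 = id_blinfun \<and>
    (\<forall>s\<ge>0. \<forall>t\<ge>0. S (s + t) = S s o\<^sub>L S t) \<and>
    (\<forall>x. ((\<lambda>t. S t x) \<longlongrightarrow> x) (at_right 0))"

text \<open>
  An unbounded operator is given by its domain \<open>D\<close> and a function \<open>A\<close> of which only the values on
  \<open>D\<close> matter. A generator determines its semigroup uniquely on \<open>t \<ge> 0\<close>.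
\<close>

definition generates ::
  "('k::real_normed_field \<Rightarrow> 'x::{real_inner,banach} \<Rightarrow> 'x) \<Rightarrow>
   'x set \<Rightarrow> ('x \<Rightarrow> 'x) \<Rightarrow> (real \<Rightarrow> 'x \<Rightarrow>\<^sub>L 'x) \<Rightarrow> bool"
  where "generates sX D A S \<longleftrightarrow>
    C0_semigroup sX S \<and>
    D = {x. \<exists>y. ((\<lambda>h. (1 / h) *\<^sub>R (S h x - x)) \<longlongrightarrow> y) (at_right 0)} \<and>
    (\<forall>x\<in>D. ((\<lambda>h. (1 / h) *\<^sub>R (S h x - x)) \<longlongrightarrow> A x) (at_right 0))"

text \<open>
  Membership in \<open>L\<^sub>2(0,T;U)\<close>. Since \<open>measurable_on\<close> requires an almost everywhere limit of continuous
  functions, it is strong (Bochner) measurability, also for nonseparable \<open>U\<close>.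
\<close>

definition L2_control :: "real \<Rightarrow> (real \<Rightarrow> 'u::{real_inner,banach}) \<Rightarrow> bool"
  where "L2_control T u \<longleftrightarrow>
    u measurable_on {0..T} \<and> (\<lambda>t. (norm (u t))\<^sup>2) absolutely_integrable_on {0..T}"

text \<open>
  The library's Bochner integral needs a separable range space, so the Henstock-Kurzweil integral is
  used; the two agree on Bochner integrable functions such as this integrand.
\<close>

definition mild_solution ::
  "(real \<Rightarrow> 'x::{real_inner,banach} \<Rightarrow>\<^sub>L 'x) \<Rightarrow> ('u::{real_inner,banach} \<Rightarrow>\<^sub>L 'x) \<Rightarrow>
   'x \<Rightarrow> (real \<Rightarrow> 'u) \<Rightarrow> real \<Rightarrow> 'x"
  where "mild_solution S B x0 u t = S t x0 + integral {0..t} (\<lambda>\<tau>. S (t - \<tau>) (B (u \<tau>)))"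

definition exactly_null_controllable ::
  "(real \<Rightarrow> 'x::{real_inner,banach} \<Rightarrow>\<^sub>L 'x) \<Rightarrow> ('u::{real_inner,banach} \<Rightarrow>\<^sub>L 'x) \<Rightarrow> bool"
  where "exactly_null_controllable S B \<longleftrightarrow>
    (\<exists>T>0. \<forall>x0. \<exists>u. L2_control T u \<and> mild_solution S B x0 u T = 0)"

definition completely_stabilizable ::
  "('k::real_normed_field \<Rightarrow> 'x::{real_inner,banach} \<Rightarrow> 'x) \<Rightarrow>
   ('k \<Rightarrow> 'u::{real_inner,banach} \<Rightarrow> 'u) \<Rightarrow>
   'x set \<Rightarrow> ('x \<Rightarrow> 'x) \<Rightarrow> ('u \<Rightarrow>\<^sub>L 'x) \<Rightarrow> bool"
  where "completely_stabilizable sX sU D A B \<longleftrightarrow>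
    (\<forall>\<omega>>0. \<exists>F M S\<^sub>F. bounded_op sX sU F \<and> M \<ge> 1 \<and>
      generates sX D (\<lambda>x. A x + B (F x)) S\<^sub>F \<and>
      (\<forall>t\<ge>0. norm (S\<^sub>F t) \<le> M * exp (- \<omega> * t)))"

end

theory Submission
  imports Defs
begin

text \<open>
  Replacing \<open>S t\<close> by \<open>exp (\<omega> t) S t\<close> preserves null controllability, so it suffices to find a bounded
  feedback for which the closed-loop semigroup is bounded. By Baire's theorem every state \<open>x\<close> is steered
  into the ball of radius \<open>norm x / 2\<close> in a fixed time, at a cost of at most a constant times
  \<open>(norm x)\<^sup>2\<close>; iterating this bounds the optimal value \<open>V x\<close> of the infinite-horizon
  linear-quadratic cost. The value \<open>V\<close> satisfies the parallelogram law, hence is a bounded quadratic form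
  with polarization \<open>Q\<close>. By uniform convexity of the cost the states along near-optimal controls converge,
  and their limits form a bounded semigroup. Its difference quotient at \<open>0\<close> shows that it is the
  closed-loop semigroup of the Riccati feedback \<open>F\<close> given by \<open>\<langle>F x, v\<rangle> = - Q x (B v)\<close>: on a short
  interval a near-optimal control is close in mean to the constant \<open>F x\<close>. Optimal states are obtained as
  limits of states, so that optimal controls, and the completeness of \<open>L\<^sub>2\<close>, are never needed.
\<close>

section \<open>Integration and Hilbert space facts\<close>

text \<open>The feedback is suggested by a formal expansion. Under a constant control
  \<open>v\<close> on \<open>[0, h]\<close>, the running cost plus the value of the end state
  depends on \<open>v\<close>, to first order, through \<open>h\<close> times the sum of
  \<open>(norm v)\<^sup>2\<close> and \<open>2 * Q x (B v)\<close>; completing the square gives the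
  minimizer. The obstacle is that near-optimal controls are bounded only in energy, so every error
  must be small compared with \<open>h\<close> uniformly in the control. The cost gap
  \<open>h ^ 3\<close> is chosen because a control error moves the state by \<open>sqrt h\<close>
  times the root of its energy: the state error is then of order \<open>h\<^sup>2\<close> and
  disappears from the difference quotient. That quotient compares the optimal state with
  \<open>S h x\<close>, not with \<open>x\<close>, so it converges for every \<open>x\<close>, and
  the closed-loop generator keeps the domain \<open>D\<close>. Piecewise continuous controls can be
  cut, shifted and glued, as dynamic programming demands, and their integrands are Henstock-Kurzweil
  integrable in any Banach space. Square-integrable controls occur only in the hypothesis and are
  replaced by continuous ones at a small terminal error.\<close>

lemma closed_cover_contains_ball:
  fixes C :: "nat \<Rightarrow> 'a::{real_normed_vector,complete_space} set"
  assumes C: "\<And>n. closed (C n)" and cover: "\<And>x. \<exists>n. x \<in> C n"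
  obtains n x r where "r > 0" "ball x r \<subseteq> C n"
proof -
  have "\<exists>n. interior (C n) \<noteq> {}"
  proof (rule ccontr)
    assume "\<not> ?thesis"
    then have "interior (\<Union>(range C)) = {}"
      using Met_TC.metric_Baire_category_alt[where ?'a = 'a and \<G> = "range C"] C
      by (auto simp: complete_UNIV)
    moreover have "\<Union>(range C) = UNIV"
      using cover by auto
    ultimately show False
      by simp
  qed
  then obtain n x where "x \<in> interior (C n)"
    by auto
  then show ?thesis
    using that mem_interior by metis
qed

text \<open>Over a fine tagged division the Riemann sums of \<open>f\<close> and \<open>g\<close>
  differ by at most the Riemann sum of the real majorant \<open>k\<close>, so the Cauchy criterion
  passes from \<open>g\<close> to \<open>f\<close>. It serves to integrate piecewise continuous
  functions and inputs driven by square-integrable controls, with values in any Banach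
  space.\<close>

lemma integrable_L1_approx:
  fixes f :: "real \<Rightarrow> 'b::banach"
  assumes approx: "\<And>e. e > 0 \<Longrightarrow> \<exists>g k. g integrable_on {a..b} \<and> k integrable_on {a..b} \<and>
      (\<forall>t\<in>{a..b}. norm (f t - g t) \<le> k t) \<and> integral {a..b} k \<le> e"
  shows "f integrable_on {a..b}"
proof -
  have "f integrable_on cbox a b"
    unfolding integrable_Cauchy
  proof (intro allI impI)
    fix e :: real
    assume "e > 0"
    obtain g k where g: "g integrable_on cbox a b" and k: "k integrable_on cbox a b"
      and fg: "\<And>t. t \<in> {a..b} \<Longrightarrow> norm (f t - g t) \<le> k t" and ke: "integral (cbox a b) k \<le> e / 8"
      using approx[of "e / 8"] \<open>e > 0\<close> by auto
    have e4: "e / 4 > 0" and e8: "e / 8 > 0"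
      using \<open>e > 0\<close> by auto
    from g[unfolded integrable_Cauchy, rule_format, OF e4]
    obtain \<gamma>1 where \<gamma>1: "gauge \<gamma>1"
      and G: "\<forall>p q. p tagged_division_of (cbox a b) \<and> \<gamma>1 fine p \<and> q tagged_division_of (cbox a b) \<and>
        \<gamma>1 fine q \<longrightarrow> norm ((\<Sum>(x,K)\<in>p. measure lborel K *\<^sub>R g x) - (\<Sum>(x,K)\<in>q. measure lborel K *\<^sub>R g x)) < e / 4"
      by (elim exE conjE) (rule that)
    from integrable_integral[OF k, unfolded has_integral, rule_format, OF e8]
    obtain \<gamma>2 where \<gamma>2: "gauge \<gamma>2"
      and K: "\<forall>p. p tagged_division_of (cbox a b) \<and> \<gamma>2 fine p \<longrightarrow>
        norm ((\<Sum>(x,K)\<in>p. measure lborel K *\<^sub>R k x) - integral (cbox a b) k) < e / 8"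
      by (elim exE conjE) (rule that)
    have est: "norm ((\<Sum>(x,K)\<in>p. measure lborel K *\<^sub>R f x) - (\<Sum>(x,K)\<in>p. measure lborel K *\<^sub>R g x)) < e / 4"
      if p: "p tagged_division_of (cbox a b)" "\<gamma>2 fine p" for p
    proof -
      have "norm ((\<Sum>(x,K)\<in>p. measure lborel K *\<^sub>R f x) - (\<Sum>(x,K)\<in>p. measure lborel K *\<^sub>R g x))
          = norm (\<Sum>(x,K)\<in>p. measure lborel K *\<^sub>R (f x - g x))"
        by (simp add: sum_subtractf[symmetric] split_beta algebra_simps)
      also have "\<dots> \<le> (\<Sum>(x,K)\<in>p. measure lborel K *\<^sub>R k x)"
      proof (rule sum_norm_le)
        fix xK assume "xK \<in> p"
        then have "fst xK \<in> {a..b}"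
          using p(1) by (metis box_real(2) prod.collapse subsetD tagged_division_ofD(2,3))
        then show "norm (case xK of (x, K) \<Rightarrow> measure lborel K *\<^sub>R (f x - g x)) \<le> (case xK of (x, K) \<Rightarrow> measure lborel K *\<^sub>R k x)"
          using fg by (auto simp: split_beta intro!: mult_left_mono)
      qed
      also have "\<dots> < e / 4"
      proof -
        have "norm ((\<Sum>(x,K)\<in>p. measure lborel K *\<^sub>R k x) - integral (cbox a b) k) < e / 8"
          using K p by blast
        then show ?thesis
          using ke unfolding real_norm_def by linarith
      qed
      finally show ?thesis .
    qed
    show "\<exists>\<gamma>. gauge \<gamma> \<and>
          (\<forall>\<D>1 \<D>2. \<D>1 tagged_division_of (cbox a b) \<and> \<gamma> fine \<D>1 \<and>
            \<D>2 tagged_division_of (cbox a b) \<and> \<gamma> fine \<D>2 \<longrightarrow>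
            norm ((\<Sum>(x,K)\<in>\<D>1. measure lborel K *\<^sub>R f x) - (\<Sum>(x,K)\<in>\<D>2. measure lborel K *\<^sub>R f x)) < e)"
    proof (intro exI[of _ "\<lambda>x. \<gamma>1 x \<inter> \<gamma>2 x"] conjI allI impI gauge_Int \<gamma>1 \<gamma>2, elim conjE)
      fix p q
      assume p: "p tagged_division_of (cbox a b)" "(\<lambda>x. \<gamma>1 x \<inter> \<gamma>2 x) fine p"
        and q: "q tagged_division_of (cbox a b)" "(\<lambda>x. \<gamma>1 x \<inter> \<gamma>2 x) fine q"
      then have fine: "\<gamma>1 fine p" "\<gamma>2 fine p" "\<gamma>1 fine q" "\<gamma>2 fine q"
        by (auto simp: fine_Int)
      show "norm ((\<Sum>(x,K)\<in>p. measure lborel K *\<^sub>R f x) - (\<Sum>(x,K)\<in>q. measure lborel K *\<^sub>R f x)) < e"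
        using est[OF p(1) fine(2)] est[OF q(1) fine(4)] G[rule_format, OF conjI[OF p(1) conjI[OF fine(1) conjI[OF q(1) fine(3)]]]]
        by norm
    qed
  qed
  then show ?thesis
    by simp
qed

text \<open>Cauchy-Schwarz against a constant: the integral of \<open>(f s - c)\<^sup>2\<close> is
  nonnegative, with \<open>c\<close> the mean value of \<open>f\<close>.\<close>

lemma integral_sq_le:
  fixes f :: "real \<Rightarrow> real"
  assumes "0 \<le> h" and f: "f integrable_on {0..h}" and f2: "(\<lambda>s. (f s)\<^sup>2) integrable_on {0..h}"
  shows "(integral {0..h} f)\<^sup>2 \<le> h * integral {0..h} (\<lambda>s. (f s)\<^sup>2)"
proof (cases "h = 0")
  case False
  then have "h > 0"
    using assms by simp
  define c where "c = integral {0..h} f / h"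
  have c: "integral {0..h} f = h * c"
    using \<open>h > 0\<close> by (simp add: c_def)
  have i: "(\<lambda>s. (f s)\<^sup>2 - 2 * c * f s + c\<^sup>2) integrable_on {0..h}"
    using f f2 by (intro integrable_add integrable_diff integrable_on_mult_right) auto
  then have "(\<lambda>s. (f s - c)\<^sup>2) integrable_on {0..h}"
    by (simp add: power2_diff algebra_simps)
  then have "0 \<le> integral {0..h} (\<lambda>s. (f s - c)\<^sup>2)"
    by (rule integral_nonneg) simp
  also have "\<dots> = integral {0..h} (\<lambda>s. (f s)\<^sup>2 - 2 * c * f s + c\<^sup>2)"
    by (simp add: power2_diff algebra_simps)
  also have "\<dots> = integral {0..h} (\<lambda>s. (f s)\<^sup>2) - 2 * c * integral {0..h} f + h * c\<^sup>2"
    using f f2 \<open>h > 0\<close> by (subst integral_add, auto intro!: integrable_diff integrable_on_mult_right,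
      subst integral_diff, auto intro!: integrable_on_mult_right)
  finally have "h * c\<^sup>2 \<le> integral {0..h} (\<lambda>s. (f s)\<^sup>2)"
    unfolding c by (simp add: power2_eq_square algebra_simps)
  then have "h * (h * c\<^sup>2) \<le> h * integral {0..h} (\<lambda>s. (f s)\<^sup>2)"
    using \<open>h > 0\<close> by (intro mult_left_mono) auto
  then show ?thesis
    unfolding c by (simp add: power2_eq_square mult_ac)
qed auto

lemma quadratic_nonneg_discriminant:
  fixes a b c :: real
  assumes "\<And>t. 0 \<le> c + 2 * t * b + t\<^sup>2 * a" and "a \<ge> 0" "c \<ge> 0"
  shows "b\<^sup>2 \<le> c * a"
proof (cases "a = 0")
  case True
  have "b = 0"
  proof (rule ccontr)
    assume "b \<noteq> 0"
    then show False
      using assms(1)[of "- (c + 1) / (2 * b)"] True by (simp add: field_simps)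
  qed
  then show ?thesis
    using True by simp
next
  case False
  then have "a > 0"
    using assms by simp
  then show ?thesis
    using assms(1)[of "- b / a"] by (simp add: field_simps power2_eq_square)
qed

text \<open>With \<open>Y = UNIV\<close> this is the Riesz representation theorem; with \<open>f = inner y\<close> it is the
  orthogonal projection of \<open>y\<close> onto \<open>Y\<close>.\<close>

lemma riesz_closed_subspace:
  fixes f :: "'a::{real_inner,banach} \<Rightarrow> real"
  assumes Y: "subspace Y" "closed Y" and f: "bounded_linear f"
  shows "\<exists>z\<in>Y. \<forall>w\<in>Y. z \<bullet> w = f w"
proof -
  interpret f: bounded_linear f by fact
  \<comment> \<open>If \<open>z\<close> in \<open>Y\<close> represents \<open>f\<close> on
    \<open>Y\<close>, then \<open>g w\<close> equals
    \<open>(norm (w - z))\<^sup>2 - (norm z)\<^sup>2\<close> there; so the representer is sought as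
    the minimizer of \<open>g\<close>.\<close>
  define g where "g w = (norm w)\<^sup>2 - 2 * f w" for w
  define d where "d = Inf (g ` Y)"
  have g_lower: "g w \<ge> - (onorm f)\<^sup>2" for w
  proof -
    have "f w \<le> onorm f * norm w"
      using onorm[OF f, of w] by auto
    moreover have "0 \<le> (norm w - onorm f)\<^sup>2"
      by simp
    ultimately show ?thesis
      unfolding g_def power2_diff by (simp add: algebra_simps)
  qed
  then have bdd: "bdd_below (g ` Y)"
    by (intro bdd_belowI2) auto
  have d_le: "d \<le> g w" if "w \<in> Y" for w
    unfolding d_def using that bdd by (intro cInf_lower) auto
  have "\<exists>w\<in>Y. g w < d + 1 / real (Suc n)" for n
    using cInf_lessD[of "g ` Y" "d + 1 / real (Suc n)"] subspace_0[OF Y(1)] unfolding d_def by auto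
  then obtain w where wY: "\<And>n. w n \<in> Y" and w: "\<And>n. g (w n) < d + 1 / real (Suc n)"
    by metis
  \<comment> \<open>Two almost minimizers are close, because the value of \<open>g\<close> at their
    midpoint cannot fall below \<open>d\<close>.\<close>
  have mid: "(norm (u - v))\<^sup>2 / 2 = g u + g v - 2 * g ((1/2) *\<^sub>R (u + v))" for u v
    unfolding g_def f.scaleR f.add
    by (simp add: power2_norm_eq_inner inner_simps inner_commute algebra_simps add_divide_distrib diff_divide_distrib)
  have close: "(norm (w m - w n))\<^sup>2 \<le> 2 * (1 / real (Suc m) + 1 / real (Suc n))" for m n
  proof -
    have "(1/2) *\<^sub>R (w m + w n) \<in> Y"
      using Y(1) wY by (simp add: subspace_add subspace_scale)
    from d_le[OF this] show ?thesis
      using mid[of "w m" "w n"] w[of m] w[of n] unfolding distrib_left by linarith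
  qed
  have "Cauchy w"
  proof (rule CauchyI)
    fix e :: real
    assume "e > 0"
    then obtain N where N: "1 / real (Suc N) < e\<^sup>2 / 4"
      using reals_Archimedean[of "e\<^sup>2 / 4"] by (auto simp: inverse_eq_divide)
    have "norm (w m - w n) < e" if "m \<ge> N" "n \<ge> N" for m n
    proof -
      have "1 / real (Suc m) \<le> 1 / real (Suc N)" "1 / real (Suc n) \<le> 1 / real (Suc N)"
        using that by (auto simp: field_simps)
      then have "2 * (1 / real (Suc m) + 1 / real (Suc n)) \<le> 2 * (1 / real (Suc N) + 1 / real (Suc N))"
        by (intro mult_left_mono add_mono) auto
      also have "\<dots> = 4 * (1 / real (Suc N))"
        by simp
      also have "\<dots> < 4 * (e\<^sup>2 / 4)"
        using N by (intro mult_strict_left_mono) auto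
      finally have "(norm (w m - w n))\<^sup>2 < e\<^sup>2"
        using close[of m n] by simp
      then show ?thesis
        using \<open>e > 0\<close> by (simp add: power_less_imp_less_base)
    qed
    then show "\<exists>M. \<forall>m\<ge>M. \<forall>n\<ge>M. norm (w m - w n) < e"
      by blast
  qed
  then obtain z where z: "w \<longlonglongrightarrow> z"
    using Cauchy_convergent_iff convergent_def by blast
  have "z \<in> Y"
    using closed_sequentially[OF Y(2) _ z] wY by blast
  have "(\<lambda>n. g (w n)) \<longlonglongrightarrow> g z"
    unfolding g_def using z by (intro tendsto_intros f.tendsto)
  moreover have "(\<lambda>n. d + 1 / real (Suc n)) \<longlonglongrightarrow> d + 0"
    by (intro tendsto_intros LIMSEQ_Suc lim_1_over_n)
  ultimately have "g z \<le> d + 0"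
    by (rule LIMSEQ_le) (use w less_imp_le in blast)
  then have gz: "g z \<le> d"
    by simp
  have "z \<bullet> v = f v" if v: "v \<in> Y" for v
  proof -
    \<comment> \<open>First variation at the minimizer: the constant term of this quadratic in
      \<open>t\<close> is \<open>0\<close>, so the discriminant bound forces the linear coefficient
      to vanish.\<close>
    have "0 \<le> 0 + 2 * t * (z \<bullet> v - f v) + t\<^sup>2 * (norm v)\<^sup>2" for t
    proof -
      have "g z \<le> g (z + t *\<^sub>R v)"
        using gz d_le[of "z + t *\<^sub>R v"] \<open>z \<in> Y\<close> v Y(1) by (simp add: subspace_add subspace_scale)
      moreover have "(norm (z + t *\<^sub>R v))\<^sup>2 = (norm z)\<^sup>2 + 2 * t * (z \<bullet> v) + t\<^sup>2 * (norm v)\<^sup>2"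
        unfolding power2_norm_eq_inner
        by (simp add: inner_simps inner_commute power2_eq_square algebra_simps)
      ultimately show ?thesis
        unfolding g_def f.scaleR f.add by (simp add: algebra_simps)
    qed
    from quadratic_nonneg_discriminant[OF this] show ?thesis
      by simp
  qed
  with \<open>z \<in> Y\<close> show ?thesis
    by blast
qed

text \<open>\<open>a\<close> has period \<open>1\<close>, so the bound on one period holds
  everywhere, and a bounded additive function is zero.\<close>

lemma bounded_additive_real:
  fixes a :: "real \<Rightarrow> real"
  assumes add: "\<And>s t. a (s + t) = a s + a t" and a1: "a 1 = 0"
    and bound: "\<And>t. 0 \<le> t \<Longrightarrow> t \<le> 1 \<Longrightarrow> \<bar>a t\<bar> \<le> K"
  shows "a t = 0"
proof -
  have a0: "a 0 = 0"
    using add[of 0 0] by simp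
  have mult: "a (real n * s) = real n * a s" for n s
    by (induction n) (auto simp: a0 add algebra_simps)
  have neg: "a (- s) = - a s" for s
    using add[of s "- s"] a0 by simp
  have int: "a (of_int k) = 0" for k
  proof (cases "k \<ge> 0")
    case True
    then show ?thesis
      using mult[of "nat k" 1] a1 by simp
  next
    case False
    then show ?thesis
      using mult[of "nat (- k)" 1] neg[of "of_int (- k)"] a1 by simp
  qed
  have bounded: "\<bar>a s\<bar> \<le> K" for s
  proof -
    have "a s = a (of_int \<lfloor>s\<rfloor>) + a (frac s)"
      by (subst add[symmetric]) (simp add: frac_def)
    then show ?thesis
      using bound[of "frac s"] int frac_lt_1[of s] by (simp add: less_imp_le)
  qed
  show ?thesis
  proof (rule ccontr)
    assume "a t \<noteq> 0"
    then obtain n where "real n * \<bar>a t\<bar> > K"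
      using reals_Archimedean3[of "\<bar>a t\<bar>"] by auto
    then show False
      using bounded[of "real n * t"] by (simp add: mult abs_mult)
  qed
qed

text \<open>The classical polarization argument with a quadratic bound in the role of continuity:
  additivity of \<open>Q\<close> comes from the parallelogram law, real homogeneity from additivity
  together with local boundedness.\<close>

lemma jordan_von_neumann:
  fixes V :: "'a::real_normed_vector \<Rightarrow> real"
  assumes par: "\<And>x y. V (x + y) + V (x - y) = 2 * V x + 2 * V y"
    and bound: "\<And>x. 0 \<le> V x" "\<And>x. V x \<le> C * (norm x)\<^sup>2"
  defines "Q \<equiv> \<lambda>x y. (V (x + y) - V (x - y)) / 4"
  shows "bounded_bilinear Q" and "V (x + y) = V x + 2 * Q x y + V y"
proof -
  have V0: "V 0 = 0"
    using par[of 0 0] by simp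
  have even: "V (- x) = V x" for x
    using par[of 0 x] V0 by simp
  have sym: "Q x y = Q y x" for x y
    unfolding Q_def using even[of "x - y"] by (simp add: add.commute)
  have add: "Q (x + x') y = Q x y + Q x' y" for x x' y
  proof -
    \<comment> \<open>Evenness identifies the mixed values produced by the four instances below, so
      they cancel when the instances with \<open>- y\<close> are subtracted from those with
      \<open>+ y\<close>.\<close>
    have "V (x - x' + y) = V (x' - x - y)" "V (x' - x + y) = V (x - x' - y)"
      using even[of "x' - x - y"] even[of "x - x' - y"] by (simp_all add: algebra_simps)
    moreover have "V (x + x' + y) + V (x - x' + y) = 2 * V (x + y) + 2 * V x'"
    proof -
      have e: "x + y + x' = x + x' + y" "x + y - x' = x - x' + y"
        by (simp_all add: algebra_simps)
      show ?thesis
        using par[of "x + y" "x'"] unfolding e .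
    qed
    moreover have "V (x + x' + y) + V (x' - x + y) = 2 * V (x' + y) + 2 * V x"
    proof -
      have e: "x' + y + x = x + x' + y" "x' + y - x = x' - x + y"
        by (simp_all add: algebra_simps)
      show ?thesis
        using par[of "x' + y" x] unfolding e .
    qed
    moreover have "V (x + x' - y) + V (x - x' - y) = 2 * V (x - y) + 2 * V x'"
    proof -
      have e: "x - y + x' = x + x' - y" "x - y - x' = x - x' - y"
        by (simp_all add: algebra_simps)
      show ?thesis
        using par[of "x - y" "x'"] unfolding e .
    qed
    moreover have "V (x + x' - y) + V (x' - x - y) = 2 * V (x' - y) + 2 * V x"
    proof -
      have e: "x' - y + x = x + x' - y" "x' - y - x = x' - x - y"
        by (simp_all add: algebra_simps)
      show ?thesis
        using par[of "x' - y" x] unfolding e .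
    qed
    ultimately have "V (x + x' + y) - V (x + x' - y) = V (x + y) - V (x - y) + (V (x' + y) - V (x' - y))"
      by linarith
    then show ?thesis
      unfolding Q_def add_divide_distrib[symmetric] by simp
  qed
  have bnd: "\<bar>Q x y\<bar> \<le> C * (norm x + norm y)\<^sup>2 / 2" for x y
  proof -
    have C: "0 \<le> C * (norm z)\<^sup>2" for z :: 'a
      using bound order_trans by blast
    have mono: "C * (norm z)\<^sup>2 \<le> C * (norm x + norm y)\<^sup>2" if "norm z \<le> norm x + norm y" for z :: 'a
    proof (cases "z = 0")
      case True
      then show ?thesis
        using C[of x] C[of y] by (cases "x = 0"; cases "y = 0") (auto simp: zero_le_mult_iff)
    next
      case False
      then have "C \<ge> 0"
        using C[of z] by (simp add: zero_le_mult_iff)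
      then show ?thesis
        using that by (intro mult_left_mono power_mono) auto
    qed
    have "V (x + y) \<le> C * (norm x + norm y)\<^sup>2" "V (x - y) \<le> C * (norm x + norm y)\<^sup>2"
      using bound(2) mono norm_triangle_ineq norm_triangle_ineq4 order_trans by blast+
    then show ?thesis
      unfolding Q_def using bound(1)[of "x + y"] bound(1)[of "x - y"] by (auto simp: abs_le_iff)
  qed
  have scale: "Q (t *\<^sub>R x) y = t * Q x y" for t x y
  proof -
    \<comment> \<open>The defect of homogeneity: additive in \<open>t\<close>, zero at
      \<open>t = 1\<close>, and bounded on the unit interval by the crude bound.\<close>
    define a where "a t = Q (t *\<^sub>R x) y - t * Q x y" for t
    have "\<bar>a s\<bar> \<le> \<bar>C\<bar> * (norm x + norm y)\<^sup>2 + \<bar>Q x y\<bar>" if "0 \<le> s" "s \<le> 1" for s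
    proof -
      have "\<bar>Q (s *\<^sub>R x) y\<bar> \<le> \<bar>C\<bar> * (norm x + norm y)\<^sup>2"
      proof -
        have "C * (norm (s *\<^sub>R x) + norm y)\<^sup>2 / 2 \<le> \<bar>C\<bar> * (norm (s *\<^sub>R x) + norm y)\<^sup>2"
          by (smt (verit) abs_ge_self abs_ge_zero field_sum_of_halves mult_right_mono zero_le_mult_iff zero_le_power2)
        also have "\<dots> \<le> \<bar>C\<bar> * (norm x + norm y)\<^sup>2"
          using that by (intro mult_left_mono power_mono) (auto simp: mult_left_le_one_le)
        finally show ?thesis
          using bnd[of "s *\<^sub>R x" y] by linarith
      qed
      moreover have "\<bar>s * Q x y\<bar> \<le> \<bar>Q x y\<bar>"
        using that by (simp add: abs_mult mult_left_le_one_le)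
      ultimately show ?thesis
        unfolding a_def by linarith
    qed
    from bounded_additive_real[of a, OF _ _ this] have "a t = 0"
      by (simp add: a_def scaleR_add_left add distrib_right)
    then show ?thesis
      by (simp add: a_def)
  qed
  have scale': "Q x (t *\<^sub>R y) = t * Q x y" for t x y
    using scale[of t y x] unfolding sym[of "t *\<^sub>R y" x] sym[of y x] .
  \<comment> \<open>For unit vectors the crude bound is
    \<open>C * (1 + 1)\<^sup>2 / 2 = 2 * C\<close>; homogeneity in both arguments does the
    rest.\<close>
  have "\<bar>Q x y\<bar> \<le> norm x * norm y * (2 * C)" for x y
  proof (cases "x = 0 \<or> y = 0")
    case True
    then show ?thesis
      using scale[of 0 0 y] scale'[of x 0 0] by auto
  next
    case False
    have "Q x y = Q (norm x *\<^sub>R inverse (norm x) *\<^sub>R x) (norm y *\<^sub>R inverse (norm y) *\<^sub>R y)"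
      using False by simp
    also have "\<dots> = norm x * norm y * Q (inverse (norm x) *\<^sub>R x) (inverse (norm y) *\<^sub>R y)"
      unfolding scale[of "norm x" "inverse (norm x) *\<^sub>R x"] scale'[of _ "norm y" "inverse (norm y) *\<^sub>R y"]
      by (simp only: mult_ac)
    also have "\<bar>\<dots>\<bar> \<le> norm x * norm y * (2 * C)"
      using bnd[of "inverse (norm x) *\<^sub>R x" "inverse (norm y) *\<^sub>R y"] False
      by (simp add: abs_mult)
    finally show ?thesis .
  qed
  note bound' = this
  show "bounded_bilinear Q"
  proof
    show "Q x (y + y') = Q x y + Q x y'" for x y y'
      using add[of y y' x] unfolding sym[of "y + y'" x] sym[of y x] sym[of y' x] .
    show "\<exists>K. \<forall>x y. norm (Q x y) \<le> norm x * norm y * K"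
      using bound' by (intro exI[of _ "2 * C"]) simp
  qed (simp_all add: add scale scale')
  show "V (x + y) = V x + 2 * Q x y + V y"
  proof -
    have "4 * Q x y = V (x + y) - V (x - y)"
      by (simp add: Q_def)
    then show ?thesis
      using par[of x y] by linarith
  qed
qed

section \<open>Piecewise continuous functions\<close>

text \<open>A weak form of piecewise continuity: at the exceptional points and at the two ends only
  boundedness is kept. The class is therefore easily seen to be stable under gluing, translation and
  restriction.\<close>

definition pc_on :: "real \<Rightarrow> real \<Rightarrow> (real \<Rightarrow> 'b::real_normed_vector) \<Rightarrow> bool"
  where "pc_on a b f \<longleftrightarrow> bounded (f ` {a..b}) \<and> (\<exists>Z. finite Z \<and> (\<forall>s\<in>{a<..<b} - Z. isCont f s))"

lemma pc_on_bound:
  assumes "pc_on a b f"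
  obtains M where "M > 0" "\<And>s. s \<in> {a..b} \<Longrightarrow> norm (f s) \<le> M"
  using assms unfolding pc_on_def bounded_pos by auto

text \<open>A cut-off vanishing on the exceptional set makes \<open>f\<close> continuous. The error
  is dominated by the real functions \<open>M * (1 - \<phi> n s)\<close>, whose integrals tend to
  zero, so \<open>integrable_L1_approx\<close> applies.\<close>

lemma pc_on_integrable:
  fixes f :: "real \<Rightarrow> 'b::banach"
  assumes f: "pc_on a b f"
  shows "f integrable_on {a..b}"
proof (cases "a < b")
  case False
  then show ?thesis
    using integrable_on_null[of a b f] by (simp add: content_real_eq_0)
next
  case True
  obtain M where "M > 0" and M: "\<And>s. s \<in> {a..b} \<Longrightarrow> norm (f s) \<le> M"
    using f pc_on_bound by blast
  obtain Z where "finite Z" and Z: "\<And>s. s \<in> {a<..<b} - Z \<Longrightarrow> isCont f s"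
    using f unfolding pc_on_def by auto
  \<comment> \<open>The end points join the exceptional set because \<open>f\<close> may jump there;
    they also keep the set nonempty, as \<open>infdist\<close> to the empty set is
    \<open>0\<close>.\<close>
  define Z' where "Z' = insert a (insert b Z)"
  have Z': "finite Z'" "closed Z'" "Z' \<noteq> {}"
    using \<open>finite Z\<close> by (auto simp: Z'_def finite_imp_closed)
  define \<phi> where "\<phi> n s = min 1 (real n * infdist s Z')" for n s
  have \<phi>_01: "0 \<le> \<phi> n s" "\<phi> n s \<le> 1" for n s
    by (auto simp: \<phi>_def infdist_nonneg)
  have \<phi>_cont: "isCont (\<phi> n) s" for n s
    unfolding \<phi>_def by (intro continuous_intros)
  have \<phi>_zero: "\<phi> n s = 0" if "s \<in> Z'" for n s
    using that by (simp add: \<phi>_def)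
  have \<phi>_lim: "(\<lambda>n. M * (1 - \<phi> n s)) \<longlonglongrightarrow> (if s \<in> Z' then M else 0)" for s
  proof (cases "s \<in> Z'")
    case False
    then have pos: "infdist s Z' > 0"
      using Z' by (metis infdist_nonneg in_closed_iff_infdist_zero less_eq_real_def)
    obtain N where N: "real N * infdist s Z' > 1"
      using reals_Archimedean3[OF pos] by auto
    have "M * (1 - \<phi> n s) = 0" if "n \<ge> N" for n
    proof -
      have "real N * infdist s Z' \<le> real n * infdist s Z'"
        using that pos by (intro mult_right_mono) auto
      then show ?thesis
        using N by (simp add: \<phi>_def)
    qed
    then have "\<forall>\<^sub>F n in sequentially. M * (1 - \<phi> n s) = 0"
      by (rule eventually_sequentiallyI)
    then show ?thesis
      using False by (simp add: tendsto_eventually)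
  qed (simp add: \<phi>_zero)
  have k: "(\<lambda>s. M * (1 - \<phi> n s)) integrable_on {a..b}" for n
    by (intro integrable_continuous_real continuous_intros continuous_at_imp_continuous_on ballI \<phi>_cont)
  have "norm (M * (1 - \<phi> n s)) \<le> M" for n :: nat and s :: real
    using \<phi>_01[where n = n and s = s] \<open>M > 0\<close> by (simp add: mult_le_cancel_left1)
  then have k0: "(\<lambda>n. integral {a..b} (\<lambda>s. M * (1 - \<phi> n s))) \<longlonglongrightarrow> integral {a..b} (\<lambda>s. if s \<in> Z' then M else 0)"
    by (intro dominated_convergence(2)[where h = "\<lambda>_. M", OF k integrable_const_ivl _ \<phi>_lim])
  have int0: "integral {a..b} (\<lambda>s. if s \<in> Z' then M else 0) = integral {a..b} (\<lambda>_. 0)"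
    by (rule integral_spike[of Z']) (use Z' in \<open>auto intro: negligible_finite\<close>)
  have g: "continuous_on {a..b} (\<lambda>s. \<phi> n s *\<^sub>R f s)" for n
    unfolding continuous_on_eq_continuous_within
  proof
    fix s assume s: "s \<in> {a..b}"
    show "continuous (at s within {a..b}) (\<lambda>s. \<phi> n s *\<^sub>R f s)"
    proof (cases "s \<in> Z'")
      case True
      have "((\<lambda>s. \<phi> n s *\<^sub>R f s) \<longlongrightarrow> 0) (at s within {a..b})"
      proof (rule Lim_null_comparison)
        show "\<forall>\<^sub>F s in at s within {a..b}. norm (\<phi> n s *\<^sub>R f s) \<le> \<phi> n s * M"
          using M \<phi>_01 by (auto simp: eventually_at_filter intro!: always_eventually mult_left_mono)
        have "(\<phi> n \<longlongrightarrow> \<phi> n s) (at s within {a..b})"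
          using \<phi>_cont[where n = n and s = s] by (simp add: continuous_at_imp_continuous_at_within continuous_within[symmetric])
        then show "((\<lambda>s. \<phi> n s * M) \<longlongrightarrow> 0) (at s within {a..b})"
          using \<phi>_zero[OF True] by (auto intro: tendsto_mult_left_zero)
      qed
      then show ?thesis
        using \<phi>_zero[OF True] by (simp add: continuous_within)
    next
      case False
      then have "isCont f s"
        using s by (intro Z) (auto simp: Z'_def)
      then show ?thesis
        by (rule continuous_at_imp_continuous_at_within[OF continuous_scaleR[OF \<phi>_cont]])
    qed
  qed
  show ?thesis
  proof (rule integrable_L1_approx)
    fix e :: real assume "e > 0"
    then obtain n where n: "integral {a..b} (\<lambda>s. M * (1 - \<phi> n s)) < e"
      using k0 order_tendstoD(2)[OF k0, of e] unfolding int0 by (auto simp: eventually_sequentially)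
    have "norm (f t - \<phi> n t *\<^sub>R f t) \<le> M * (1 - \<phi> n t)" if "t \<in> {a..b}" for t
    proof -
      have "f t - \<phi> n t *\<^sub>R f t = (1 - \<phi> n t) *\<^sub>R f t"
        by (simp add: algebra_simps)
      then show ?thesis
        using M[OF that] \<phi>_01(2)[of n t] by (simp add: mult.commute mult_right_mono)
    qed
    then show "\<exists>g k. g integrable_on {a..b} \<and> k integrable_on {a..b} \<and>
      (\<forall>t\<in>{a..b}. norm (f t - g t) \<le> k t) \<and> integral {a..b} k \<le> e"
      using k n g integrable_continuous_real less_imp_le by blast
  qed
qed

lemma pc_on_subset: "pc_on a b f \<Longrightarrow> a \<le> c \<Longrightarrow> d \<le> b \<Longrightarrow> pc_on c d f"
  unfolding pc_on_def by (meson Diff_iff atLeastatMost_subset_iff bounded_subset greaterThanLessThan_subseteq_greaterThanLessThan image_mono subsetD)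

lemma pc_on_continuous: "continuous_on {a..b} f \<Longrightarrow> pc_on a b f"
  unfolding pc_on_def
  by (intro conjI exI[of _ "{}"] compact_imp_bounded compact_continuous_image)
    (auto simp: continuous_on_interior)

lemma pc_on_join:
  assumes f: "pc_on a b f" and g: "pc_on b c f"
  shows "pc_on a c f"
proof -
  obtain Z where Z: "finite Z" "\<And>s. s \<in> {a<..<b} - Z \<Longrightarrow> isCont f s"
    using f unfolding pc_on_def by auto
  obtain Y where Y: "finite Y" "\<And>s. s \<in> {b<..<c} - Y \<Longrightarrow> isCont f s"
    using g unfolding pc_on_def by auto
  have "isCont f s" if "s \<in> {a<..<c} - (insert b (Z \<union> Y))" for s
    using Z(2)[of s] Y(2)[of s] that by (cases "s < b") auto
  moreover have "bounded (f ` ({a..b} \<union> {b..c}))"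
    using f g unfolding pc_on_def by (simp add: image_Un)
  then have "bounded (f ` {a..c})"
    by (rule bounded_subset) auto
  ultimately show ?thesis
    unfolding pc_on_def using Z(1) Y(1) by (intro conjI exI[of _ "insert b (Z \<union> Y)"]) auto
qed

lemma pc_on_cong:
  assumes "\<And>s. s \<in> {a<..<b} \<Longrightarrow> f s = g s" and f: "pc_on a b f"
  shows "pc_on a b g"
proof -
  obtain Z where Z: "finite Z" "\<And>s. s \<in> {a<..<b} - Z \<Longrightarrow> isCont f s"
    using f unfolding pc_on_def by auto
  have "isCont g s" if "s \<in> {a<..<b} - Z" for s
  proof -
    have "\<forall>\<^sub>F r in nhds s. r \<in> {a<..<b}"
      using that by (intro eventually_nhds_in_open) auto
    then have "\<forall>\<^sub>F r in nhds s. f r = g r"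
      by eventually_elim (use assms in auto)
    then show ?thesis
      using Z(2)[OF that] isCont_cong by metis
  qed
  moreover have "bounded (g ` {a..b})"
  proof (rule bounded_subset)
    show "bounded (f ` {a..b} \<union> {g a, g b})"
      using f unfolding pc_on_def by (intro bounded_Un[THEN iffD2]) auto
    show "g ` {a..b} \<subseteq> f ` {a..b} \<union> {g a, g b}"
    proof
      fix y assume "y \<in> g ` {a..b}"
      then obtain s where s: "y = g s" "a \<le> s" "s \<le> b"
        by auto
      then consider "s = a" | "s = b" | "s \<in> {a<..<b}"
        by force
      then show "y \<in> f ` {a..b} \<union> {g a, g b}"
        using s assms(1)[of s, symmetric] by cases (auto intro!: image_eqI[of _ f s])
    qed
  qed
  ultimately show ?thesis
    unfolding pc_on_def using Z(1) by blast
qed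

lemma pc_on_compose:
  assumes f: "pc_on a b f" and h: "\<And>x. isCont h x" "\<And>S. bounded S \<Longrightarrow> bounded (h ` S)"
  shows "pc_on a b (\<lambda>s. h (f s))"
proof -
  obtain Z where Z: "finite Z" "\<And>s. s \<in> {a<..<b} - Z \<Longrightarrow> isCont f s"
    using f unfolding pc_on_def by auto
  have "bounded ((\<lambda>s. h (f s)) ` {a..b})"
    using h(2)[of "f ` {a..b}"] f unfolding pc_on_def image_image by simp
  moreover have "isCont (\<lambda>s. h (f s)) s" if "s \<in> {a<..<b} - Z" for s
    by (rule isCont_o2[OF Z(2)[OF that] h(1)])
  ultimately show ?thesis
    unfolding pc_on_def using Z(1) by blast
qed

lemma pc_on_bounded_linear:
  assumes f: "pc_on a b f" and h: "bounded_linear h"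
  shows "pc_on a b (\<lambda>s. h (f s))"
  by (rule pc_on_compose[OF f linear_continuous_at[OF h] bounded_linear_image[OF _ h]])

lemma pc_on_norm_sq:
  assumes f: "pc_on a b f"
  shows "pc_on a b (\<lambda>s. (norm (f s))\<^sup>2)"
proof (rule pc_on_compose[OF f])
  show "bounded ((\<lambda>x. (norm x)\<^sup>2) ` S)" if S: "bounded S" for S :: "'a set"
  proof -
    obtain M where M: "\<forall>x\<in>S. norm x \<le> M"
      using S unfolding bounded_iff by auto
    then have "norm ((norm x)\<^sup>2) \<le> M\<^sup>2" if "x \<in> S" for x
      using M that by (simp add: power_mono)
    then show ?thesis
      unfolding bounded_iff by blast
  qed
qed (intro continuous_intros)

lemma pc_on_norm:
  assumes f: "pc_on a b f"
  shows "pc_on a b (\<lambda>s. norm (f s))"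
  by (rule pc_on_compose[OF f]) (auto simp: bounded_norm_comp intro: continuous_intros)

lemma pc_on_add:
  assumes f: "pc_on a b f" and g: "pc_on a b g"
  shows "pc_on a b (\<lambda>s. f s + g s)"
proof -
  obtain Z where Z: "finite Z" "\<And>s. s \<in> {a<..<b} - Z \<Longrightarrow> isCont f s"
    using f unfolding pc_on_def by auto
  obtain Y where Y: "finite Y" "\<And>s. s \<in> {a<..<b} - Y \<Longrightarrow> isCont g s"
    using g unfolding pc_on_def by auto
  have "bounded ((\<lambda>s. f s + g s) ` {a..b})"
    using f g unfolding pc_on_def by (intro bounded_plus_comp) auto
  then show ?thesis
    unfolding pc_on_def using Z Y by (intro conjI exI[of _ "Z \<union> Y"]) auto
qed

lemma pc_on_scaleR: "pc_on a b f \<Longrightarrow> pc_on a b (\<lambda>s. c *\<^sub>R f s)"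
  by (rule pc_on_bounded_linear[OF _ bounded_linear_scaleR_right])

lemma pc_on_diff: "pc_on a b f \<Longrightarrow> pc_on a b g \<Longrightarrow> pc_on a b (\<lambda>s. f s - g s)"
  using pc_on_add[of a b f "\<lambda>s. (-1) *\<^sub>R g s"] pc_on_scaleR[of a b g "-1"] by simp

lemma pc_on_shift:
  assumes f: "pc_on (a + c) (b + c) f"
  shows "pc_on a b (\<lambda>s. f (s + c))"
proof -
  obtain Z where Z: "finite Z" "\<And>s. s \<in> {a+c<..<b+c} - Z \<Longrightarrow> isCont f s"
    using f unfolding pc_on_def by auto
  have "isCont (\<lambda>s. f (s + c)) s" if "s \<in> {a<..<b} - (\<lambda>z. z - c) ` Z" for s
  proof -
    have "isCont f (s + c)"
      using that by (intro Z) force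
    then show ?thesis
      by (rule isCont_o2[rotated]) (intro continuous_intros)
  qed
  moreover have "(\<lambda>s. f (s + c)) ` {a..b} = f ` {a+c..b+c}"
    by (auto simp: image_image simp flip: image_add_atLeastAtMost')
  ultimately show ?thesis
    using f Z(1) unfolding pc_on_def by (metis finite_imageI)
qed

section \<open>Truncation and continuous approximation of square-integrable controls\<close>

definition clip :: "real \<Rightarrow> 'a::real_normed_vector \<Rightarrow> 'a"
  where "clip R y = (R / max R (norm y)) *\<^sub>R y"

lemma norm_clip_le: "R > 0 \<Longrightarrow> norm (clip R y) \<le> R"
  by (auto simp: clip_def max_def)

lemma norm_clip_diff_le: "R > 0 \<Longrightarrow> norm (y - clip R y) \<le> norm y"
proof -
  assume R: "R > 0"
  have "y - clip R y = (1 - R / max R (norm y)) *\<^sub>R y"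
    by (simp add: clip_def algebra_simps)
  moreover have "0 \<le> 1 - R / max R (norm y)" "1 - R / max R (norm y) \<le> 1"
    using R by (auto simp: max_def divide_simps)
  ultimately show ?thesis
    by (simp add: mult_left_le_one_le)
qed

lemma clip_eq: "norm y \<le> R \<Longrightarrow> R > 0 \<Longrightarrow> clip R y = y"
  by (auto simp: clip_def max_def)

lemma isCont_clip: "R > 0 \<Longrightarrow> isCont (clip R) y"
  unfolding clip_def by (intro continuous_intros) (auto simp: max_def)

lemma clip_tendsto: "(\<lambda>j. clip (real (Suc j)) y) \<longlonglongrightarrow> y"
proof -
  obtain N where N: "norm y \<le> real N"
    using real_arch_simple by auto
  have "\<forall>\<^sub>F j in sequentially. clip (real (Suc j)) y = y"
    using N by (intro eventually_sequentiallyI[of N] clip_eq) auto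
  then show ?thesis
    by (rule tendsto_eventually)
qed

lemma norm_diff_sq_le: "(norm (x - y))\<^sup>2 \<le> 2 * (norm x)\<^sup>2 + 2 * (norm y)\<^sup>2"
proof -
  have "(norm (x - y))\<^sup>2 \<le> (norm x + norm y)\<^sup>2"
    by (intro power_mono norm_triangle_ineq4) auto
  also have "\<dots> \<le> 2 * (norm x)\<^sup>2 + 2 * (norm y)\<^sup>2"
    using sum_squares_bound[of "norm x" "norm y"] by (simp add: power2_sum)
  finally show ?thesis .
qed

text \<open>Almost everywhere convergence of continuous functions comes without a majorant.
  Truncating them radially at a level \<open>R\<close> supplies one; the loss
  \<open>u - clip R u\<close> is dominated by \<open>u\<close> itself and vanishes as
  \<open>R\<close> grows.\<close>

lemma L2_control_approx:
  fixes u :: "real \<Rightarrow> 'u::{real_inner,banach}"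
  assumes u: "L2_control T u" and "e > 0"
  obtains g where "continuous_on UNIV g" "(\<lambda>t. (norm (u t - g t))\<^sup>2) integrable_on {0..T}"
    "integral {0..T} (\<lambda>t. (norm (u t - g t))\<^sup>2) < e"
proof -
  obtain N g where N: "negligible N" and g: "\<And>n. continuous_on UNIV (g n)"
    and gN: "\<And>t. t \<notin> N \<Longrightarrow> (\<lambda>n. g n t) \<longlonglongrightarrow> (if t \<in> {0..T} then u t else 0)"
    using u unfolding L2_control_def measurable_on_def by blast
  have g_lim: "(\<lambda>n. g n t) \<longlonglongrightarrow> u t" if "t \<in> {0..T} - N" for t
    using gN[of t] that by auto
  \<comment> \<open>Removing the null set from the domain makes the limits hold at every point of
    it, as dominated convergence requires.\<close>
  have spike: "f integrable_on {0..T} \<longleftrightarrow> f integrable_on ({0..T} - N)" for f :: "real \<Rightarrow> real"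
    by (rule integrable_spike_set_eq) (auto intro: negligible_subset[OF N])
  have spike_eq: "integral {0..T} f = integral ({0..T} - N) f" for f :: "real \<Rightarrow> real"
    by (rule integral_spike_set) (auto intro: negligible_subset[OF N])
  have u2: "(\<lambda>t. (norm (u t))\<^sup>2) integrable_on ({0..T} - N)"
    using u unfolding L2_control_def spike[symmetric] by (simp add: set_lebesgue_integral_eq_integral(1))
  have const: "(\<lambda>t. c) integrable_on ({0..T} - N)" for c :: real
    unfolding spike[symmetric] by (rule integrable_const_ivl)
  have dom: "(\<lambda>t. 2 * (norm (u t))\<^sup>2 + 2 * c) integrable_on ({0..T} - N)" for c :: real
    using u2 const by (intro integrable_add integrable_on_mult_right)
  have clipg: "(\<lambda>k. clip R (g k t)) \<longlonglongrightarrow> clip R (u t)" if "R > 0" "t \<in> {0..T} - N" for R t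
    using isCont_tendsto_compose[OF isCont_clip[OF that(1)] g_lim[OF that(2)]] .
  have cont: "continuous_on UNIV (\<lambda>t. clip R (g k t))" if "R > 0" for R k
    using g[of k] isCont_clip[OF that] by (auto simp: continuous_on_eq_continuous_at intro: isCont_o2)
  have sq_le: "(norm (x - clip R y))\<^sup>2 \<le> 2 * (norm x)\<^sup>2 + 2 * R\<^sup>2" if "R > 0" for R and x y :: 'u
    using norm_diff_sq_le[of x "clip R y"] power_mono[OF norm_clip_le[OF that, of y], of 2] by simp
  \<comment> \<open>Three dominated limits with \<open>R\<close> fixed: \<open>g j\<close> becomes
    \<open>u\<close> under its truncation, then the truncation of \<open>u\<close> is removed, then
    \<open>g k\<close> becomes \<open>u\<close> under the second truncation. Only afterwards does
    the radius tend to infinity.\<close>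
  have step1: "(\<lambda>t. (norm (clip R' (u t) - clip R (g k t)))\<^sup>2) integrable_on ({0..T} - N)"
    if R: "R' > 0" "R > 0" for R R' k
  proof (rule dominated_convergence(1)[where f = "\<lambda>j t. (norm (clip R' (g j t) - clip R (g k t)))\<^sup>2"
        and h = "\<lambda>_. 2 * R'\<^sup>2 + 2 * R\<^sup>2"])
    fix j
    have "continuous_on {0..T} (\<lambda>t. (norm (clip R' (g j t) - clip R (g k t)))\<^sup>2)"
      using cont R by (intro continuous_intros) (auto intro: continuous_on_subset)
    then show "(\<lambda>t. (norm (clip R' (g j t) - clip R (g k t)))\<^sup>2) integrable_on ({0..T} - N)"
      unfolding spike[symmetric] by (rule integrable_continuous_real)
    show "norm ((norm (clip R' (g j t) - clip R (g k t)))\<^sup>2) \<le> 2 * R'\<^sup>2 + 2 * R\<^sup>2" for t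
      using sq_le[OF R(2), of "clip R' (g j t)" "g k t"] power_mono[OF norm_clip_le[OF R(1), of "g j t"], of 2]
      by simp
  qed (use const clipg R in \<open>auto intro!: tendsto_intros\<close>)
  have step2: "(\<lambda>t. (norm (u t - clip R (g k t)))\<^sup>2) integrable_on ({0..T} - N)" if R: "R > 0" for R k
  proof (rule dominated_convergence(1)[where f = "\<lambda>j t. (norm (clip (real (Suc j)) (u t) - clip R (g k t)))\<^sup>2"
        and h = "\<lambda>t. 2 * (norm (u t))\<^sup>2 + 2 * R\<^sup>2"])
    show "norm ((norm (clip (real (Suc j)) (u t) - clip R (g k t)))\<^sup>2) \<le> 2 * (norm (u t))\<^sup>2 + 2 * R\<^sup>2" for j t
    proof -
      have "norm (clip (real (Suc j)) (u t)) \<le> norm (u t)"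
        using norm_clip_le[of "real (Suc j)" "u t"] clip_eq[of "u t" "real (Suc j)"]
        by (cases "norm (u t) \<le> real (Suc j)") auto
      then have "(norm (clip (real (Suc j)) (u t)))\<^sup>2 \<le> (norm (u t))\<^sup>2"
        by (intro power_mono) auto
      then have "2 * (norm (clip (real (Suc j)) (u t)))\<^sup>2 + 2 * R\<^sup>2 \<le> 2 * (norm (u t))\<^sup>2 + 2 * R\<^sup>2"
        by linarith
      from order_trans[OF sq_le[OF R] this] show ?thesis
        by simp
    qed
    show "(\<lambda>j. (norm (clip (real (Suc j)) (u t) - clip R (g k t)))\<^sup>2) \<longlonglongrightarrow> (norm (u t - clip R (g k t)))\<^sup>2" for t
      by (intro tendsto_intros clip_tendsto)
  qed (use dom step1 R in auto)
  have step3: "(\<lambda>t. (norm (u t - clip R (u t)))\<^sup>2) integrable_on ({0..T} - N)"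
    "(\<lambda>k. integral ({0..T} - N) (\<lambda>t. (norm (u t - clip R (g k t)))\<^sup>2))
      \<longlonglongrightarrow> integral ({0..T} - N) (\<lambda>t. (norm (u t - clip R (u t)))\<^sup>2)" if R: "R > 0" for R
  proof -
    have *: "norm ((norm (u t - clip R (g k t)))\<^sup>2) \<le> 2 * (norm (u t))\<^sup>2 + 2 * R\<^sup>2" for k t
      using sq_le[OF R] by simp
    have **: "(\<lambda>k. (norm (u t - clip R (g k t)))\<^sup>2) \<longlonglongrightarrow> (norm (u t - clip R (u t)))\<^sup>2"
      if "t \<in> {0..T} - N" for t
      by (intro tendsto_intros clipg[OF R that])
    note dominated_convergence[where f = "\<lambda>k t. (norm (u t - clip R (g k t)))\<^sup>2", OF step2[OF R] dom * **]
    then show "(\<lambda>t. (norm (u t - clip R (u t)))\<^sup>2) integrable_on ({0..T} - N)"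
      "(\<lambda>k. integral ({0..T} - N) (\<lambda>t. (norm (u t - clip R (g k t)))\<^sup>2))
      \<longlonglongrightarrow> integral ({0..T} - N) (\<lambda>t. (norm (u t - clip R (u t)))\<^sup>2)"
      by simp_all
  qed
  have "(\<lambda>j. integral ({0..T} - N) (\<lambda>t. (norm (u t - clip (real (Suc j)) (u t)))\<^sup>2))
      \<longlonglongrightarrow> integral ({0..T} - N) (\<lambda>t. 0)"
  proof (rule dominated_convergence(2)[OF _ u2])
    show "norm ((norm (u t - clip (real (Suc j)) (u t)))\<^sup>2) \<le> (norm (u t))\<^sup>2" for j t
      using norm_clip_diff_le[of "real (Suc j)" "u t"] by (simp add: power_mono)
    show "(\<lambda>j. (norm (u t - clip (real (Suc j)) (u t)))\<^sup>2) \<longlonglongrightarrow> 0" for t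
      using tendsto_power[OF tendsto_norm[OF tendsto_diff[OF tendsto_const clip_tendsto[of "u t"]]], of "u t" 2] by simp
  qed (use step3 in auto)
  then obtain j where j: "integral ({0..T} - N) (\<lambda>t. (norm (u t - clip (real (Suc j)) (u t)))\<^sup>2) < e"
    using \<open>e > 0\<close> order_tendstoD(2)[of _ "0::real" sequentially e] by (force simp: eventually_sequentially)
  obtain k where k: "integral ({0..T} - N) (\<lambda>t. (norm (u t - clip (real (Suc j)) (g k t)))\<^sup>2) < e"
    using order_tendstoD(2)[OF step3(2) j] by (force simp: eventually_sequentially)
  show ?thesis
    using that[of "\<lambda>t. clip (real (Suc j)) (g k t)"] cont[of "real (Suc j)" k] step2[of "real (Suc j)" k] k
    unfolding spike spike_eq by simp
qed

section \<open>Mild solutions\<close>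

lemma (in hilbert_space) scale_bounded_linear: "bounded_linear (scale c)"
proof
  show "scale c (r *\<^sub>R x) = r *\<^sub>R scale c x" for r x
    by (metis mult.commute scale_of_real scale_scale)
  show "\<exists>K. \<forall>x. norm (scale c x) \<le> norm x * K"
    by (intro exI[of _ "norm c"]) (simp add: norm_scale mult.commute)
qed (simp add: scale_right_distrib)

locale bounded_control =
  fixes sX :: "'k::real_normed_field \<Rightarrow> 'x::{real_inner,banach} \<Rightarrow> 'x"
    and sU :: "'k \<Rightarrow> 'u::{real_inner,banach} \<Rightarrow> 'u"
    and S :: "real \<Rightarrow> 'x \<Rightarrow>\<^sub>L 'x" and B :: "'u \<Rightarrow>\<^sub>L 'x"
  assumes hilbert_X: "hilbert_space sX" and hilbert_U: "hilbert_space sU"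
    and semigroup: "C0_semigroup sX S" and linear_B: "bounded_op sU sX B"
begin

abbreviation X :: "'x \<Rightarrow> (real \<Rightarrow> 'u) \<Rightarrow> real \<Rightarrow> 'x"
  where "X \<equiv> mild_solution S B"

section \<open>Local boundedness and strong continuity of the semigroup\<close>

lemma S_0: "S 0 x = x"
  using semigroup by (simp add: C0_semigroup_def)

lemma S_add: "0 \<le> s \<Longrightarrow> 0 \<le> t \<Longrightarrow> S (s + t) x = S s (S t x)"
  using semigroup by (simp add: C0_semigroup_def)

lemma S_right: "((\<lambda>t. S t x) \<longlongrightarrow> x) (at_right 0)"
  using semigroup by (simp add: C0_semigroup_def)

text \<open>Uniform boundedness by Baire: right continuity at \<open>0\<close> bounds each orbit on
  some interval whose length depends on the state, so in \<open>C n\<close> one index controls both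
  the bound and the length.\<close>

lemma S_bounded_near_0: "\<exists>\<delta>>0. \<exists>M\<ge>1. \<forall>t\<in>{0..\<delta>}. norm (S t) \<le> M"
proof -
  define C where "C n = {x. \<forall>t\<in>{0<..1 / real (Suc n)}. norm (S t x) \<le> real n}" for n
  have "closed (C n)" for n
  proof -
    have "C n = (\<Inter>t\<in>{0<..1 / real (Suc n)}. {x. norm (S t x) \<le> real n})"
      by (auto simp: C_def)
    moreover have "closed {x. norm (S t x) \<le> real n}" for t
      by (intro closed_Collect_le continuous_intros)
    ultimately show ?thesis
      by auto
  qed
  moreover have "\<exists>n. x \<in> C n" for x
  proof -
    have "\<forall>\<^sub>F t in at_right 0. norm (S t x) < norm x + 1"
      by (intro order_tendstoD(2)[OF tendsto_norm[OF S_right]]) simp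
    then obtain b where b: "b > 0" "\<And>t. 0 < t \<Longrightarrow> t < b \<Longrightarrow> norm (S t x) < norm x + 1"
      unfolding eventually_at_right_field by auto
    obtain n1 where n1: "1 / real (Suc n1) < b"
      using reals_Archimedean[OF b(1)] by (auto simp: inverse_eq_divide)
    obtain n2 where n2: "norm x + 1 \<le> real n2"
      using real_arch_simple by blast
    define n where "n = max n1 n2"
    have "1 / real (Suc n) \<le> 1 / real (Suc n1)"
      by (intro divide_left_mono) (auto simp: n_def)
    then have "norm (S t x) \<le> real n" if "t \<in> {0<..1 / real (Suc n)}" for t
      using that n1 n2 b(2)[of t] by (auto simp: n_def)
    then show ?thesis
      unfolding C_def by blast
  qed
  ultimately obtain n x r where r: "r > 0" "ball x r \<subseteq> C n"
    using closed_cover_contains_ball[of C] by metis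
  \<comment> \<open>A vector of length \<open>r / 2\<close> is a difference of two points of the
    ball, so its image has norm at most \<open>2 * n\<close>; this gives the factor
    \<open>4 * n / r\<close>. The \<open>1\<close> covers the identity at time
    \<open>0\<close>.\<close>
  define M where "M = max 1 (4 * real n / r)"
  have "norm (S t) \<le> M" if t: "t \<in> {0..1 / real (Suc n)}" for t
  proof (cases "t = 0")
    case True
    then show ?thesis
      using semigroup norm_blinfun_id_le[where 'a = 'x] by (simp add: C0_semigroup_def M_def)
  next
    case False
    have small: "norm (S t y) \<le> real n" if "y \<in> ball x r" for y
      using r(2) that t False unfolding C_def by auto
    have "norm (S t z) \<le> 4 * real n / r * norm z" for z
    proof (cases "z = 0")
      case False
      define c where "c = r / (2 * norm z)"
      have "c > 0" and cz: "norm (c *\<^sub>R z) < r"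
        using False r by (auto simp: c_def)
      have "c * norm (S t z) = norm (S t (x + c *\<^sub>R z) - S t x)"
        using \<open>c > 0\<close> by (simp add: blinfun.add_right blinfun.scaleR_right)
      also have "\<dots> \<le> norm (S t (x + c *\<^sub>R z)) + norm (S t x)"
        by (rule norm_triangle_ineq4)
      also have "\<dots> \<le> real n + real n"
        using cz r by (intro add_mono small) (auto simp: dist_norm)
      finally have "r * norm (S t z) \<le> 4 * real n * norm z"
        using False by (simp add: c_def field_simps)
      then show ?thesis
        using r by (simp add: field_simps)
    qed simp
    then have "norm (S t) \<le> 4 * real n / r"
      using r by (intro norm_blinfun_bound) auto
    then show ?thesis
      by (simp add: M_def)
  qed
  then show ?thesis
    by (intro exI[of _ "1 / real (Suc n)"] conjI exI[of _ M]) (auto simp: M_def)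
qed

lemma S_locally_bounded: "\<exists>M\<ge>1. \<forall>t\<in>{0..h}. norm (S t) \<le> M"
proof -
  obtain \<delta> M where \<delta>: "\<delta> > 0" and M: "M \<ge> 1" "\<And>t. t \<in> {0..\<delta>} \<Longrightarrow> norm (S t) \<le> M"
    using S_bounded_near_0 by metis
  have bound: "norm (S t) \<le> M ^ Suc n" if "0 \<le> t" "t \<le> real (Suc n) * \<delta>" for t n
    using that
  proof (induction n arbitrary: t)
    case 0
    then show ?case
      using M(2)[of t] by simp
  next
    case (Suc n)
    show ?case
    proof (cases "t \<le> \<delta>")
      case True
      have "M ^ 1 \<le> M ^ Suc (Suc n)"
        using M(1) by (intro power_increasing) auto
      then show ?thesis
        using M(2)[of t] True Suc.prems by simp
    next
      case False
      then have "S t = S \<delta> o\<^sub>L S (t - \<delta>)"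
        using S_add[of \<delta> "t - \<delta>"] \<delta> by (intro blinfun_eqI) simp
      moreover have "norm (S (t - \<delta>)) \<le> M ^ Suc n"
        using False Suc.prems by (intro Suc.IH) (auto simp: algebra_simps)
      moreover have "norm (S \<delta>) \<le> M"
        using \<delta> by (intro M(2)) auto
      ultimately have "norm (S t) \<le> M * M ^ Suc n"
        using norm_blinfun_compose[of "S \<delta>" "S (t - \<delta>)"] M(1)
        by (smt (verit) mult_mono norm_ge_zero)
      then show ?thesis
        by simp
    qed
  qed
  obtain n where n: "h \<le> real n * \<delta>"
    using reals_Archimedean3[OF \<delta>] less_imp_le by blast
  have "norm (S t) \<le> M ^ Suc n" if "t \<in> {0..h}" for t
    using that n \<delta> by (intro bound) (auto simp: algebra_simps)
  moreover have "1 \<le> M ^ Suc n"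
    using M(1) by (rule one_le_power)
  ultimately show ?thesis
    by blast
qed

definition S_sup :: "real \<Rightarrow> real"
  where "S_sup h = (SOME M. M \<ge> 1 \<and> (\<forall>t\<in>{0..h}. norm (S t) \<le> M))"

lemma S_sup: "S_sup h \<ge> 1" "t \<in> {0..h} \<Longrightarrow> norm (S t) \<le> S_sup h"
  using someI_ex[of "\<lambda>M. M \<ge> 1 \<and> (\<forall>t\<in>{0..h}. norm (S t) \<le> M)"] S_locally_bounded[of h]
  unfolding S_sup_def by blast+

lemma norm_S_le: "0 \<le> t \<Longrightarrow> t \<le> h \<Longrightarrow> norm (S t x) \<le> S_sup h * norm x"
  using norm_blinfun[of "S t" x] S_sup(2)[of t h] mult_right_mono[of "norm (S t)" "S_sup h" "norm x"]
  by fastforce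

text \<open>Both one-sided limits follow from the one at \<open>0\<close>: factoring out the
  semigroup at the smaller time leaves \<open>S \<bar>t - a\<bar> x - x\<close>, and local
  boundedness controls the factor.\<close>

lemma S_continuous: "continuous_on {0..} (\<lambda>t. S t x)"
  unfolding continuous_on_def
proof
  fix a :: real
  assume a: "a \<in> {0..}"
  have dist: "norm (S t x - S a x) \<le> S_sup (a + 1) * norm (S \<bar>t - a\<bar> x - x)" if "0 \<le> t" "t \<le> a + 1" for t
  proof -
    have main: "norm (S (s + d) x - S s x) \<le> S_sup (a + 1) * norm (S d x - x)"
      if "0 \<le> s" "0 \<le> d" "s \<le> a + 1" for s d
      using norm_S_le[of s "a + 1" "S d x - x"] that by (simp add: S_add blinfun.diff_right)
    show ?thesis
      using main[of a "t - a"] main[of t "a - t"] that a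
      by (cases "a \<le> t") (auto simp: norm_minus_commute)
  qed
  have "filterlim (\<lambda>t. \<bar>t - a\<bar>) (at_right 0) (at a within {0..})"
    unfolding filterlim_at
    by (auto simp: eventually_at_filter intro!: tendsto_eq_intros)
  then have "((\<lambda>t. S \<bar>t - a\<bar> x) \<longlongrightarrow> x) (at a within {0..})"
    using S_right filterlim_compose by blast
  from tendsto_diff[OF this tendsto_const[of x]]
  have "((\<lambda>t. S_sup (a + 1) * norm (S \<bar>t - a\<bar> x - x)) \<longlongrightarrow> 0) (at a within {0..})"
    by (auto intro!: tendsto_mult_right_zero tendsto_norm_zero)
  moreover have "\<forall>\<^sub>F t in at a within {0..}. t < a + 1"
    by (rule order_tendstoD(2)[OF tendsto_ident_at]) simp
  then have "\<forall>\<^sub>F t in at a within {0..}. norm (S t x - S a x) \<le> S_sup (a + 1) * norm (S \<bar>t - a\<bar> x - x)"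
    unfolding eventually_at_filter by eventually_elim (auto intro!: dist)
  ultimately have "((\<lambda>t. S t x - S a x) \<longlongrightarrow> 0) (at a within {0..})"
    by (rule Lim_null_comparison[rotated])
  then show "((\<lambda>t. S t x) \<longlongrightarrow> S a x) (at a within {0..})"
    using Lim_null by blast
qed

lemma S_tendsto:
  assumes f: "(f \<longlongrightarrow> a) F" "\<forall>\<^sub>F s in F. f s \<ge> 0" "a \<ge> 0" and v: "(v \<longlongrightarrow> y) F"
  shows "((\<lambda>s. S (f s) (v s)) \<longlongrightarrow> S a y) F"
proof -
  have "((\<lambda>s. S (f s) y) \<longlongrightarrow> S a y) F"
    using f by (intro continuous_on_tendsto_compose[OF S_continuous f(1)]) auto
  moreover have "((\<lambda>s. S (f s) (v s - y)) \<longlongrightarrow> 0) F"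
  proof (rule Lim_null_comparison)
    have "\<forall>\<^sub>F s in F. f s < a + 1"
      by (rule order_tendstoD(2)[OF f(1)]) simp
    with f(2) show "\<forall>\<^sub>F s in F. norm (S (f s) (v s - y)) \<le> S_sup (a + 1) * norm (v s - y)"
      by eventually_elim (auto intro!: norm_S_le)
    show "((\<lambda>s. S_sup (a + 1) * norm (v s - y)) \<longlongrightarrow> 0) F"
      using v by (intro tendsto_mult_right_zero tendsto_norm_zero) (simp add: LIM_zero)
  qed
  ultimately have "((\<lambda>s. S (f s) y + S (f s) (v s - y)) \<longlongrightarrow> S a y + 0) F"
    by (rule tendsto_add)
  then show ?thesis
    by (simp add: blinfun.diff_right)
qed

section \<open>Piecewise continuous controls and the variation of constants formula\<close>

definition pc :: "(real \<Rightarrow> 'u) \<Rightarrow> bool"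
  where "pc u \<longleftrightarrow> (\<forall>b. pc_on 0 b u)"

lemma pc_on_integrand:
  assumes u: "pc_on 0 t u"
  shows "pc_on 0 t (\<lambda>s. S (t - s) (B (u s)))"
proof -
  obtain M where M: "M > 0" "\<And>s. s \<in> {0..t} \<Longrightarrow> norm (u s) \<le> M"
    using u pc_on_bound by blast
  obtain Z where Z: "finite Z" "\<And>s. s \<in> {0<..<t} - Z \<Longrightarrow> isCont u s"
    using u unfolding pc_on_def by auto
  have "norm (S (t - s) (B (u s))) \<le> S_sup t * (norm B * M)" if "s \<in> {0..t}" for s
  proof -
    have "norm (S (t - s) (B (u s))) \<le> S_sup t * norm (B (u s))"
      using that by (intro norm_S_le) auto
    also have "\<dots> \<le> S_sup t * (norm B * M)"
      using M(2)[OF that] norm_blinfun[of B "u s"] S_sup(1)[of t]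
      by (intro mult_left_mono order_trans[OF norm_blinfun]) auto
    finally show ?thesis .
  qed
  then have "bounded ((\<lambda>s. S (t - s) (B (u s))) ` {0..t})"
    unfolding bounded_iff by blast
  moreover have "isCont (\<lambda>s. S (t - s) (B (u s))) s" if "s \<in> {0<..<t} - Z" for s
    unfolding isCont_def
  proof (rule S_tendsto)
    show "((\<lambda>s. B (u s)) \<longlongrightarrow> B (u s)) (at s)"
      using Z(2)[OF that] by (intro blinfun.tendsto tendsto_const) (simp add: isCont_def)
    have "\<forall>\<^sub>F r in at s. r < t"
      using that by (intro order_tendstoD(2)[OF tendsto_ident_at]) auto
    then show "\<forall>\<^sub>F r in at s. 0 \<le> t - r"
      by eventually_elim simp
  qed (use that in \<open>auto intro!: tendsto_intros\<close>)
  ultimately show ?thesis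
    unfolding pc_on_def using Z(1) by blast
qed

lemma integrable_integrand: "pc_on 0 t u \<Longrightarrow> (\<lambda>s. S (t - s) (B (u s))) integrable_on {0..t}"
  by (intro pc_on_integrable pc_on_integrand)

lemma norm_integrand_le:
  assumes "s \<in> {0..t}" "t \<le> h"
  shows "norm (S (t - s) (B y)) \<le> S_sup h * norm B * norm y"
proof -
  have "norm (S (t - s) (B y)) \<le> S_sup h * norm (B y)"
    using assms by (intro norm_S_le) auto
  also have "\<dots> \<le> S_sup h * (norm B * norm y)"
    using S_sup(1)[of h] by (intro mult_left_mono norm_blinfun) auto
  finally show ?thesis
    by (simp add: mult.assoc)
qed

lemma norm_input_le:
  assumes u: "pc_on 0 t u" and t: "0 \<le> t" "t \<le> h"
  shows "norm (integral {0..t} (\<lambda>s. S (t - s) (B (u s)))) \<le> S_sup h * norm B * integral {0..t} (\<lambda>s. norm (u s))"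
proof -
  have "norm (integral {0..t} (\<lambda>s. S (t - s) (B (u s)))) \<le> integral {0..t} (\<lambda>s. S_sup h * norm B * norm (u s))"
    using t norm_integrand_le
    by (intro integral_norm_bound_integral integrable_integrand u integrable_on_mult_right pc_on_integrable pc_on_norm) auto
  then show ?thesis
    by simp
qed

lemma integral_norm_le:
  fixes u :: "real \<Rightarrow> 'b::banach"
  assumes u: "pc_on 0 t u" and t: "0 \<le> t"
  shows "integral {0..t} (\<lambda>s. norm (u s)) \<le> sqrt t * sqrt (integral {0..t} (\<lambda>s. (norm (u s))\<^sup>2))"
proof -
  have "(integral {0..t} (\<lambda>s. norm (u s)))\<^sup>2 \<le> t * integral {0..t} (\<lambda>s. (norm (u s))\<^sup>2)"
    by (intro integral_sq_le t pc_on_integrable pc_on_norm pc_on_norm_sq u)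
  then show ?thesis
    by (simp add: real_le_rsqrt flip: real_sqrt_mult)
qed

text \<open>The factor \<open>sqrt t\<close> comes from Cauchy-Schwarz in time and makes inputs of
  bounded energy small on short intervals.\<close>

lemma norm_input_le_sqrt:
  assumes u: "pc_on 0 t u" and t: "0 \<le> t" "t \<le> h" and E: "integral {0..t} (\<lambda>s. (norm (u s))\<^sup>2) \<le> E"
  shows "norm (integral {0..t} (\<lambda>s. S (t - s) (B (u s)))) \<le> S_sup h * norm B * (sqrt t * sqrt E)"
proof -
  have "norm (integral {0..t} (\<lambda>s. S (t - s) (B (u s)))) \<le> S_sup h * norm B * integral {0..t} (\<lambda>s. norm (u s))"
    by (rule norm_input_le[OF u t])
  also have "\<dots> \<le> S_sup h * norm B * (sqrt t * sqrt E)"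
    using S_sup(1)[of h] E t
    by (intro mult_left_mono order_trans[OF integral_norm_le[OF u]] real_sqrt_le_mono) auto
  finally show ?thesis .
qed

lemma X_add:
  assumes "pc_on 0 t u" "pc_on 0 t v"
  shows "X (x + y) (\<lambda>s. u s + v s) t = X x u t + X y v t"
  unfolding mild_solution_def blinfun.add_right
  by (subst integral_add) (use assms in \<open>auto intro: integrable_integrand\<close>)

lemma X_scaleR: "X (r *\<^sub>R x) (\<lambda>s. r *\<^sub>R u s) t = r *\<^sub>R X x u t"
  unfolding mild_solution_def blinfun.scaleR_right by (simp add: scaleR_add_right)

lemma X_diff:
  assumes "pc_on 0 t u" "pc_on 0 t v"
  shows "X (x - y) (\<lambda>s. u s - v s) t = X x u t - X y v t"
  using X_add[of t u "\<lambda>s. (-1) *\<^sub>R v s" x "(-1) *\<^sub>R y"] X_scaleR[of "-1" y v t] assms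
    pc_on_scaleR[of 0 t v "-1"]
  by simp

lemma X_scale:
  assumes u: "pc_on 0 t u" and t: "0 \<le> t"
  shows "X (sX c x) (\<lambda>s. sU c (u s)) t = sX c (X x u t)"
proof -
  interpret hX: hilbert_space sX by (rule hilbert_X)
  have S_scale: "S r (sX c y) = sX c (S r y)" if "0 \<le> r" for r y
    using semigroup that by (simp add: C0_semigroup_def bounded_op_def Vector_Spaces.linear_iff)
  have B_scale: "B (sU c y) = sX c (B y)" for y
    using linear_B by (simp add: bounded_op_def Vector_Spaces.linear_iff)
  have "integral {0..t} (\<lambda>s. S (t - s) (B (sU c (u s)))) = integral {0..t} (\<lambda>s. sX c (S (t - s) (B (u s))))"
    by (intro integral_cong) (simp add: S_scale B_scale)
  also have "\<dots> = sX c (integral {0..t} (\<lambda>s. S (t - s) (B (u s))))"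
    using integral_linear[OF integrable_integrand[OF u] hilbert_space.scale_bounded_linear[OF hilbert_X, of c]] by (simp add: o_def)
  finally show ?thesis
    unfolding mild_solution_def using t by (simp add: S_scale hX.scale_right_distrib)
qed

lemma X_cong:
  assumes "\<And>s. s \<in> {0..<t} \<Longrightarrow> u s = v s"
  shows "X x u t = X x v t"
proof -
  have "integral {0..t} (\<lambda>s. S (t - s) (B (u s))) = integral {0..t} (\<lambda>s. S (t - s) (B (v s)))"
    by (rule integral_spike[of "{t}"]) (auto simp: assms)
  then show ?thesis
    by (simp add: mild_solution_def)
qed

lemma X_concat:
  assumes u: "pc_on 0 (h + t) u" and h: "0 \<le> h" "0 \<le> t"
  shows "X x u (h + t) = X (X x u h) (\<lambda>s. u (s + h)) t"
proof -
  let ?f = "\<lambda>s. S (h + t - s) (B (u s))"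
  have f: "?f integrable_on {0..h + t}"
    by (rule integrable_integrand[OF u])
  have "integral {0..h} ?f = integral {0..h} (\<lambda>s. S t (S (h - s) (B (u s))))"
    using h by (intro integral_cong) (simp flip: S_add add: algebra_simps)
  also have "\<dots> = S t (integral {0..h} (\<lambda>s. S (h - s) (B (u s))))"
    using integral_linear[OF integrable_integrand[of h u] blinfun.bounded_linear_right[of "S t"]]
      pc_on_subset[OF u, of 0 h] h by (simp add: o_def)
  finally have 1: "integral {0..h} ?f = S t (integral {0..h} (\<lambda>s. S (h - s) (B (u s))))" .
  have 2: "integral {h..h + t} ?f = integral {0..t} (\<lambda>s. S (t - s) (B (u (s + h))))"
    using integral_shift_real_ivl[of h h "h + t" ?f] by simp
  have "integral {0..h + t} ?f = integral {0..h} ?f + integral {h..h + t} ?f"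
    using Henstock_Kurzweil_Integration.integral_combine[of 0 h "h + t" ?f] f h by simp
  moreover have "S (h + t) x = S t (S h x)"
    using S_add[of t h x] h by (simp add: add.commute)
  ultimately show ?thesis
    unfolding mild_solution_def 1 2 by (simp add: blinfun.add_right)
qed

lemma X_0: "X x u 0 = x"
  by (simp add: mild_solution_def S_0)

lemma norm_X_diff_le:
  assumes u: "pc_on 0 t u" "pc_on 0 t v" and t: "0 \<le> t" "t \<le> h"
    and E: "integral {0..t} (\<lambda>s. (norm (u s - v s))\<^sup>2) \<le> E"
  shows "norm (X x u t - X x v t) \<le> S_sup h * norm B * (sqrt t * sqrt E)"
proof -
  have "X x u t - X x v t = integral {0..t} (\<lambda>s. S (t - s) (B (u s - v s)))"
    using X_diff[OF u, of x x] by (simp add: mild_solution_def)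
  then show ?thesis
    using norm_input_le_sqrt[OF pc_on_diff[OF u] t E] by simp
qed

text \<open>The trajectory is restarted at a time \<open>a\<close> shortly before \<open>t\<close>.
  Up to time \<open>t + d\<close> the input then contributes at most \<open>e / 4\<close>, so
  continuity of the state reduces to that of the orbit of \<open>X x u a\<close>.\<close>

lemma X_continuous:
  assumes u: "pc u"
  shows "continuous_on {0..} (X x u)"
  unfolding continuous_on_iff
proof (intro ballI allI impI)
  fix t e :: real
  assume t: "t \<in> {0..}" and "e > 0"
  obtain M where M: "M > 0" "\<And>s. s \<in> {0..t+1} \<Longrightarrow> norm (u s) \<le> M"
    using u pc_on_bound unfolding pc_def by blast
  define L where "L = S_sup 2 * norm B * M + 1"
  have "L > 0"
    using M(1) S_sup(1)[of 2] by (simp add: L_def add_nonneg_pos)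
  \<comment> \<open>\<open>d \<le> 1/2\<close> keeps the elapsed times
    \<open>r - a \<le> 2 * d\<close> within the horizon of \<open>S_sup 2\<close> and the control
    values within reach of \<open>M\<close>; the other bound makes the input contribute at most
    \<open>e / 4\<close>.\<close>
  define d where "d = min (1/2) (e / (8 * L))"
  have d: "d > 0" "d \<le> 1/2" "L * (2 * d) \<le> e / 4"
    using \<open>e > 0\<close> \<open>L > 0\<close> by (auto simp: d_def min_def field_simps)
  define a where "a = max 0 (t - d)"
  have a: "0 \<le> a" "a \<le> t" "t - a \<le> d"
    using t d by (auto simp: a_def)
  have near: "norm (X x u r - S (r - a) (X x u a)) \<le> e / 4" if r: "a \<le> r" "r \<le> t + d" for r
  proof -
    have pcr: "pc_on 0 (r - a) (\<lambda>s. u (s + a))"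
      using u a r unfolding pc_def by (intro pc_on_shift) (auto intro: pc_on_subset[where a = 0 and b = r])
    have "X x u r = X (X x u a) (\<lambda>s. u (s + a)) (r - a)"
      using X_concat[of a "r - a" u x] u a r unfolding pc_def by simp
    then have "norm (X x u r - S (r - a) (X x u a))
        = norm (integral {0..r - a} (\<lambda>s. S (r - a - s) (B (u (s + a)))))"
      by (simp add: mild_solution_def)
    also have "\<dots> \<le> S_sup 2 * norm B * integral {0..r - a} (\<lambda>s. norm (u (s + a)))"
      using r a d by (intro norm_input_le pcr) auto
    also have "\<dots> \<le> S_sup 2 * norm B * integral {0..r - a} (\<lambda>s. M)"
      using S_sup(1)[of 2] r a d
      by (intro mult_left_mono integral_le pc_on_integrable[OF pc_on_norm[OF pcr]] integrable_const_ivl M(2)) auto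
    also have "\<dots> = (L - 1) * (r - a)"
      using r by (simp add: L_def)
    also have "\<dots> \<le> L * (2 * d)"
      using r a \<open>L > 0\<close> by (intro mult_mono) auto
    finally show ?thesis
      using d by simp
  qed
  have "continuous_on {0..} (\<lambda>t. S t (X x u a))"
    by (rule S_continuous)
  then obtain d' where d': "d' > 0"
    "\<And>r. 0 \<le> r \<Longrightarrow> dist r (t - a) < d' \<Longrightarrow> dist (S r (X x u a)) (S (t - a) (X x u a)) < e / 4"
    unfolding continuous_on_iff using \<open>e > 0\<close> a
    by (metis atLeast_iff diff_ge_0_iff_ge divide_pos_pos zero_less_numeral)
  have "dist (X x u r) (X x u t) < e" if r: "r \<in> {0..}" "dist r t < min d d'" for r
  proof -
    have ra: "a \<le> r" "r \<le> t + d"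
      using r unfolding a_def dist_real_def by auto
    have "norm (S (r - a) (X x u a) - S (t - a) (X x u a)) < e / 4"
      using d'(2)[of "r - a"] ra r by (simp add: dist_norm)
    moreover have "norm (X x u t - S (t - a) (X x u a)) \<le> e / 4"
      using near[of t] a d by simp
    ultimately show ?thesis
      using near[OF ra] \<open>e > 0\<close> unfolding dist_norm by norm
  qed
  then show "\<exists>d>0. \<forall>r\<in>{0..}. dist r t < d \<longrightarrow> dist (X x u r) (X x u t) < e"
    using d(1) d'(1) by (intro exI[of _ "min d d'"]) auto
qed

end

section \<open>Uniform approximate null controllability\<close>

context bounded_control
begin

text \<open>Norm convergence of the adjoint orbit of \<open>y\<close> at time \<open>0\<close>,
  expressed through \<open>S\<close> alone: a bound by \<open>e * norm z\<close> for all
  \<open>z\<close> says that the norm of the difference is at most \<open>e\<close>.\<close>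

definition adjoint_continuous :: "'x \<Rightarrow> bool"
  where "adjoint_continuous y \<longleftrightarrow> (\<forall>e>0. \<exists>d>0. \<forall>t z. 0 \<le> t \<longrightarrow> t \<le> d \<longrightarrow> \<bar>y \<bullet> S t z - y \<bullet> z\<bar> \<le> e * norm z)"

lemma subspace_adjoint_continuous: "subspace {y. adjoint_continuous y}"
proof -
  have "adjoint_continuous (x + y)" if xy: "adjoint_continuous x" "adjoint_continuous y" for x y
    unfolding adjoint_continuous_def
  proof (intro allI impI)
    fix e :: real assume "e > 0"
    then have e2: "e / 2 > 0"
      by simp
    obtain d1 where d1: "d1 > 0" "\<And>t z. 0 \<le> t \<Longrightarrow> t \<le> d1 \<Longrightarrow> \<bar>x \<bullet> S t z - x \<bullet> z\<bar> \<le> e / 2 * norm z"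
      using xy(1) e2 unfolding adjoint_continuous_def by meson
    obtain d2 where d2: "d2 > 0" "\<And>t z. 0 \<le> t \<Longrightarrow> t \<le> d2 \<Longrightarrow> \<bar>y \<bullet> S t z - y \<bullet> z\<bar> \<le> e / 2 * norm z"
      using xy(2) e2 unfolding adjoint_continuous_def by meson
    have "\<bar>(x + y) \<bullet> S t z - (x + y) \<bullet> z\<bar> \<le> e * norm z" if "0 \<le> t" "t \<le> min d1 d2" for t z
    proof -
      have "\<bar>x \<bullet> S t z - x \<bullet> z\<bar> \<le> e / 2 * norm z" "\<bar>y \<bullet> S t z - y \<bullet> z\<bar> \<le> e / 2 * norm z"
        using that d1(2)[of t z] d2(2)[of t z] by auto
      then show ?thesis
        unfolding inner_add_left by linarith
    qed
    then show "\<exists>d>0. \<forall>t z. 0 \<le> t \<longrightarrow> t \<le> d \<longrightarrow> \<bar>(x + y) \<bullet> S t z - (x + y) \<bullet> z\<bar> \<le> e * norm z"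
      using d1(1) d2(1) by (intro exI[of _ "min d1 d2"]) auto
  qed
  moreover have "adjoint_continuous (c *\<^sub>R y)" if y: "adjoint_continuous y" for c y
    unfolding adjoint_continuous_def
  proof (intro allI impI)
    fix e :: real assume "e > 0"
    then have "e / (\<bar>c\<bar> + 1) > 0"
      by simp
    then obtain d where d: "d > 0" "\<And>t z. 0 \<le> t \<Longrightarrow> t \<le> d \<Longrightarrow> \<bar>y \<bullet> S t z - y \<bullet> z\<bar> \<le> e / (\<bar>c\<bar> + 1) * norm z"
      using y unfolding adjoint_continuous_def by meson
    have "\<bar>c *\<^sub>R y \<bullet> S t z - c *\<^sub>R y \<bullet> z\<bar> \<le> e * norm z" if "0 \<le> t" "t \<le> d" for t z
    proof -
      have "\<bar>c *\<^sub>R y \<bullet> S t z - c *\<^sub>R y \<bullet> z\<bar> = \<bar>c\<bar> * \<bar>y \<bullet> S t z - y \<bullet> z\<bar>"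
        by (simp add: abs_mult flip: right_diff_distrib)
      also have "\<dots> \<le> (\<bar>c\<bar> + 1) * (e / (\<bar>c\<bar> + 1) * norm z)"
        using d(2)[OF that, of z] by (intro mult_mono) auto
      also have "\<dots> = e * norm z"
        by (simp add: add_eq_0_iff_both_eq_0)
      finally show ?thesis .
    qed
    then show "\<exists>d>0. \<forall>t z. 0 \<le> t \<longrightarrow> t \<le> d \<longrightarrow> \<bar>c *\<^sub>R y \<bullet> S t z - c *\<^sub>R y \<bullet> z\<bar> \<le> e * norm z"
      using d(1) by blast
  qed
  moreover have "adjoint_continuous 0"
    by (auto simp: adjoint_continuous_def intro: exI[of _ 1])
  ultimately show ?thesis
    unfolding subspace_def by blast
qed

lemma closed_adjoint_continuous: "closed {y. adjoint_continuous y}"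
proof -
  have "adjoint_continuous y" if y: "\<And>d. d > 0 \<Longrightarrow> \<exists>x. adjoint_continuous x \<and> dist x y < d" for y
    unfolding adjoint_continuous_def
  proof (intro allI impI)
    fix e :: real assume "e > 0"
    define K where "K = S_sup 1 + 1"
    have "K > 0"
      using S_sup(1)[of 1] by (simp add: K_def)
    then obtain x where x: "adjoint_continuous x" "dist x y < e / (2 * K)"
      using y[of "e / (2 * K)"] \<open>e > 0\<close> by auto
    have "e / 2 > 0"
      using \<open>e > 0\<close> by simp
    then obtain d where d: "d > 0" "\<And>t z. 0 \<le> t \<Longrightarrow> t \<le> d \<Longrightarrow> \<bar>x \<bullet> S t z - x \<bullet> z\<bar> \<le> e / 2 * norm z"
      using x(1) unfolding adjoint_continuous_def by meson
    have "\<bar>y \<bullet> S t z - y \<bullet> z\<bar> \<le> e * norm z" if t: "0 \<le> t" "t \<le> min d 1" for t z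
    proof -
      have "norm (S t z - z) \<le> norm (S t z) + norm z"
        by (rule norm_triangle_ineq4)
      also have "\<dots> \<le> K * norm z"
        using norm_S_le[of t 1 z] t by (simp add: K_def distrib_right)
      finally have Kz: "norm (S t z - z) \<le> K * norm z" .
      have "\<bar>(y - x) \<bullet> (S t z - z)\<bar> \<le> norm (y - x) * norm (S t z - z)"
        by (rule Cauchy_Schwarz_ineq2)
      also have "\<dots> \<le> e / (2 * K) * (K * norm z)"
        using x(2) Kz \<open>K > 0\<close> \<open>e > 0\<close> by (intro mult_mono) (auto simp: dist_norm norm_minus_commute)
      also have "\<dots> = e / 2 * norm z"
        using \<open>K > 0\<close> by simp
      finally have "\<bar>(y - x) \<bullet> (S t z - z)\<bar> \<le> e / 2 * norm z" .
      moreover have "\<bar>x \<bullet> S t z - x \<bullet> z\<bar> \<le> e / 2 * norm z"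
        using t by (intro d) auto
      moreover have "y \<bullet> S t z - y \<bullet> z = (y - x) \<bullet> (S t z - z) + (x \<bullet> S t z - x \<bullet> z)"
        by (simp add: inner_diff_left inner_diff_right)
      ultimately show ?thesis
        by linarith
    qed
    then show "\<exists>d>0. \<forall>t z. 0 \<le> t \<longrightarrow> t \<le> d \<longrightarrow> \<bar>y \<bullet> S t z - y \<bullet> z\<bar> \<le> e * norm z"
      using d(1) by (intro exI[of _ "min d 1"]) auto
  qed
  then show ?thesis
    unfolding closed_approachable[symmetric] closed_limpt islimpt_approachable
    by (metis dist_self mem_Collect_eq)
qed

lemma orbit_integrable:
  assumes "0 \<le> a"
  shows "(\<lambda>t. y \<bullet> S t z) integrable_on {a..b}"
  by (intro integrable_continuous_real continuous_on_inner continuous_on_const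
      continuous_on_subset[OF S_continuous]) (use assms in auto)

lemma orbit_integral_le:
  assumes "0 \<le> a" "a \<le> b" "b \<le> h"
  shows "\<bar>integral {a..b} (\<lambda>t. y \<bullet> S t z)\<bar> \<le> (b - a) * (norm y * S_sup h * norm z)"
proof -
  have "norm (integral {a..b} (\<lambda>t. y \<bullet> S t z)) \<le> integral {a..b} (\<lambda>_. norm y * S_sup h * norm z)"
  proof (rule integral_norm_bound_integral)
    fix t assume "t \<in> {a..b}"
    then have "norm (S t z) \<le> S_sup h * norm z"
      using assms by (intro norm_S_le) auto
    then show "norm (y \<bullet> S t z) \<le> norm y * S_sup h * norm z"
      using Cauchy_Schwarz_ineq2[of y "S t z"] mult_left_mono[of "norm (S t z)" "S_sup h * norm z" "norm y"]
      by (simp add: mult.assoc)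
  qed (use assms orbit_integrable in auto)
  then show ?thesis
    using assms by (simp add: mult_ac)
qed

text \<open>\<open>w\<close> is the integral of the adjoint orbit of \<open>y\<close> over
  \<open>[0, r]\<close>, formed weakly by Riesz. Applying the adjoint at time \<open>t\<close>
  shifts the interval, so only two end pieces of length \<open>t\<close> remain, uniformly small for
  \<open>z\<close> in the unit ball.\<close>

lemma orbit_average:
  assumes r: "r > 0"
  obtains w where "adjoint_continuous w" "\<And>z. w \<bullet> z = integral {0..r} (\<lambda>t. y \<bullet> S t z)"
proof -
  let ?f = "\<lambda>z. integral {0..r} (\<lambda>t. y \<bullet> S t z)"
  have "bounded_linear ?f"
  proof
    show "?f (z + z') = ?f z + ?f z'" for z z'
      unfolding blinfun.add_right inner_add_right by (intro integral_add orbit_integrable) auto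
    show "?f (c *\<^sub>R z) = c *\<^sub>R ?f z" for c z
      unfolding blinfun.scaleR_right inner_scaleR_right by simp
    show "\<exists>K. \<forall>z. norm (?f z) \<le> norm z * K"
      using orbit_integral_le[of 0 r r y] r by (intro exI[of _ "r * norm y * S_sup r"]) (simp add: mult_ac)
  qed
  then obtain w where w: "\<And>z. w \<bullet> z = ?f z"
    using riesz_closed_subspace[of UNIV ?f] by auto
  have "adjoint_continuous w"
    unfolding adjoint_continuous_def
  proof (intro allI impI)
    fix e :: real assume "e > 0"
    define K where "K = norm y * S_sup (r + 1) + 1"
    have "K > 0"
      using S_sup(1)[of "r + 1"] by (simp add: K_def add_nonneg_pos)
    define d where "d = min 1 (e / (2 * K))"
    have d: "d > 0" "d \<le> 1" "2 * d * K \<le> e"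
      using \<open>K > 0\<close> \<open>e > 0\<close> by (auto simp: d_def min_def field_simps)
    have "\<bar>w \<bullet> S t z - w \<bullet> z\<bar> \<le> e * norm z" if t: "0 \<le> t" "t \<le> d" for t z
    proof -
      let ?g = "\<lambda>t. y \<bullet> S t z"
      have "?f (S t z) = integral {0..r} (\<lambda>s. ?g (s + t))"
        using t by (intro integral_cong) (simp add: S_add)
      also have "\<dots> = integral {t..r + t} ?g"
        using integral_shift_real_ivl[of t t "r + t" ?g] by simp
      finally have "w \<bullet> S t z - w \<bullet> z = integral {t..r + t} ?g - integral {0..r} ?g"
        by (simp add: w)
      also have "\<dots> = integral {r..r + t} ?g - integral {0..t} ?g"
        using Henstock_Kurzweil_Integration.integral_combine[of 0 t "r + t" ?g]
          Henstock_Kurzweil_Integration.integral_combine[of 0 r "r + t" ?g] orbit_integrable[of 0 y z] t r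
        by (simp add: algebra_simps)
      finally have "\<bar>w \<bullet> S t z - w \<bullet> z\<bar> \<le> \<bar>integral {r..r + t} ?g\<bar> + \<bar>integral {0..t} ?g\<bar>"
        by linarith
      also have "\<dots> \<le> t * (norm y * S_sup (r + 1) * norm z) + t * (norm y * S_sup (r + 1) * norm z)"
        using orbit_integral_le[of r "r + t" "r + 1" y z] orbit_integral_le[of 0 t "r + 1" y z] t d r
        by (intro add_mono) auto
      also have "\<dots> \<le> 2 * t * K * norm z"
        using t by (simp add: K_def algebra_simps)
      also have "\<dots> \<le> 2 * d * K * norm z"
        using t \<open>K > 0\<close> by (intro mult_right_mono) auto
      also have "\<dots> \<le> e * norm z"
        using d by (intro mult_right_mono) auto
      finally show ?thesis .
    qed
    then show "\<exists>d>0. \<forall>t z. 0 \<le> t \<longrightarrow> t \<le> d \<longrightarrow> \<bar>w \<bullet> S t z - w \<bullet> z\<bar> \<le> e * norm z"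
      using d(1) by blast
  qed
  with w show ?thesis
    using that[of w] by simp
qed

text \<open>On a Hilbert space the adjoint semigroup is strongly continuous: the orbit averages of \<open>y\<close> have
  this property, and a vector orthogonal to all of them vanishes.\<close>

lemma adjoint_continuous: "adjoint_continuous y"
proof -
  obtain w where w: "adjoint_continuous w" "\<And>v. adjoint_continuous v \<Longrightarrow> w \<bullet> v = y \<bullet> v"
    using riesz_closed_subspace[OF subspace_adjoint_continuous closed_adjoint_continuous bounded_linear_inner_right[of y]]
    by auto
  define g where "g = y - w"
  have "g = 0"
  proof (rule ccontr)
    assume "g \<noteq> 0"
    \<comment> \<open>\<open>g\<close> is orthogonal to the whole subspace, in particular to its own
      orbit average \<open>v\<close>; but \<open>g \<bullet> S t g\<close> stays above half of
      \<open>g \<bullet> g\<close> near time \<open>0\<close>, which makes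
      \<open>v \<bullet> g\<close> positive.\<close>
    define m where "m = (g \<bullet> g) / 2"
    have m: "m > 0" "m < g \<bullet> S 0 g"
      using \<open>g \<noteq> 0\<close> by (auto simp: m_def S_0)
    have "((\<lambda>t. g \<bullet> S t g) \<longlongrightarrow> g \<bullet> g) (at_right 0)"
      by (intro tendsto_intros S_right)
    then have "\<forall>\<^sub>F t in at_right 0. m < g \<bullet> S t g"
      using m by (intro order_tendstoD(1)) (auto simp: S_0)
    then obtain b where b: "b > 0" "\<And>t. 0 < t \<Longrightarrow> t < b \<Longrightarrow> m < g \<bullet> S t g"
      unfolding eventually_at_right_field by auto
    obtain v where v: "adjoint_continuous v" "\<And>z. v \<bullet> z = integral {0..b/2} (\<lambda>t. g \<bullet> S t z)"
      using orbit_average[of "b / 2" g] b(1) by auto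
    have "integral {0..b/2} (\<lambda>t. m) \<le> integral {0..b/2} (\<lambda>t. g \<bullet> S t g)"
    proof (rule integral_le)
      show "m \<le> g \<bullet> S t g" if "t \<in> {0..b/2}" for t
        using b(2)[of t] m(2) that b(1) by (cases "t = 0") auto
    qed (auto intro: orbit_integrable)
    also have "\<dots> = 0"
      using w(2)[OF v(1)] v(2)[of g] by (simp add: g_def inner_diff_left inner_diff_right inner_commute)
    finally show False
      using m b(1) by (simp add: mult_le_0_iff)
  qed
  then show ?thesis
    using w by (simp add: g_def)
qed

text \<open>An \<open>L\<^sub>2\<close> error below \<open>1\<close> accounts for the energy bound,
  and the terminal error follows by comparing the two integrands. The proof also settles that the
  integrand driven by \<open>u\<close> is integrable.\<close>

lemma L2_input_approx:
  assumes u: "L2_control T u" and T: "T > 0" and e: "e > 0"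
  obtains g where "continuous_on UNIV g" "integral {0..T} (\<lambda>t. (norm (g t))\<^sup>2) \<le> 2 * integral {0..T} (\<lambda>t. (norm (u t))\<^sup>2) + 2"
    "norm (X x u T - X x g T) \<le> e"
proof -
  define K where "K = S_sup T * norm B"
  have K: "K \<ge> 0"
    using S_sup(1)[of T] by (simp add: K_def)
  let ?w = "\<lambda>u t. S (T - t) (B (u t))"
  have approx: "\<exists>g k. continuous_on UNIV g \<and> (\<lambda>t. (norm (u t - g t))\<^sup>2) integrable_on {0..T} \<and>
      integral {0..T} (\<lambda>t. (norm (u t - g t))\<^sup>2) < 1 \<and>
      k integrable_on {0..T} \<and> (\<forall>t\<in>{0..T}. norm (?w u t - ?w g t) \<le> k t) \<and> integral {0..T} k \<le> e"
    if "e > 0" for e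
  proof -
    define c where "c = (K + 1) * (T + 1)"
    define \<delta> where "\<delta> = min 1 (e / c)"
    have "c > 0"
      using K T by (simp add: c_def)
    then have "\<delta> > 0" "\<delta> \<le> 1" "c * \<delta> \<le> e"
      using \<open>e > 0\<close> by (auto simp: \<delta>_def min_def field_simps)
    then have \<delta>: "\<delta> > 0" "\<delta> \<le> 1" "(K + 1) * (T + 1) * \<delta> \<le> e"
      by (auto simp: c_def)
    obtain g where g: "continuous_on UNIV g" "(\<lambda>t. (norm (u t - g t))\<^sup>2) integrable_on {0..T}"
      "integral {0..T} (\<lambda>t. (norm (u t - g t))\<^sup>2) < \<delta>\<^sup>2"
      using L2_control_approx[OF u, of "\<delta>\<^sup>2"] \<delta>(1) by auto
    \<comment> \<open>Only the square of the error is known to be integrable, so Young's inequality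
      majorizes \<open>norm (u t - g t)\<close> by a constant and a multiple of the square. The
      integral of \<open>k\<close> is at most \<open>K * (T + 1) * \<delta>\<close>.\<close>
    define k where "k t = K * (\<delta> + (norm (u t - g t))\<^sup>2 / \<delta>)" for t
    have k: "k integrable_on {0..T}"
      unfolding k_def using g(2) by (intro integrable_on_mult_right integrable_add integrable_const_ivl integrable_on_divide)
    have "norm (?w u t - ?w g t) \<le> k t" if t: "t \<in> {0..T}" for t
    proof -
      have "?w u t - ?w g t = S (T - t) (B (u t - g t))"
        by (simp add: blinfun.diff_right)
      then have "norm (?w u t - ?w g t) \<le> K * norm (u t - g t)"
        using norm_integrand_le[OF t order_refl, of "u t - g t"] by (simp add: K_def)
      also have "norm (u t - g t) \<le> \<delta> + (norm (u t - g t))\<^sup>2 / \<delta>"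
      proof -
        have "2 * \<delta> * norm (u t - g t) \<le> \<delta>\<^sup>2 + (norm (u t - g t))\<^sup>2"
          by (rule sum_squares_bound)
        moreover have "\<delta> * norm (u t - g t) \<le> 2 * \<delta> * norm (u t - g t)"
          using \<delta>(1) by simp
        ultimately have "\<delta> * norm (u t - g t) \<le> \<delta>\<^sup>2 + (norm (u t - g t))\<^sup>2"
          by linarith
        also have "\<dots> = \<delta> * (\<delta> + (norm (u t - g t))\<^sup>2 / \<delta>)"
          using \<delta>(1) by (simp add: field_simps power2_eq_square)
        finally show ?thesis
          using \<delta>(1) by simp
      qed
      finally show ?thesis
        using K by (simp add: k_def mult_left_mono)
    qed
    moreover have "integral {0..T} k \<le> e"
    proof -
      have "integral {0..T} k = K * (T * \<delta> + integral {0..T} (\<lambda>t. (norm (u t - g t))\<^sup>2) / \<delta>)"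
        unfolding k_def integral_mult_right
        by (subst Henstock_Kurzweil_Integration.integral_add)
          (use T in \<open>auto intro!: integrable_on_divide g(2)\<close>)
      also have "\<dots> \<le> K * (T * \<delta> + \<delta>\<^sup>2 / \<delta>)"
        using K g(3) \<delta>(1) by (intro mult_left_mono add_left_mono divide_right_mono) auto
      also have "\<dots> = K * ((T + 1) * \<delta>)"
        using \<delta>(1) by (simp add: power2_eq_square algebra_simps)
      also have "\<dots> \<le> (K + 1) * ((T + 1) * \<delta>)"
        using T \<delta>(1) by (intro mult_right_mono) auto
      finally show ?thesis
        using \<delta>(3) by (simp add: mult.assoc)
    qed
    moreover have "\<delta>\<^sup>2 \<le> 1"
      using \<delta> by (simp add: power_le_one)
    then have "integral {0..T} (\<lambda>t. (norm (u t - g t))\<^sup>2) < 1"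
      using g(3) by linarith
    ultimately show ?thesis
      using g k by blast
  qed
  have cont: "?w g integrable_on {0..T}" if "continuous_on UNIV g" for g
    using that by (intro integrable_integrand pc_on_continuous) (auto intro: continuous_on_subset)
  \<comment> \<open>Integrability is essential: otherwise \<open>integral\<close> would have its
    default value \<open>0\<close>, and \<open>X x u T\<close> would carry no information on the
    input.\<close>
  have wu: "?w u integrable_on {0..T}"
  proof (rule integrable_L1_approx)
    fix e :: real assume "e > 0"
    from approx[OF this] obtain g k where gk: "continuous_on UNIV g" "k integrable_on {0..T}"
      "\<forall>t\<in>{0..T}. norm (?w u t - ?w g t) \<le> k t" "integral {0..T} k \<le> e"
      by blast
    then show "\<exists>g k. g integrable_on {0..T} \<and> k integrable_on {0..T} \<and>
      (\<forall>t\<in>{0..T}. norm (?w u t - g t) \<le> k t) \<and> integral {0..T} k \<le> e"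
      using cont[OF gk(1)] by (intro exI[of _ "?w g"] exI[of _ k]) auto
  qed
  from approx[OF e] obtain g k where g: "continuous_on UNIV g" "(\<lambda>t. (norm (u t - g t))\<^sup>2) integrable_on {0..T}"
      "integral {0..T} (\<lambda>t. (norm (u t - g t))\<^sup>2) < 1" and k: "k integrable_on {0..T}"
      "\<forall>t\<in>{0..T}. norm (?w u t - ?w g t) \<le> k t" "integral {0..T} k \<le> e"
    by blast
  have "X x u T - X x g T = integral {0..T} (\<lambda>t. ?w u t - ?w g t)"
    unfolding mild_solution_def using wu cont[OF g(1)] by (simp add: Henstock_Kurzweil_Integration.integral_diff)
  also have "norm \<dots> \<le> integral {0..T} k"
    using k wu cont[OF g(1)] by (intro integral_norm_bound_integral integrable_diff) auto
  finally have 1: "norm (X x u T - X x g T) \<le> e"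
    using k(3) by simp
  have u2: "(\<lambda>t. (norm (u t))\<^sup>2) integrable_on {0..T}"
    using u unfolding L2_control_def by (simp add: set_lebesgue_integral_eq_integral(1))
  have "integral {0..T} (\<lambda>t. (norm (g t))\<^sup>2) \<le> integral {0..T} (\<lambda>t. 2 * (norm (u t))\<^sup>2 + 2 * (norm (u t - g t))\<^sup>2)"
  proof (rule integral_le)
    show "(\<lambda>t. (norm (g t))\<^sup>2) integrable_on {0..T}"
      by (intro integrable_continuous_real continuous_intros continuous_on_subset[OF g(1)]) auto
    show "(norm (g t))\<^sup>2 \<le> 2 * (norm (u t))\<^sup>2 + 2 * (norm (u t - g t))\<^sup>2" for t
      using norm_diff_sq_le[of "u t" "u t - g t"] by simp
  qed (intro integrable_add integrable_on_mult_right u2 g)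
  also have "\<dots> = 2 * integral {0..T} (\<lambda>t. (norm (u t))\<^sup>2) + 2 * integral {0..T} (\<lambda>t. (norm (u t - g t))\<^sup>2)"
    using u2 g(2) by (simp add: Henstock_Kurzweil_Integration.integral_add integrable_on_mult_right)
  finally have "integral {0..T} (\<lambda>t. (norm (g t))\<^sup>2) \<le> 2 * integral {0..T} (\<lambda>t. (norm (u t))\<^sup>2) + 2"
    using g(3) by linarith
  with 1 g(1) show ?thesis
    using that by blast
qed

text \<open>Baire's theorem makes the cost of approximate null controllability uniform in the initial state;
  passing to approximate controllability avoids any appeal to the completeness of \<open>L\<^sub>2\<close>.\<close>

lemma approximately_null_controllable:
  assumes "exactly_null_controllable S B"
  shows "\<exists>T>0. \<exists>C\<ge>0. \<forall>x. \<forall>e>0. \<exists>u. continuous_on UNIV u \<and>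
      integral {0..T} (\<lambda>t. (norm (u t))\<^sup>2) \<le> C * (norm x)\<^sup>2 \<and> norm (X x u T) \<le> e"
proof -
  obtain T where T: "T > 0" and null: "\<And>x. \<exists>u. L2_control T u \<and> X x u T = 0"
    using assms unfolding exactly_null_controllable_def by blast
  define P where "P n x e u \<longleftrightarrow> continuous_on UNIV u \<and>
      integral {0..T} (\<lambda>t. (norm (u t))\<^sup>2) \<le> n \<and> norm (X x u T) \<le> e" for n :: real and x e u
  \<comment> \<open>One energy level serves all accuracies \<open>e\<close>. This makes
    \<open>G n\<close> closed: a nearby initial state is steered by the same control, and the
    terminal state moves by at most \<open>S_sup T\<close> times the distance.\<close>
  define G where "G n = {x. \<forall>e>0. \<exists>u. P (real n) x e u}" for n
  have pcc: "pc_on 0 T u" if "continuous_on UNIV u" for u :: "real \<Rightarrow> 'u"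
    using that by (intro pc_on_continuous) (auto intro: continuous_on_subset)
  have "closed (G n)" for n
  proof -
    have "x \<in> G n" if x: "\<And>d. d > 0 \<Longrightarrow> \<exists>y\<in>G n. dist y x < d" for x
      unfolding G_def
    proof (intro CollectI allI impI)
      fix e :: real assume "e > 0"
      have pos: "e / (2 * S_sup T) > 0"
        using S_sup(1)[of T] \<open>e > 0\<close> by (intro divide_pos_pos) auto
      from x[OF this] obtain y where y: "y \<in> G n" "dist y x < e / (2 * S_sup T)"
        by blast
      have "e / 2 > 0"
        using \<open>e > 0\<close> by simp
      then obtain u where u: "P (real n) y (e / 2) u"
        using y(1) unfolding G_def by blast
      have "X x u T = X y u T + S T (x - y)"
        by (simp add: mild_solution_def blinfun.diff_right)
      then have "norm (X x u T) \<le> norm (X y u T) + norm (S T (x - y))"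
        by (simp add: norm_triangle_ineq)
      also have "\<dots> \<le> e / 2 + S_sup T * norm (x - y)"
        using u T by (intro add_mono norm_S_le) (auto simp: P_def)
      also have "\<dots> \<le> e / 2 + S_sup T * (e / (2 * S_sup T))"
        using y(2) S_sup(1)[of T] by (intro add_left_mono mult_left_mono) (auto simp: dist_norm norm_minus_commute)
      also have "\<dots> = e"
        using S_sup(1)[of T] by simp
      finally show "\<exists>u. P (real n) x e u"
        using u unfolding P_def by blast
    qed
    then show ?thesis
      unfolding closed_limpt islimpt_approachable by meson
  qed
  moreover have "\<exists>n. x \<in> G n" for x
  proof -
    obtain u where u: "L2_control T u" "X x u T = 0"
      using null by blast
    obtain n where n: "2 * integral {0..T} (\<lambda>t. (norm (u t))\<^sup>2) + 2 \<le> real n"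
      using real_arch_simple by blast
    have "\<exists>u. P (real n) x e u" if e: "e > 0" for e
    proof -
      obtain g where g: "continuous_on UNIV g" "integral {0..T} (\<lambda>t. (norm (g t))\<^sup>2) \<le> 2 * integral {0..T} (\<lambda>t. (norm (u t))\<^sup>2) + 2"
        "norm (X x u T - X x g T) \<le> e"
        by (rule L2_input_approx[OF u(1) T e, of x])
      then have "P (real n) x e g"
        using u(2) n by (simp add: P_def)
      then show ?thesis
        by blast
    qed
    then show ?thesis
      unfolding G_def by blast
  qed
  ultimately obtain n a r where r: "r > 0" "ball a r \<subseteq> G n"
    using closed_cover_contains_ball[of G] by metis
  \<comment> \<open>Both \<open>a + x\<close> and \<open>a - x\<close> lie in the ball, and half the
    difference of their controls steers \<open>x\<close>; by convexity its energy is still at most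
    \<open>n\<close>.\<close>
  have ball0: "\<exists>u. P (real n) x e u" if x: "norm x < r" and "e > 0" for x e
  proof -
    have "a + x \<in> G n" "a - x \<in> G n"
      using r x by (auto simp: subset_iff dist_norm)
    then obtain u v where uv: "P (real n) (a + x) e u" "P (real n) (a - x) e v"
      using \<open>e > 0\<close> unfolding G_def by blast
    then have pc: "pc_on 0 T u" "pc_on 0 T v"
      using pcc by (auto simp: P_def)
    let ?w = "\<lambda>t. (1/2) *\<^sub>R (u t - v t)"
    have "X ((1/2) *\<^sub>R ((a + x) - (a - x))) ?w T = (1/2) *\<^sub>R (X (a + x) u T - X (a - x) v T)"
      by (simp only: X_scaleR X_diff[OF pc])
    moreover have "(1/2) *\<^sub>R ((a + x) - (a - x)) = x"
      by (simp flip: scaleR_2)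
    ultimately have "norm (X x ?w T) = norm (X (a + x) u T - X (a - x) v T) / 2"
      by simp
    also have "\<dots> \<le> (e + e) / 2"
      using uv norm_triangle_ineq4[of "X (a + x) u T" "X (a - x) v T"] by (simp add: P_def)
    finally have 1: "norm (X x ?w T) \<le> e"
      by simp
    have i: "(\<lambda>t. (norm (u t))\<^sup>2) integrable_on {0..T}" "(\<lambda>t. (norm (v t))\<^sup>2) integrable_on {0..T}"
      using pc by (auto intro: pc_on_integrable pc_on_norm_sq)
    have "integral {0..T} (\<lambda>t. (norm (?w t))\<^sup>2) \<le> integral {0..T} (\<lambda>t. (norm (u t))\<^sup>2 / 2 + (norm (v t))\<^sup>2 / 2)"
    proof (rule integral_le)
      show "(\<lambda>t. (norm (?w t))\<^sup>2) integrable_on {0..T}"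
        by (intro pc_on_integrable pc_on_norm_sq pc_on_scaleR pc_on_diff pc)
      show "(norm (?w t))\<^sup>2 \<le> (norm (u t))\<^sup>2 / 2 + (norm (v t))\<^sup>2 / 2" for t
        using norm_diff_sq_le[of "u t" "v t"] by (simp add: power_mult_distrib power_divide)
    qed (intro integrable_add integrable_on_divide i)
    also have "\<dots> = integral {0..T} (\<lambda>t. (norm (u t))\<^sup>2) / 2 + integral {0..T} (\<lambda>t. (norm (v t))\<^sup>2) / 2"
      using i by (simp add: Henstock_Kurzweil_Integration.integral_add integrable_on_divide)
    also have "\<dots> \<le> real n"
      using uv by (simp add: P_def)
    finally have "P (real n) x e ?w"
      using 1 uv by (auto simp: P_def intro!: continuous_intros)
    then show ?thesis
      by blast
  qed
  have "\<exists>u. P (4 * real n / r\<^sup>2 * (norm x)\<^sup>2) x e u" if "e > 0" for x e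
  proof (cases "x = 0")
    case True
    then have "P (4 * real n / r\<^sup>2 * (norm x)\<^sup>2) x e (\<lambda>_. 0)"
      using \<open>e > 0\<close> by (simp add: P_def mild_solution_def)
    then show ?thesis
      by blast
  next
    case False
    \<comment> \<open>Scaling \<open>x\<close> to length \<open>r / 2\<close> and back divides the
      energy by \<open>c\<^sup>2\<close>, which is the origin of the constant
      \<open>4 * n / r\<^sup>2\<close>.\<close>
    define c where "c = r / (2 * norm x)"
    have c: "c > 0" "norm (c *\<^sub>R x) < r"
      using False r by (auto simp: c_def)
    then have "c * e > 0"
      using \<open>e > 0\<close> by simp
    from ball0[OF c(2) this] obtain u where u: "P (real n) (c *\<^sub>R x) (c * e) u"
      by blast
    let ?w = "\<lambda>t. (1/c) *\<^sub>R u t"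
    have "X x ?w T = (1/c) *\<^sub>R X (c *\<^sub>R x) u T"
      using X_scaleR[of "1/c" "c *\<^sub>R x" u T] c by simp
    then have "norm (X x ?w T) = norm (X (c *\<^sub>R x) u T) / c"
      using c by simp
    also have "\<dots> \<le> c * e / c"
      using u c by (intro divide_right_mono) (auto simp: P_def)
    finally have "norm (X x ?w T) \<le> e"
      using c by simp
    moreover have "integral {0..T} (\<lambda>t. (norm (?w t))\<^sup>2) = integral {0..T} (\<lambda>t. (norm (u t))\<^sup>2) / c\<^sup>2"
      using c by (simp add: power_mult_distrib power_divide)
    moreover have "integral {0..T} (\<lambda>t. (norm (u t))\<^sup>2) / c\<^sup>2 \<le> real n / c\<^sup>2"
      using u by (intro divide_right_mono) (auto simp: P_def)
    moreover have "real n / c\<^sup>2 = 4 * real n / r\<^sup>2 * (norm x)\<^sup>2"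
      using r False by (simp add: c_def field_simps power2_eq_square)
    ultimately have "P (4 * real n / r\<^sup>2 * (norm x)\<^sup>2) x e ?w"
      using u by (auto simp: P_def intro!: continuous_intros)
    then show ?thesis
      by blast
  qed
  then show ?thesis
    using T unfolding P_def by (intro exI[of _ T] conjI exI[of _ "4 * real n / r\<^sup>2"]) auto
qed

end

section \<open>The exponential weight\<close>

lemma bounded_control_shift:
  assumes "bounded_control sX sU S B"
  shows "bounded_control sX sU (\<lambda>t. exp (\<omega> * t) *\<^sub>R S t) B"
proof -
  interpret bounded_control sX sU S B by fact
  have scale: "sX c (r *\<^sub>R x) = r *\<^sub>R sX c x" for c r x
    by (rule linear_cmul[OF bounded_linear.linear[OF hilbert_space.scale_bounded_linear[OF hilbert_X]]])
  have "bounded_op sX sX (exp (\<omega> * t) *\<^sub>R S t)" if "0 \<le> t" for t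
    using semigroup that unfolding C0_semigroup_def bounded_op_def Vector_Spaces.linear_iff
    by (auto simp: scale blinfun.scaleR_left scaleR_add_right)
  moreover have "((\<lambda>t. (exp (\<omega> * t) *\<^sub>R S t) x) \<longlongrightarrow> x) (at_right 0)" for x
  proof -
    have "((\<lambda>t. exp (\<omega> * t) *\<^sub>R S t x) \<longlongrightarrow> exp (\<omega> * 0) *\<^sub>R x) (at_right 0)"
      by (intro tendsto_intros S_right)
    then show ?thesis
      by (simp add: blinfun.scaleR_left)
  qed
  moreover have "exp (\<omega> * (s + t)) *\<^sub>R S (s + t) = exp (\<omega> * s) *\<^sub>R S s o\<^sub>L exp (\<omega> * t) *\<^sub>R S t"
    if "0 \<le> s" "0 \<le> t" for s t
    using that by (intro blinfun_eqI)
      (simp add: blinfun.scaleR_left blinfun.scaleR_right S_add distrib_left exp_add mult.commute)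
  moreover have "S 0 = id_blinfun"
    using semigroup by (simp add: C0_semigroup_def)
  ultimately have "C0_semigroup sX (\<lambda>t. exp (\<omega> * t) *\<^sub>R S t)"
    by (simp add: C0_semigroup_def)
  then show ?thesis
    by (rule bounded_control.intro[OF hilbert_X hilbert_U _ linear_B])
qed

text \<open>The weights of kernel and control multiply to \<open>exp (\<omega> * t)\<close> whatever
  \<open>s\<close> is, so the factor leaves the integral.\<close>

lemma mild_solution_shift:
  "mild_solution (\<lambda>t. exp (\<omega> * t) *\<^sub>R S t) B x (\<lambda>s. exp (\<omega> * s) *\<^sub>R u s) t
    = exp (\<omega> * t) *\<^sub>R mild_solution S B x u t"
proof -
  have "exp (\<omega> * (t - s)) * exp (\<omega> * s) = exp (\<omega> * t)" for s
    by (simp flip: exp_add add: algebra_simps)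
  then show ?thesis
    by (simp add: mild_solution_def blinfun.scaleR_left blinfun.scaleR_right scaleR_add_right mult.commute)
qed

section \<open>The optimal value\<close>

lemma parallelogram_law:
  fixes a b :: "'a::real_inner"
  shows "(norm (a + b))\<^sup>2 + (norm (a - b))\<^sup>2 = 2 * (norm a)\<^sup>2 + 2 * (norm b)\<^sup>2"
  by (simp add: power2_norm_eq_inner inner_simps)

text \<open>From here on controllability enters only through this contraction: the factor
  \<open>1 / 2\<close> lets the step be iterated with a geometric series of costs.\<close>

locale steerable_control = bounded_control sX sU S B
  for sX :: "'k::real_normed_field \<Rightarrow> 'x::{real_inner,banach} \<Rightarrow> 'x"
    and sU :: "'k \<Rightarrow> 'u::{real_inner,banach} \<Rightarrow> 'u"
    and S :: "real \<Rightarrow> 'x \<Rightarrow>\<^sub>L 'x" and B :: "'u \<Rightarrow>\<^sub>L 'x" +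
  fixes T C :: real
  assumes T_pos: "T > 0" and C_nonneg: "C \<ge> 0"
    and steer: "\<And>x. \<exists>u. continuous_on UNIV u \<and>
      integral {0..T} (\<lambda>t. (norm (u t))\<^sup>2) \<le> C * (norm x)\<^sup>2 \<and> norm (X x u T) \<le> norm x / 2"
begin

definition J :: "real \<Rightarrow> 'x \<Rightarrow> (real \<Rightarrow> 'u) \<Rightarrow> real"
  where "J h x u = integral {0..h} (\<lambda>s. (norm (X x u s))\<^sup>2 + (norm (u s))\<^sup>2)"

lemma state_sq_integrable:
  assumes "pc u" "0 \<le> a"
  shows "(\<lambda>s. (norm (X x u s))\<^sup>2) integrable_on {a..b}"
  using assms
  by (intro integrable_continuous_real continuous_intros continuous_on_subset[OF X_continuous]) auto

lemma control_sq_integrable: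
  assumes "pc u" "0 \<le> a"
  shows "(\<lambda>s. (norm (u s))\<^sup>2) integrable_on {a..b}"
  using assms unfolding pc_def
  by (intro pc_on_integrable pc_on_norm_sq) (meson order_refl pc_on_subset)

lemma cost_integrable:
  assumes "pc u" "0 \<le> a"
  shows "(\<lambda>s. (norm (X x u s))\<^sup>2 + (norm (u s))\<^sup>2) integrable_on {a..b}"
  by (intro integrable_add state_sq_integrable control_sq_integrable assms)

lemma J_eq:
  assumes "pc u"
  shows "J h x u = integral {0..h} (\<lambda>s. (norm (X x u s))\<^sup>2) + integral {0..h} (\<lambda>s. (norm (u s))\<^sup>2)"
  unfolding J_def
  by (intro Henstock_Kurzweil_Integration.integral_add state_sq_integrable control_sq_integrable assms) auto

lemma J_nonneg: "pc u \<Longrightarrow> 0 \<le> J h x u"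
  unfolding J_def by (intro integral_nonneg cost_integrable) auto

lemma pc_add: "pc u \<Longrightarrow> pc v \<Longrightarrow> pc (\<lambda>s. u s + v s)"
  unfolding pc_def by (simp add: pc_on_add)

lemma pc_diff: "pc u \<Longrightarrow> pc v \<Longrightarrow> pc (\<lambda>s. u s - v s)"
  unfolding pc_def by (simp add: pc_on_diff)

lemma pc_continuous: "continuous_on UNIV u \<Longrightarrow> pc u"
  unfolding pc_def by (auto intro: pc_on_continuous continuous_on_subset)

lemma pc_shift:
  assumes "pc u" "0 \<le> h"
  shows "pc (\<lambda>s. u (s + h))"
  unfolding pc_def
proof
  fix b
  have "pc_on (0 + h) (b + h) u"
    using assms unfolding pc_def by (auto intro: pc_on_subset[of 0 "b + h"])
  then show "pc_on 0 b (\<lambda>s. u (s + h))"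
    by (rule pc_on_shift)
qed

lemma pc_scale: "pc u \<Longrightarrow> pc (\<lambda>s. sU c (u s))"
  unfolding pc_def by (auto intro: pc_on_bounded_linear hilbert_space.scale_bounded_linear[OF hilbert_U])

lemma pc_on_pc: "pc u \<Longrightarrow> pc_on 0 b u"
  by (simp add: pc_def)

lemma J_add:
  assumes u: "pc u" and h: "0 \<le> h" "0 \<le> t"
  shows "J (h + t) x u = J h x u + J t (X x u h) (\<lambda>s. u (s + h))"
proof -
  let ?f = "\<lambda>s. (norm (X x u s))\<^sup>2 + (norm (u s))\<^sup>2"
  have "integral {h..h + t} ?f = integral {0..t} (\<lambda>s. ?f (s + h))"
    using integral_shift_real_ivl[of h h "h + t" ?f] by simp
  also have "\<dots> = J t (X x u h) (\<lambda>s. u (s + h))"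
    unfolding J_def
  proof (rule integral_cong)
    fix s assume "s \<in> {0..t}"
    then show "?f (s + h) = (norm (X (X x u h) (\<lambda>s. u (s + h)) s))\<^sup>2 + (norm (u (s + h)))\<^sup>2"
      using X_concat[OF pc_on_pc[OF u], of h s x] h by (simp add: add.commute)
  qed
  finally show ?thesis
    using Henstock_Kurzweil_Integration.integral_combine[of 0 h "h + t" ?f] cost_integrable[OF u order_refl, of x "h + t"] h
    by (simp add: J_def)
qed

lemma J_mono:
  assumes u: "pc u" and h: "0 \<le> h" "h \<le> h'"
  shows "J h x u \<le> J h' x u"
  using J_add[OF u h(1), of "h' - h" x] J_nonneg[OF pc_shift[OF u h(1)]] h by simp

text \<open>Trajectory and control depend linearly on the pair of initial state and control, so the
  Hilbert norm identity holds at each time. It yields both the quadratic form \<open>V\<close> and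
  the convexity of the cost.\<close>

lemma J_parallelogram:
  assumes u: "pc u" and v: "pc v"
  shows "J h (x + y) (\<lambda>s. u s + v s) + J h (x - y) (\<lambda>s. u s - v s) = 2 * J h x u + 2 * J h y v"
proof -
  have "J h (x + y) (\<lambda>s. u s + v s) + J h (x - y) (\<lambda>s. u s - v s)
      = integral {0..h} (\<lambda>s. ((norm (X (x + y) (\<lambda>s. u s + v s) s))\<^sup>2 + (norm (u s + v s))\<^sup>2)
        + ((norm (X (x - y) (\<lambda>s. u s - v s) s))\<^sup>2 + (norm (u s - v s))\<^sup>2))"
    unfolding J_def
    by (intro Henstock_Kurzweil_Integration.integral_add[symmetric] cost_integrable pc_add pc_diff u v) auto
  also have "\<dots> = integral {0..h} (\<lambda>s. 2 * ((norm (X x u s))\<^sup>2 + (norm (u s))\<^sup>2) + 2 * ((norm (X y v s))\<^sup>2 + (norm (v s))\<^sup>2))"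
  proof (rule integral_cong)
    fix s
    show "((norm (X (x + y) (\<lambda>s. u s + v s) s))\<^sup>2 + (norm (u s + v s))\<^sup>2)
        + ((norm (X (x - y) (\<lambda>s. u s - v s) s))\<^sup>2 + (norm (u s - v s))\<^sup>2)
        = 2 * ((norm (X x u s))\<^sup>2 + (norm (u s))\<^sup>2) + 2 * ((norm (X y v s))\<^sup>2 + (norm (v s))\<^sup>2)"
      unfolding X_add[OF pc_on_pc[OF u] pc_on_pc[OF v]] X_diff[OF pc_on_pc[OF u] pc_on_pc[OF v]]
      using parallelogram_law[of "X x u s" "X y v s"] parallelogram_law[of "u s" "v s"] by argo
  qed
  also have "\<dots> = integral {0..h} (\<lambda>s. 2 * ((norm (X x u s))\<^sup>2 + (norm (u s))\<^sup>2))
      + integral {0..h} (\<lambda>s. 2 * ((norm (X y v s))\<^sup>2 + (norm (v s))\<^sup>2))"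
    by (intro Henstock_Kurzweil_Integration.integral_add integrable_on_mult_right cost_integrable u v) auto
  also have "\<dots> = 2 * J h x u + 2 * J h y v"
    unfolding J_def integral_mult_right ..
  finally show ?thesis .
qed

lemma J_scale:
  assumes u: "pc u"
  shows "J h (sX c x) (\<lambda>s. sU c (u s)) = (norm c)\<^sup>2 * J h x u"
proof -
  interpret hX: hilbert_space sX by (rule hilbert_X)
  interpret hU: hilbert_space sU by (rule hilbert_U)
  show ?thesis
    unfolding J_def integral_mult_right[symmetric]
    by (rule integral_cong)
      (simp add: X_scale[OF pc_on_pc[OF u]] hX.norm_scale hU.norm_scale power_mult_distrib distrib_left)
qed

text \<open>Bounding all costs \<open>J h\<close> replaces the improper integral over the half line.\<close>

definition V :: "'x \<Rightarrow> real"
  where "V x = Inf {c. \<exists>u. pc u \<and> (\<forall>h\<ge>0. J h x u \<le> c)}"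

text \<open>The steering controls are concatenated; the norm of the state at least halves on each
  block of length \<open>T\<close>, so the block costs are dominated by a geometric series.\<close>

lemma finite_cost: "\<exists>K\<ge>0. \<forall>x. \<exists>u. pc u \<and> (\<forall>h\<ge>0. J h x u \<le> K * (norm x)\<^sup>2)"
proof -
  obtain \<kappa> where \<kappa>: "\<And>x. continuous_on UNIV (\<kappa> x)"
    "\<And>x. integral {0..T} (\<lambda>t. (norm (\<kappa> x t))\<^sup>2) \<le> C * (norm x)\<^sup>2" "\<And>x. norm (X x (\<kappa> x) T) \<le> norm x / 2"
    using steer by metis
  \<comment> \<open>On one block the state is at most \<open>L * norm x\<close> by the energy bound,
    so the block costs at most \<open>T * L\<^sup>2 + C\<close> times the squared norm.\<close>
  define L where "L = S_sup T + S_sup T * norm B * (sqrt T * sqrt C)"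
  have L: "L \<ge> 0"
    using S_sup(1)[of T] T_pos C_nonneg by (simp add: L_def)
  define K where "K = T * L\<^sup>2 + C"
  have K: "K \<ge> 0"
    using T_pos C_nonneg by (simp add: K_def)
  have one: "J T x (\<kappa> x) \<le> K * (norm x)\<^sup>2" for x
  proof -
    have p: "pc (\<kappa> x)"
      by (rule pc_continuous[OF \<kappa>(1)])
    have state: "norm (X x (\<kappa> x) s) \<le> L * norm x" if s: "s \<in> {0..T}" for s
    proof -
      have "integral {0..s} (\<lambda>t. (norm (\<kappa> x t))\<^sup>2) \<le> integral {0..T} (\<lambda>t. (norm (\<kappa> x t))\<^sup>2)"
        using s by (intro integral_subset_le control_sq_integrable p) auto
      then have E: "integral {0..s} (\<lambda>t. (norm (\<kappa> x t))\<^sup>2) \<le> C * (norm x)\<^sup>2"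
        using \<kappa>(2)[of x] by linarith
      have "norm (X x (\<kappa> x) s) \<le> norm (S s x) + norm (integral {0..s} (\<lambda>r. S (s - r) (B (\<kappa> x r))))"
        unfolding mild_solution_def by (rule norm_triangle_ineq)
      also have "\<dots> \<le> S_sup T * norm x + S_sup T * norm B * (sqrt s * sqrt (C * (norm x)\<^sup>2))"
        using s by (intro add_mono norm_S_le norm_input_le_sqrt[OF pc_on_pc[OF p] _ _ E]) auto
      also have "\<dots> \<le> S_sup T * norm x + S_sup T * norm B * (sqrt T * sqrt (C * (norm x)\<^sup>2))"
        using s S_sup(1)[of T] C_nonneg by (intro add_left_mono mult_left_mono mult_right_mono) auto
      also have "\<dots> = L * norm x"
        by (simp add: L_def real_sqrt_mult algebra_simps)
      finally show ?thesis .
    qed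
    have "J T x (\<kappa> x) \<le> integral {0..T} (\<lambda>s. (L * norm x)\<^sup>2) + C * (norm x)\<^sup>2"
      unfolding J_eq[OF p] using state L
      by (intro add_mono \<kappa>(2) integral_le state_sq_integrable p power_mono) auto
    also have "\<dots> = K * (norm x)\<^sup>2"
      using T_pos by (simp add: K_def power_mult_distrib algebra_simps)
    finally show ?thesis .
  qed
  have "\<exists>u. pc u \<and> (\<forall>h\<ge>0. J h x u \<le> (2 * K) * (norm x)\<^sup>2)" for x
  proof -
    define y where "y n = ((\<lambda>y. X y (\<kappa> y) T) ^^ n) x" for n
    have y0: "y 0 = x" and ySuc: "y (Suc n) = X (y n) (\<kappa> (y n)) T" for n
      by (auto simp: y_def)
    have y_norm: "norm (y n) \<le> norm x / 2 ^ n" for n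
    proof (induction n)
      case (Suc n)
      have "norm (y (Suc n)) \<le> norm (y n) / 2"
        unfolding ySuc by (rule \<kappa>(3))
      also have "\<dots> \<le> norm x / 2 ^ n / 2"
        using Suc by (intro divide_right_mono) auto
      finally show ?case
        by (simp add: mult.commute)
    qed (simp add: y0)
    \<comment> \<open>Blocks are half-open, so at a switching time the next control is active; the
      end point of a block is discarded as a null set when costs are compared.\<close>
    define u where "u s = \<kappa> (y (nat \<lfloor>s / T\<rfloor>)) (s - real (nat \<lfloor>s / T\<rfloor>) * T)" for s
    have u_eq: "u s = \<kappa> (y n) (s - real n * T)" if "real n * T \<le> s" "s < real n * T + T" for n s
    proof -
      have "\<lfloor>s / T\<rfloor> = int n"
        using that T_pos by (intro floor_unique) (auto simp: field_simps)
      then show ?thesis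
        by (simp add: u_def)
    qed
    have pcn: "pc_on 0 (real n * T) u" for n
    proof (induction n)
      case 0
      then show ?case
        by (auto simp: pc_on_def intro: exI[of _ "{}"])
    next
      case (Suc n)
      have "pc_on (real n * T) (real (Suc n) * T) (\<lambda>s. \<kappa> (y n) (s - real n * T))"
        by (intro pc_on_continuous continuous_on_compose2[OF \<kappa>(1)] continuous_intros) auto
      then have "pc_on (real n * T) (real (Suc n) * T) u"
        by (rule pc_on_cong[rotated]) (simp add: u_eq[of n] distrib_right)
      with Suc show ?case
        by (rule pc_on_join)
    qed
    have multiple: "\<exists>n. h \<le> real n * T" for h
      using reals_Archimedean3[OF T_pos] less_imp_le by blast
    have p: "pc u"
      unfolding pc_def using multiple pcn pc_on_subset order_refl by metis
    have tail: "u (s + real n * T) = \<kappa> (y n) s" if "s \<in> {0..<T}" for n s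
      using u_eq[of n "s + real n * T"] that by simp
    have Xn: "X x u (real n * T) = y n" for n
    proof (induction n)
      case 0
      then show ?case
        by (simp add: X_0 y0)
    next
      case (Suc n)
      have "X x u (real n * T + T) = X (y n) (\<lambda>s. u (s + real n * T)) T"
        using X_concat[OF pc_on_pc[OF p], of "real n * T" T x] T_pos Suc by simp
      also have "\<dots> = y (Suc n)"
        unfolding ySuc by (rule X_cong) (rule tail)
      finally show ?case
        by (simp add: algebra_simps)
    qed
    \<comment> \<open>The bound on the squared state decays by \<open>1 / 4\<close> per block;
      weakening this to \<open>1 / 2\<close> gives partial sums with the closed form
      \<open>2 * (1 - 1 / 2 ^ n)\<close>.\<close>
    have Jn: "J (real n * T) x u \<le> 2 * K * (norm x)\<^sup>2 * (1 - 1 / 2 ^ n)" for n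
    proof (induction n)
      case 0
      then show ?case
        by (simp add: J_def)
    next
      case (Suc n)
      have "J T (y n) (\<lambda>s. u (s + real n * T)) = J T (y n) (\<kappa> (y n))"
        unfolding J_def
      proof (rule integral_spike[of "{T}"])
        fix s assume s: "s \<in> {0..T} - {T}"
        then have "X (y n) (\<lambda>s. u (s + real n * T)) s = X (y n) (\<kappa> (y n)) s"
          by (intro X_cong tail) auto
        then show "(norm (X (y n) (\<kappa> (y n)) s))\<^sup>2 + (norm (\<kappa> (y n) s))\<^sup>2
            = (norm (X (y n) (\<lambda>s. u (s + real n * T)) s))\<^sup>2 + (norm (u (s + real n * T)))\<^sup>2"
          using s tail[of s n] by simp
      qed simp
      also have "\<dots> \<le> K * (norm (y n))\<^sup>2"
        by (rule one)
      also have "\<dots> \<le> K * (norm x / 2 ^ n)\<^sup>2"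
        using y_norm K by (intro mult_left_mono power_mono) auto
      also have "\<dots> \<le> K * ((norm x)\<^sup>2 / 2 ^ n)"
      proof -
        have "(1::real) \<le> 2 ^ n"
          by simp
        then have "(norm x)\<^sup>2 / (2 ^ n * 2 ^ n) \<le> (norm x)\<^sup>2 / (2 ^ n * 1)"
          by (intro divide_left_mono mult_left_mono) auto
        then show ?thesis
          using K by (intro mult_left_mono) (auto simp: power2_eq_square)
      qed
      finally have "J (real n * T + T) x u \<le> J (real n * T) x u + K * ((norm x)\<^sup>2 / 2 ^ n)"
        using J_add[OF p, of "real n * T" T x] T_pos by (simp add: Xn)
      also have "\<dots> \<le> 2 * K * (norm x)\<^sup>2 * (1 - 1 / 2 ^ n) + K * ((norm x)\<^sup>2 / 2 ^ n)"
        using Suc by simp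
      also have "\<dots> = 2 * K * (norm x)\<^sup>2 * (1 - 1 / 2 ^ Suc n)"
        by (simp add: field_simps)
      finally show ?case
        by (simp add: algebra_simps)
    qed
    have "J h x u \<le> (2 * K) * (norm x)\<^sup>2" if h: "h \<ge> 0" for h
    proof -
      obtain n where n: "h \<le> real n * T"
        using multiple by blast
      have "J h x u \<le> 2 * K * (norm x)\<^sup>2 * (1 - 1 / 2 ^ n)"
        using J_mono[OF p h n] Jn order_trans by blast
      also have "\<dots> \<le> 2 * K * (norm x)\<^sup>2 * 1"
        using K by (intro mult_left_mono) auto
      finally show ?thesis
        by simp
    qed
    with p show ?thesis
      by blast
  qed
  then show ?thesis
    using K by (intro exI[of _ "2 * K"]) simp
qed

lemma V_le:
  assumes "pc u" "\<And>h. h \<ge> 0 \<Longrightarrow> J h x u \<le> c"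
  shows "V x \<le> c"
  unfolding V_def
proof (rule cInf_lower)
  show "bdd_below {c. \<exists>u. pc u \<and> (\<forall>h\<ge>0. J h x u \<le> c)}"
  proof (rule bdd_belowI[of _ 0])
    fix c assume "c \<in> {c. \<exists>u. pc u \<and> (\<forall>h\<ge>0. J h x u \<le> c)}"
    then obtain u where "pc u" "J 0 x u \<le> c"
      by auto
    then show "0 \<le> c"
      using J_nonneg[of u 0 x] by simp
  qed
qed (use assms in blast)

lemma cost_set_nonempty: "{c. \<exists>u. pc u \<and> (\<forall>h\<ge>0. J h x u \<le> c)} \<noteq> {}"
proof -
  obtain K where "\<forall>x. \<exists>u. pc u \<and> (\<forall>h\<ge>0. J h x u \<le> K * (norm x)\<^sup>2)"
    using finite_cost by blast
  then have "K * (norm x)\<^sup>2 \<in> {c. \<exists>u. pc u \<and> (\<forall>h\<ge>0. J h x u \<le> c)}"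
    by simp
  then show ?thesis
    by (metis empty_iff)
qed

lemma V_nonneg: "0 \<le> V x"
  unfolding V_def
proof (rule cInf_greatest[OF cost_set_nonempty])
  fix c assume "c \<in> {c. \<exists>u. pc u \<and> (\<forall>h\<ge>0. J h x u \<le> c)}"
  then obtain u where "pc u" "J 0 x u \<le> c"
    by auto
  then show "0 \<le> c"
    using J_nonneg[of u 0 x] by simp
qed

lemma V_bound: "\<exists>K\<ge>0. \<forall>x. V x \<le> K * (norm x)\<^sup>2"
proof -
  obtain K where K: "K \<ge> 0" "\<forall>x. \<exists>u. pc u \<and> (\<forall>h\<ge>0. J h x u \<le> K * (norm x)\<^sup>2)"
    using finite_cost by blast
  have "V x \<le> K * (norm x)\<^sup>2" for x
  proof -
    obtain u where "pc u" "\<And>h. h \<ge> 0 \<Longrightarrow> J h x u \<le> K * (norm x)\<^sup>2"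
      using K(2) by blast
    then show ?thesis
      by (rule V_le)
  qed
  with K(1) show ?thesis
    by blast
qed

section \<open>Near-optimal controls, the quadratic value and dynamic programming\<close>

definition near_optimal :: "'x \<Rightarrow> real \<Rightarrow> (real \<Rightarrow> 'u) \<Rightarrow> bool"
  where "near_optimal x e u \<longleftrightarrow> pc u \<and> (\<forall>h\<ge>0. J h x u \<le> V x + e)"

lemma near_optimal_exists:
  assumes "e > 0"
  shows "\<exists>u. near_optimal x e u"
proof -
  obtain c where c: "c \<in> {c. \<exists>u. pc u \<and> (\<forall>h\<ge>0. J h x u \<le> c)}" "c < V x + e"
    using cInf_lessD[OF cost_set_nonempty, of x "V x + e"] assms unfolding V_def by auto
  then obtain u where "pc u" "\<forall>h\<ge>0. J h x u \<le> c"
    by blast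
  then have "near_optimal x e u"
    using order_trans[OF _ less_imp_le[OF c(2)]] unfolding near_optimal_def by simp
  then show ?thesis
    by blast
qed

text \<open>The hypothesis couples both costs at one horizon. Monotonicity, applied at the larger of
  two horizons, decouples them, and the two infima can be taken one after the other.\<close>

lemma V_add_le:
  assumes u: "pc u" and v: "pc v" and le: "\<And>h. h \<ge> 0 \<Longrightarrow> J h x u + J h y v \<le> c"
  shows "V x + V y \<le> c"
proof -
  have "J h x u + J h' y v \<le> c" if "h \<ge> 0" "h' \<ge> 0" for h h'
  proof -
    have "max h h' \<ge> 0"
      using that by simp
    from le[OF this] show ?thesis
      using J_mono[OF u that(1), of "max h h'" x] J_mono[OF v that(2), of "max h h'" y] by simp
  qed
  then have "J h x u \<le> c - J h' y v" if "h \<ge> 0" "h' \<ge> 0" for h h'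
    using that by (simp add: le_diff_eq)
  then have "V x \<le> c - J h' y v" if "h' \<ge> 0" for h'
    using that V_le[OF u, of x "c - J h' y v"] by simp
  then have "J h' y v \<le> c - V x" if "h' \<ge> 0" for h'
    using that by (simp add: le_diff_eq add.commute)
  then have "V y \<le> c - V x"
    by (rule V_le[OF v])
  then show ?thesis
    by simp
qed

lemma V_scale: "V (sX c x) = (norm c)\<^sup>2 * V x"
proof -
  interpret hX: hilbert_space sX by (rule hilbert_X)
  have le: "V (sX c x) \<le> (norm c)\<^sup>2 * V x" for c x
  proof (rule field_le_epsilon)
    fix e :: real assume "e > 0"
    define d where "d = e / ((norm c)\<^sup>2 + 1)"
    have pos: "(norm c)\<^sup>2 + 1 > 0"
      by (simp add: add_nonneg_pos)
    then have d: "d > 0" "(norm c)\<^sup>2 * d \<le> e"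
      using \<open>e > 0\<close> by (auto simp: d_def field_simps)
    obtain u where u: "near_optimal x d u"
      using near_optimal_exists d by blast
    have "V (sX c x) \<le> (norm c)\<^sup>2 * (V x + d)"
      using u by (intro V_le[OF pc_scale[of u c]]) (auto simp: near_optimal_def J_scale intro!: mult_left_mono)
    then show "V (sX c x) \<le> (norm c)\<^sup>2 * V x + e"
      using d by (simp add: distrib_left)
  qed
  show ?thesis
  proof (cases "c = 0")
    case True
    then show ?thesis
      using le[of c x] V_nonneg[of "sX c x"] by simp
  next
    case False
    have "V x \<le> (norm (inverse c))\<^sup>2 * V (sX c x)"
      using le[of "inverse c" "sX c x"] False by simp
    then have "(norm c)\<^sup>2 * V x \<le> (norm c)\<^sup>2 * ((norm (inverse c))\<^sup>2 * V (sX c x))"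
      by (intro mult_left_mono) auto
    also have "\<dots> = V (sX c x)"
      using False by (simp add: norm_inverse power_inverse)
    finally show ?thesis
      using le[of c x] by simp
  qed
qed

lemma V_scaleR: "V (r *\<^sub>R x) = r\<^sup>2 * V x"
  using V_scale[of "of_real r" x] hilbert_space.scale_of_real[OF hilbert_X, of r x] by simp

text \<open>Combining near-optimal controls gives one inequality; the other is the same inequality
  at \<open>x + y\<close> and \<open>x - y\<close>, since \<open>V\<close> scales
  quadratically.\<close>

lemma V_parallelogram: "V (x + y) + V (x - y) = 2 * V x + 2 * V y"
proof -
  have le: "V (x + y) + V (x - y) \<le> 2 * V x + 2 * V y" for x y
  proof (rule field_le_epsilon)
    fix e :: real assume "e > 0"
    then obtain u v where uv: "near_optimal x (e/4) u" "near_optimal y (e/4) v"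
      using near_optimal_exists[of "e/4"] by (metis divide_pos_pos zero_less_numeral)
    then have p: "pc u" "pc v"
      by (auto simp: near_optimal_def)
    show "V (x + y) + V (x - y) \<le> 2 * V x + 2 * V y + e"
    proof (rule V_add_le[OF pc_add[OF p] pc_diff[OF p]])
      fix h :: real assume "h \<ge> 0"
      then have "J h x u \<le> V x + e / 4" "J h y v \<le> V y + e / 4"
        using uv by (auto simp: near_optimal_def)
      then show "J h (x + y) (\<lambda>s. u s + v s) + J h (x - y) (\<lambda>s. u s - v s) \<le> 2 * V x + 2 * V y + e"
        unfolding J_parallelogram[OF p] by linarith
    qed
  qed
  have "V (2 *\<^sub>R x) + V (2 *\<^sub>R y) \<le> 2 * V (x + y) + 2 * V (x - y)"
    using le[of "x + y" "x - y"] by (simp add: scaleR_2 algebra_simps)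
  then show ?thesis
    using le[of x y] by (simp add: V_scaleR)
qed

text \<open>Uniform convexity: the sum of the two controls starts at \<open>x + x\<close>, whose
  value is already \<open>4 * V x\<close>, so the parallelogram law leaves at most
  \<open>2 * (e + e')\<close> for the cost of the difference, which starts at
  \<open>0\<close>.\<close>

lemma near_optimal_diff:
  assumes u: "near_optimal x e u" and v: "near_optimal x e' v" and h: "h \<ge> 0"
  shows "integral {0..h} (\<lambda>s. (norm (u s - v s))\<^sup>2) \<le> 2 * (e + e')"
proof -
  have p: "pc u" "pc v"
    using u v by (auto simp: near_optimal_def)
  let ?p = "\<lambda>s. u s + v s" and ?m = "\<lambda>s. u s - v s"
  have sum: "J k (x + x) ?p + J k (x - x) ?m \<le> 4 * V x + 2 * (e + e')" if "k \<ge> 0" for k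
  proof -
    have "J k x u \<le> V x + e" "J k x v \<le> V x + e'"
      using u v that by (auto simp: near_optimal_def)
    then have "2 * J k x u + 2 * J k x v \<le> 2 * (V x + e) + 2 * (V x + e')"
      by (intro add_mono mult_left_mono) auto
    then show ?thesis
      unfolding J_parallelogram[OF p] by simp
  qed
  \<comment> \<open>A finite-horizon cost of the sum may lie below \<open>V (x + x)\<close>. The
    horizon \<open>h\<close> of the difference is therefore frozen while the horizon
    \<open>k\<close> of the sum runs through all values.\<close>
  have "V (x + x) \<le> 4 * V x + 2 * (e + e') - J h (x - x) ?m"
  proof (rule V_le[OF pc_add[OF p]])
    fix k :: real assume k: "k \<ge> 0"
    show "J k (x + x) ?p \<le> 4 * V x + 2 * (e + e') - J h (x - x) ?m"
    proof -
      have "max k h \<ge> 0"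
        using k by simp
      from sum[OF this] show ?thesis
        using J_mono[OF pc_add[OF p] k, of "max k h" "x + x"] J_mono[OF pc_diff[OF p] h, of "max k h" "x - x"]
        by simp
    qed
  qed
  moreover have "V (x + x) = 4 * V x"
    using V_scaleR[of 2 x] by (simp add: scaleR_2)
  ultimately have "J h (x - x) ?m \<le> 2 * (e + e')"
    by simp
  moreover have "integral {0..h} (\<lambda>s. (norm (X (x - x) ?m s))\<^sup>2) \<ge> 0"
    by (intro integral_nonneg state_sq_integrable pc_diff p) auto
  ultimately show ?thesis
    unfolding J_eq[OF pc_diff[OF p]] by linarith
qed

lemma near_optimal_state_diff:
  assumes u: "near_optimal x e u" and v: "near_optimal x e' v" and t: "0 \<le> t" "t \<le> h"
  shows "norm (X x u t - X x v t) \<le> S_sup h * norm B * (sqrt t * sqrt (2 * (e + e')))"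
  using u v near_optimal_diff[OF u v t(1)] t
  by (intro norm_X_diff_le) (auto simp: near_optimal_def pc_on_pc)

lemma V_dynamic_programming:
  assumes u: "pc u" and h: "0 \<le> h" and v: "near_optimal (X x u h) e v"
  defines "w \<equiv> \<lambda>s. if s < h then u s else v (s - h)"
  shows "pc w" and "\<And>k. k \<ge> 0 \<Longrightarrow> J k x w \<le> J h x u + V (X x u h) + e"
proof -
  have pv: "pc v"
    using v by (simp add: near_optimal_def)
  have e: "V (X x u h) + e \<ge> 0"
    using v J_nonneg[OF pv, of 0 "X x u h"] unfolding near_optimal_def by (meson order_refl order_trans)
  show p: "pc w"
    unfolding pc_def
  proof
    fix b
    have 1: "pc_on 0 h w"
      by (rule pc_on_cong[OF _ pc_on_pc[OF u]]) (auto simp: w_def)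
    have "pc_on (h + (- h)) (max b h + (- h)) v"
      using pc_on_pc[OF pv] by simp
    from pc_on_shift[OF this] have "pc_on h (max b h) w"
      by (rule pc_on_cong[rotated]) (auto simp: w_def)
    from pc_on_join[OF 1 this] show "pc_on 0 b w"
      by (rule pc_on_subset) auto
  qed
  have Xw: "X x w s = X x u s" if "s \<le> h" for s
    by (rule X_cong) (use that in \<open>auto simp: w_def\<close>)
  have Jh: "J h x w = J h x u"
    unfolding J_def by (rule integral_spike[of "{h}"]) (auto simp: Xw, auto simp: w_def)
  have tail: "X (X x u h) (\<lambda>s. w (s + h)) r = X (X x u h) v r" for r
    by (rule X_cong) (auto simp: w_def)
  have Jt: "J t (X x u h) (\<lambda>s. w (s + h)) = J t (X x u h) v" for t
    unfolding J_def by (rule integral_cong) (auto simp: tail, auto simp: w_def)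
  fix k :: real assume k: "k \<ge> 0"
  show "J k x w \<le> J h x u + V (X x u h) + e"
  proof (cases "k \<le> h")
    case True
    then show ?thesis
      using J_mono[OF p k True, of x] Jh e by simp
  next
    case False
    then have "J k x w = J h x u + J (k - h) (X x u h) v"
      using J_add[OF p h, of "k - h" x] Jh Jt Xw[of h] by simp
    then show ?thesis
      using v False by (simp add: near_optimal_def)
  qed
qed

lemma V_le_step:
  assumes u: "pc u" and h: "0 \<le> h"
  shows "V x \<le> J h x u + V (X x u h)"
proof (rule field_le_epsilon)
  fix e :: real assume "e > 0"
  then obtain v where "near_optimal (X x u h) e v"
    using near_optimal_exists by blast
  from V_dynamic_programming[OF u h this] show "V x \<le> J h x u + V (X x u h) + e"
    by (rule V_le)
qed

text \<open>The principle of optimality with the same gap \<open>e\<close>: it does not grow,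
  because \<open>V x\<close> is at most the cost up to \<open>h\<close> plus the value of the state
  reached.\<close>

lemma near_optimal_tail:
  assumes u: "near_optimal x e u" and h: "0 \<le> h"
  shows "J h x u + V (X x u h) \<le> V x + e" and "near_optimal (X x u h) e (\<lambda>s. u (s + h))"
proof -
  have p: "pc u" and le: "\<And>k. k \<ge> 0 \<Longrightarrow> J k x u \<le> V x + e"
    using u by (auto simp: near_optimal_def)
  have tail: "J k (X x u h) (\<lambda>s. u (s + h)) \<le> V x + e - J h x u" if "k \<ge> 0" for k
    using le[of "h + k"] J_add[OF p h that, of x] h that by simp
  then have "V (X x u h) \<le> V x + e - J h x u"
    by (rule V_le[OF pc_shift[OF p h]])
  then show "J h x u + V (X x u h) \<le> V x + e"
    by simp
  show "near_optimal (X x u h) e (\<lambda>s. u (s + h))"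
    unfolding near_optimal_def
  proof (intro conjI pc_shift p h allI impI)
    fix k :: real assume "k \<ge> 0"
    from tail[OF this] show "J k (X x u h) (\<lambda>s. u (s + h)) \<le> V (X x u h) + e"
      using V_le_step[OF p h, of x] by simp
  qed
qed

end

section \<open>The semigroup of optimal states\<close>

context steerable_control
begin

text \<open>By the parallelogram law the excess costs of sum and difference together are at most
  \<open>4 * e\<close>, and the difference cannot stay below its own value at all horizons. This is
  what makes optimal states additive.\<close>

lemma near_optimal_add:
  assumes u: "near_optimal x e u" and v: "near_optimal y e v"
  shows "near_optimal (x + y) (4 * e) (\<lambda>s. u s + v s)"
proof -
  have p: "pc u" "pc v"
    using u v by (auto simp: near_optimal_def)
  let ?p = "\<lambda>s. u s + v s" and ?m = "\<lambda>s. u s - v s"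
  have sum: "J k (x + y) ?p + J k (x - y) ?m \<le> V (x + y) + V (x - y) + 4 * e" if "k \<ge> 0" for k
  proof -
    have "J k x u \<le> V x + e" "J k y v \<le> V y + e"
      using u v that by (auto simp: near_optimal_def)
    then have "2 * J k x u + 2 * J k y v \<le> 2 * (V x + e) + 2 * (V y + e)"
      by (intro add_mono mult_left_mono) auto
    then show ?thesis
      unfolding J_parallelogram[OF p] V_parallelogram by simp
  qed
  have "J h (x + y) ?p \<le> V (x + y) + 4 * e" if h: "h \<ge> 0" for h
  proof -
    have "V (x - y) \<le> V (x + y) + V (x - y) + 4 * e - J h (x + y) ?p"
    proof (rule V_le[OF pc_diff[OF p]])
      fix k :: real assume k: "k \<ge> 0"
      have "max k h \<ge> 0"
        using k by simp
      from sum[OF this] show "J k (x - y) ?m \<le> V (x + y) + V (x - y) + 4 * e - J h (x + y) ?p"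
        using J_mono[OF pc_add[OF p] h, of "max k h" "x + y"] J_mono[OF pc_diff[OF p] k, of "max k h" "x - y"]
        by simp
    qed
    then show ?thesis
      by simp
  qed
  then show ?thesis
    unfolding near_optimal_def using pc_add[OF p] by simp
qed

lemma near_optimal_scale:
  assumes u: "near_optimal x e u"
  shows "near_optimal (sX c x) ((norm c)\<^sup>2 * e) (\<lambda>s. sU c (u s))"
proof -
  have p: "pc u"
    using u by (simp add: near_optimal_def)
  have "J h (sX c x) (\<lambda>s. sU c (u s)) \<le> (norm c)\<^sup>2 * (V x + e)" if "h \<ge> 0" for h
    unfolding J_scale[OF p] using u that by (intro mult_left_mono) (auto simp: near_optimal_def)
  then show ?thesis
    unfolding near_optimal_def using pc_scale[OF p] by (simp add: V_scale distrib_left)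
qed

definition near_optimal_seq :: "'x \<Rightarrow> nat \<Rightarrow> real \<Rightarrow> 'u"
  where "near_optimal_seq x n = (SOME u. near_optimal x (1 / real (Suc n)) u)"

lemma near_optimal_seq: "near_optimal x (1 / real (Suc n)) (near_optimal_seq x n)"
  unfolding near_optimal_seq_def by (rule someI_ex[OF near_optimal_exists]) simp

definition optimal_state :: "real \<Rightarrow> 'x \<Rightarrow> 'x"
  where "optimal_state t x = lim (\<lambda>n. X x (near_optimal_seq x n) t)"

lemma optimal_state_limit:
  assumes t: "0 \<le> t"
  shows "(\<lambda>n. X x (near_optimal_seq x n) t) \<longlonglongrightarrow> optimal_state t x"
proof -
  define K where "K = S_sup t * norm B * sqrt t"
  have K: "K \<ge> 0"
    using S_sup(1)[of t] t by (simp add: K_def)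
  have close: "norm (X x (near_optimal_seq x m) t - X x (near_optimal_seq x n) t) \<le> K * sqrt (4 / real (Suc N))"
    if "m \<ge> N" "n \<ge> N" for m n N
  proof -
    have "1 / real (Suc m) \<le> 1 / real (Suc N)" "1 / real (Suc n) \<le> 1 / real (Suc N)"
      using that by (auto intro!: divide_left_mono)
    then have "2 * (1 / real (Suc m) + 1 / real (Suc n)) \<le> 2 * (1 / real (Suc N) + 1 / real (Suc N))"
      by (intro mult_left_mono add_mono) auto
    then have "sqrt (2 * (1 / real (Suc m) + 1 / real (Suc n))) \<le> sqrt (4 / real (Suc N))"
      by (intro real_sqrt_le_mono) simp
    then have "K * sqrt (2 * (1 / real (Suc m) + 1 / real (Suc n))) \<le> K * sqrt (4 / real (Suc N))"
      using K by (rule mult_left_mono)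
    then show ?thesis
      using near_optimal_state_diff[OF near_optimal_seq near_optimal_seq t order_refl, of x m n]
      unfolding K_def by (simp add: mult.assoc)
  qed
  have lim0: "(\<lambda>N. K * sqrt (4 / real (Suc N))) \<longlonglongrightarrow> 0"
  proof -
    have "(\<lambda>N. K * sqrt (4 * (1 / real (Suc N)))) \<longlonglongrightarrow> K * sqrt (4 * 0)"
      by (intro tendsto_intros LIMSEQ_Suc lim_1_over_n)
    then show ?thesis
      by simp
  qed
  have "Cauchy (\<lambda>n. X x (near_optimal_seq x n) t)"
  proof (rule CauchyI)
    fix e :: real assume "e > 0"
    then obtain N where N: "K * sqrt (4 / real (Suc N)) < e"
      using order_tendstoD(2)[OF lim0] by (auto simp: eventually_sequentially)
    have "norm (X x (near_optimal_seq x m) t - X x (near_optimal_seq x n) t) < e" if "m \<ge> N" "n \<ge> N" for m n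
      using close[OF that] N by simp
    then show "\<exists>M. \<forall>m\<ge>M. \<forall>n\<ge>M. norm (X x (near_optimal_seq x m) t - X x (near_optimal_seq x n) t) < e"
      by blast
  qed
  then show ?thesis
    unfolding optimal_state_def by (simp add: Cauchy_convergent_iff convergent_LIMSEQ_iff)
qed

lemma optimal_state_diff:
  assumes u: "near_optimal x e u" and t: "0 \<le> t" "t \<le> h"
  shows "norm (X x u t - optimal_state t x) \<le> S_sup h * norm B * (sqrt t * sqrt (2 * e))"
proof -
  have "(\<lambda>n. norm (X x u t - X x (near_optimal_seq x n) t)) \<longlonglongrightarrow> norm (X x u t - optimal_state t x)"
    by (intro tendsto_intros optimal_state_limit t)
  moreover have "(\<lambda>n. S_sup h * norm B * (sqrt t * sqrt (2 * (e + 1 / real (Suc n)))))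
      \<longlonglongrightarrow> S_sup h * norm B * (sqrt t * sqrt (2 * (e + 0)))"
    by (intro tendsto_intros LIMSEQ_Suc lim_1_over_n)
  ultimately have "norm (X x u t - optimal_state t x) \<le> S_sup h * norm B * (sqrt t * sqrt (2 * (e + 0)))"
    by (rule LIMSEQ_le) (use near_optimal_state_diff[OF u near_optimal_seq t] in blast)
  then show ?thesis
    by simp
qed

text \<open>The limit state does not depend on the choice of near-optimal controls. The factor
  \<open>c\<close> leaves room for the \<open>4\<close> of sums and the squared norm of a
  scalar.\<close>

lemma optimal_state_unique:
  assumes u: "\<And>n. near_optimal x (c / real (Suc n)) (u n)" and t: "0 \<le> t"
  shows "(\<lambda>n. X x (u n) t) \<longlonglongrightarrow> optimal_state t x"
proof -
  have "(\<lambda>n. S_sup t * norm B * (sqrt t * sqrt (2 * (c * (1 / real (Suc n))))))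
      \<longlonglongrightarrow> S_sup t * norm B * (sqrt t * sqrt (2 * (c * 0)))"
    by (intro tendsto_intros LIMSEQ_Suc lim_1_over_n)
  then have "(\<lambda>n. S_sup t * norm B * (sqrt t * sqrt (2 * (c / real (Suc n))))) \<longlonglongrightarrow> 0"
    by simp
  then have "(\<lambda>n. X x (u n) t - optimal_state t x) \<longlonglongrightarrow> 0"
    by (rule Lim_null_comparison[rotated]) (intro always_eventually allI optimal_state_diff[OF u t order_refl])
  then show ?thesis
    by (simp add: LIM_zero_iff)
qed

lemma optimal_state_add:
  assumes t: "0 \<le> t"
  shows "optimal_state t (x + y) = optimal_state t x + optimal_state t y"
proof (rule LIMSEQ_unique)
  let ?u = "near_optimal_seq x" and ?v = "near_optimal_seq y"
  have pcs: "pc (?u n)" "pc (?v n)" for n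
    using near_optimal_seq by (auto simp: near_optimal_def)
  have "near_optimal (x + y) (4 / real (Suc n)) (\<lambda>s. ?u n s + ?v n s)" for n
    using near_optimal_add[OF near_optimal_seq[of x n] near_optimal_seq[of y n]] by simp
  then show "(\<lambda>n. X (x + y) (\<lambda>s. ?u n s + ?v n s) t) \<longlonglongrightarrow> optimal_state t (x + y)"
    by (rule optimal_state_unique[OF _ t])
  show "(\<lambda>n. X (x + y) (\<lambda>s. ?u n s + ?v n s) t) \<longlonglongrightarrow> optimal_state t x + optimal_state t y"
    using tendsto_add[OF optimal_state_limit[OF t] optimal_state_limit[OF t], of x y]
    by (simp add: X_add[OF pc_on_pc[OF pcs(1)] pc_on_pc[OF pcs(2)]])
qed

lemma optimal_state_scale:
  assumes t: "0 \<le> t"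
  shows "optimal_state t (sX c x) = sX c (optimal_state t x)"
proof (rule LIMSEQ_unique)
  let ?u = "near_optimal_seq x"
  have pcs: "pc (?u n)" for n
    using near_optimal_seq by (auto simp: near_optimal_def)
  have "near_optimal (sX c x) ((norm c)\<^sup>2 / real (Suc n)) (\<lambda>s. sU c (?u n s))" for n
    using near_optimal_scale[OF near_optimal_seq, of c x n] by simp
  then show "(\<lambda>n. X (sX c x) (\<lambda>s. sU c (?u n s)) t) \<longlonglongrightarrow> optimal_state t (sX c x)"
    by (rule optimal_state_unique[OF _ t])
  show "(\<lambda>n. X (sX c x) (\<lambda>s. sU c (?u n s)) t) \<longlonglongrightarrow> sX c (optimal_state t x)"
    using bounded_linear.tendsto[OF hilbert_space.scale_bounded_linear[OF hilbert_X] optimal_state_limit[OF t], of c x]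
    by (simp add: X_scale[OF pc_on_pc[OF pcs] t])
qed

lemma control_energy_le:
  assumes u: "pc u"
  shows "integral {0..h} (\<lambda>s. (norm (u s))\<^sup>2) \<le> J h x u"
proof -
  have "integral {0..h} (\<lambda>s. (norm (X x u s))\<^sup>2) \<ge> 0"
    by (intro integral_nonneg state_sq_integrable u) auto
  then show ?thesis
    by (simp add: J_eq[OF u])
qed

lemma norm_X_le:
  assumes u: "pc u" and t: "0 \<le> t" "t \<le> h" and E: "integral {0..t} (\<lambda>s. (norm (u s))\<^sup>2) \<le> E"
  shows "norm (X x u t) \<le> S_sup h * norm x + S_sup h * norm B * (sqrt t * sqrt E)"
proof -
  have "norm (X x u t) \<le> norm (S t x) + norm (integral {0..t} (\<lambda>s. S (t - s) (B (u s))))"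
    unfolding mild_solution_def by (rule norm_triangle_ineq)
  also have "\<dots> \<le> S_sup h * norm x + S_sup h * norm B * (sqrt t * sqrt E)"
    using t by (intro add_mono norm_S_le norm_input_le_sqrt[OF pc_on_pc[OF u] t E]) auto
  finally show ?thesis .
qed

lemma optimal_state_local_bound: "\<exists>M. \<forall>t x. 0 \<le> t \<longrightarrow> t \<le> h \<longrightarrow> norm (optimal_state t x) \<le> M * norm x"
proof -
  obtain K where K: "K \<ge> 0" "\<And>x. V x \<le> K * (norm x)\<^sup>2"
    using V_bound by blast
  define M where "M = S_sup h + S_sup h * norm B * (sqrt h * sqrt K)"
  have "norm (optimal_state t x) \<le> M * norm x" if t: "0 \<le> t" "t \<le> h" for t x
  proof -
    let ?u = "near_optimal_seq x"
    have "norm (X x (?u n) t) \<le> S_sup h * norm x + S_sup h * norm B * (sqrt t * sqrt (V x + 1 / real (Suc n)))" for n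
    proof (rule norm_X_le)
      show "pc (?u n)"
        using near_optimal_seq by (auto simp: near_optimal_def)
      then show "integral {0..t} (\<lambda>s. (norm (?u n s))\<^sup>2) \<le> V x + 1 / real (Suc n)"
        using control_energy_le[of "?u n" t x] near_optimal_seq[of x n] t
        unfolding near_optimal_def by (meson order_trans)
    qed (use t in auto)
    moreover have "(\<lambda>n. S_sup h * norm x + S_sup h * norm B * (sqrt t * sqrt (V x + 1 / real (Suc n))))
        \<longlonglongrightarrow> S_sup h * norm x + S_sup h * norm B * (sqrt t * sqrt (V x + 0))"
      by (intro tendsto_intros LIMSEQ_Suc lim_1_over_n)
    ultimately have "norm (optimal_state t x) \<le> S_sup h * norm x + S_sup h * norm B * (sqrt t * sqrt (V x + 0))"
      using LIMSEQ_le[OF tendsto_norm[OF optimal_state_limit[OF t(1)]]] by blast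
    also have "\<dots> \<le> S_sup h * norm x + S_sup h * norm B * (sqrt h * sqrt (K * (norm x)\<^sup>2))"
      using t S_sup(1)[of h] K(2)[of x] V_nonneg[of x]
      by (intro add_left_mono mult_left_mono mult_mono real_sqrt_le_mono) auto
    also have "\<dots> = M * norm x"
      by (simp add: M_def real_sqrt_mult algebra_simps)
    finally show ?thesis .
  qed
  then show ?thesis
    by blast
qed

lemma optimal_state_bounded_linear:
  assumes t: "0 \<le> t"
  shows "bounded_linear (optimal_state t)"
proof -
  interpret hX: hilbert_space sX by (rule hilbert_X)
  obtain M where M: "\<forall>s x. 0 \<le> s \<longrightarrow> s \<le> t \<longrightarrow> norm (optimal_state s x) \<le> M * norm x"
    using optimal_state_local_bound by blast
  show ?thesis
  proof
    show "optimal_state t (r *\<^sub>R x) = r *\<^sub>R optimal_state t x" for r x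
      using optimal_state_scale[OF t, of "of_real r" x] by (simp add: hX.scale_of_real)
    show "\<exists>K. \<forall>x. norm (optimal_state t x) \<le> norm x * K"
      using M t by (intro exI[of _ M]) (simp add: mult.commute)
  qed (rule optimal_state_add[OF t])
qed

definition optimal_semigroup :: "real \<Rightarrow> 'x \<Rightarrow>\<^sub>L 'x"
  where "optimal_semigroup t = Blinfun (optimal_state t)"

lemma optimal_semigroup_apply: "0 \<le> t \<Longrightarrow> optimal_semigroup t x = optimal_state t x"
  by (simp add: optimal_semigroup_def bounded_linear_Blinfun_apply optimal_state_bounded_linear)

text \<open>The tail of a near-optimal control is near-optimal for the state it has reached, which
  varies with \<open>n\<close>; the comparison estimate is uniform in that state, and boundedness of
  \<open>optimal_state s\<close> permits the limit.\<close>

lemma optimal_state_semigroup: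
  assumes s: "0 \<le> s" and t: "0 \<le> t"
  shows "optimal_state (s + t) x = optimal_state s (optimal_state t x)"
proof (rule LIMSEQ_unique)
  let ?u = "near_optimal_seq x"
  let ?K = "\<lambda>n. S_sup s * norm B * (sqrt s * sqrt (2 * (1 / real (Suc n))))"
  show "(\<lambda>n. X x (?u n) (s + t)) \<longlonglongrightarrow> optimal_state (s + t) x"
    using s t by (intro optimal_state_limit) auto
  have "(\<lambda>n. S_sup s * norm B * (sqrt s * sqrt (2 * (1 / real (Suc n)))))
      \<longlonglongrightarrow> S_sup s * norm B * (sqrt s * sqrt (2 * 0))"
    by (intro tendsto_intros LIMSEQ_Suc lim_1_over_n)
  then have K: "?K \<longlonglongrightarrow> 0"
    by simp
  have "norm (X x (?u n) (s + t) - optimal_state s (X x (?u n) t)) \<le> ?K n" for n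
  proof -
    have "pc (?u n)"
      using near_optimal_seq by (auto simp: near_optimal_def)
    then have "X x (?u n) (s + t) = X (X x (?u n) t) (\<lambda>r. ?u n (r + t)) s"
      using X_concat[OF pc_on_pc t s, of "?u n" x] by (simp add: add.commute)
    then show ?thesis
      using optimal_state_diff[OF near_optimal_tail(2)[OF near_optimal_seq t] s order_refl, of x n] by simp
  qed
  then have "(\<lambda>n. X x (?u n) (s + t) - optimal_state s (X x (?u n) t)) \<longlonglongrightarrow> 0"
    by (intro Lim_null_comparison[OF _ K] always_eventually allI)
  moreover have "(\<lambda>n. optimal_state s (X x (?u n) t)) \<longlonglongrightarrow> optimal_state s (optimal_state t x)"
    by (rule bounded_linear.tendsto[OF optimal_state_bounded_linear[OF s] optimal_state_limit[OF t]])
  ultimately have "(\<lambda>n. (X x (?u n) (s + t) - optimal_state s (X x (?u n) t)) + optimal_state s (X x (?u n) t))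
      \<longlonglongrightarrow> 0 + optimal_state s (optimal_state t x)"
    by (rule tendsto_add)
  then show "(\<lambda>n. X x (?u n) (s + t)) \<longlonglongrightarrow> optimal_state s (optimal_state t x)"
    by simp
qed

text \<open>The state at time \<open>t \<ge> 1\<close> is controlled by the states on \<open>[t - 1, t]\<close>, and the square integral
  of those is at most the optimal cost.\<close>

lemma near_optimal_state_bound:
  assumes u: "near_optimal x e u" and t: "1 \<le> t"
  shows "(norm (X x u t))\<^sup>2 \<le> 4 * (S_sup 1 * (1 + norm B))\<^sup>2 * (V x + e)"
proof -
  have p: "pc u" and Jt: "J t x u \<le> V x + e"
    using u t by (auto simp: near_optimal_def)
  have E: "V x + e \<ge> 0"
    using Jt J_nonneg[OF p, of t x] by linarith
  define L where "L = S_sup 1 * (1 + norm B)"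
  have S1: "S_sup 1 \<ge> 0"
    using S_sup(1)[of 1] by simp
  then have L: "L \<ge> 0"
    by (simp add: L_def)
  \<comment> \<open>The state at \<open>t\<close> is computed from the one at a time
    \<open>s\<close> in the preceding unit window. Integrating over \<open>s\<close> bounds each of
    the two terms by \<open>2 * L\<^sup>2\<close> times the cost, whence the factor
    \<open>4\<close>.\<close>
  have pointwise: "(norm (X x u t))\<^sup>2 \<le> 2 * L\<^sup>2 * (norm (X x u s))\<^sup>2 + 2 * L\<^sup>2 * (V x + e)" if s: "s \<in> {t - 1..t}" for s
  proof -
    have s': "0 \<le> s" "0 \<le> t - s" "t - s \<le> 1"
      using s t by auto
    have tail: "integral {0..t - s} (\<lambda>r. (norm (u (r + s)))\<^sup>2) \<le> V x + e"
      using J_add[OF p s'(1,2), of x] J_nonneg[OF p, of s x] Jt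
        control_energy_le[OF pc_shift[OF p s'(1)], of "t - s" "X x u s"] by simp
    have "X x u t = X (X x u s) (\<lambda>r. u (r + s)) (t - s)"
      using X_concat[OF pc_on_pc[OF p] s'(1,2), of x] by simp
    then have "norm (X x u t) \<le> S_sup 1 * norm (X x u s) + S_sup 1 * norm B * (sqrt (t - s) * sqrt (V x + e))"
      using norm_X_le[OF pc_shift[OF p s'(1)] s'(2,3) tail] by simp
    also have "\<dots> \<le> L * norm (X x u s) + L * sqrt (V x + e)"
    proof (rule add_mono)
      have "S_sup 1 \<le> L"
        using S1 by (simp add: L_def distrib_left)
      then show "S_sup 1 * norm (X x u s) \<le> L * norm (X x u s)"
        by (rule mult_right_mono) simp
      have "sqrt (t - s) * sqrt (V x + e) \<le> 1 * sqrt (V x + e)"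
        using s' E by (intro mult_right_mono) auto
      then show "S_sup 1 * norm B * (sqrt (t - s) * sqrt (V x + e)) \<le> L * sqrt (V x + e)"
        using S1 E s' by (intro mult_mono) (auto simp: L_def distrib_left)
    qed
    finally have "norm (X x u t) \<le> L * norm (X x u s) + L * sqrt (V x + e)" .
    then have "(norm (X x u t))\<^sup>2 \<le> (L * norm (X x u s) + L * sqrt (V x + e))\<^sup>2"
      by (rule power_mono) simp
    also have "\<dots> \<le> 2 * (L * norm (X x u s))\<^sup>2 + 2 * (L * sqrt (V x + e))\<^sup>2"
      using sum_squares_bound[of "L * norm (X x u s)" "L * sqrt (V x + e)"] by (simp add: power2_sum)
    finally show ?thesis
      using E by (simp add: power_mult_distrib)
  qed
  have "(norm (X x u t))\<^sup>2 = integral {t - 1..t} (\<lambda>_. (norm (X x u t))\<^sup>2)"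
    by simp
  also have "\<dots> \<le> integral {t - 1..t} (\<lambda>s. 2 * L\<^sup>2 * (norm (X x u s))\<^sup>2 + 2 * L\<^sup>2 * (V x + e))"
    using t by (intro integral_le pointwise integrable_add integrable_on_mult_right state_sq_integrable p integrable_const_ivl) auto
  also have "\<dots> = 2 * L\<^sup>2 * integral {t - 1..t} (\<lambda>s. (norm (X x u s))\<^sup>2) + 2 * L\<^sup>2 * (V x + e)"
    using t by (subst Henstock_Kurzweil_Integration.integral_add)
      (auto intro!: integrable_on_mult_right state_sq_integrable p)
  also have "\<dots> \<le> 2 * L\<^sup>2 * (V x + e) + 2 * L\<^sup>2 * (V x + e)"
  proof -
    have "integral {t - 1..t} (\<lambda>s. (norm (X x u s))\<^sup>2) \<le> integral {0..t} (\<lambda>s. (norm (X x u s))\<^sup>2)"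
      using t by (intro integral_subset_le state_sq_integrable p) auto
    also have "\<dots> \<le> J t x u"
      using integral_nonneg[OF control_sq_integrable[OF p order_refl], of t] by (simp add: J_eq[OF p])
    finally have "integral {t - 1..t} (\<lambda>s. (norm (X x u s))\<^sup>2) \<le> V x + e"
      using Jt by simp
    then show ?thesis
      by (intro add_right_mono mult_left_mono) auto
  qed
  finally show ?thesis
    by (simp add: L_def mult_ac)
qed

text \<open>For \<open>t \<ge> 1\<close> the bound on near-optimal states passes to the limit; on
  \<open>[0, 1]\<close>, where a full unit window of earlier states is missing, the local bound
  takes over.\<close>

lemma optimal_semigroup_bounded: "\<exists>M\<ge>1. \<forall>t\<ge>0. norm (optimal_semigroup t) \<le> M"
proof -
  obtain K where K: "K \<ge> 0" "\<And>x. V x \<le> K * (norm x)\<^sup>2"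
    using V_bound by blast
  obtain M1 where M1: "\<And>t x. 0 \<le> t \<Longrightarrow> t \<le> 1 \<Longrightarrow> norm (optimal_state t x) \<le> M1 * norm x"
    using optimal_state_local_bound[of 1] by blast
  define c where "c = 4 * (S_sup 1 * (1 + norm B))\<^sup>2"
  have c: "c \<ge> 0"
    by (simp add: c_def)
  have late: "norm (optimal_state t x) \<le> sqrt (c * K) * norm x" if t: "1 \<le> t" for t x
  proof -
    let ?u = "near_optimal_seq x"
    have "(\<lambda>n. (norm (X x (?u n) t))\<^sup>2) \<longlonglongrightarrow> (norm (optimal_state t x))\<^sup>2"
      using t by (intro tendsto_intros optimal_state_limit) auto
    moreover have "(\<lambda>n. c * (V x + 1 / real (Suc n))) \<longlonglongrightarrow> c * (V x + 0)"
      by (intro tendsto_intros LIMSEQ_Suc lim_1_over_n)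
    ultimately have "(norm (optimal_state t x))\<^sup>2 \<le> c * (V x + 0)"
      by (rule LIMSEQ_le) (use near_optimal_state_bound[OF near_optimal_seq t] in \<open>auto simp: c_def\<close>)
    also have "\<dots> \<le> c * (K * (norm x)\<^sup>2)"
      using K(2)[of x] c by (intro mult_left_mono) auto
    finally have "norm (optimal_state t x) \<le> sqrt (c * (K * (norm x)\<^sup>2))"
      by (rule real_le_rsqrt)
    then show ?thesis
      by (simp add: real_sqrt_mult mult.assoc)
  qed
  define M where "M = max 1 (max M1 (sqrt (c * K)))"
  have "norm (optimal_semigroup t) \<le> M" if t: "t \<ge> 0" for t
  proof (rule norm_blinfun_bound)
    fix x
    have "norm (optimal_state t x) \<le> max M1 (sqrt (c * K)) * norm x"
    proof (cases "t \<le> 1")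
      case True
      have "M1 * norm x \<le> max M1 (sqrt (c * K)) * norm x"
        by (intro mult_right_mono) auto
      with M1[OF t True, of x] show ?thesis
        by (rule order_trans)
    next
      case False
      then have "1 \<le> t"
        by simp
      moreover have "sqrt (c * K) * norm x \<le> max M1 (sqrt (c * K)) * norm x"
        by (intro mult_right_mono) auto
      ultimately show ?thesis
        using late[of t x] by linarith
    qed
    also have "\<dots> \<le> M * norm x"
      by (intro mult_right_mono) (auto simp: M_def)
    finally show "norm (optimal_semigroup t x) \<le> M * norm x"
      using t by (simp add: optimal_semigroup_apply)
  qed (simp add: M_def)
  then show ?thesis
    by (intro exI[of _ M]) (simp add: M_def)
qed

end

section \<open>The optimal feedback\<close>

lemma eventually_right_ball:
  fixes P :: "real \<Rightarrow> bool"
  assumes "\<forall>\<^sub>F h in at_right 0. P h" "P 0"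
  shows "\<forall>\<^sub>F h in at_right 0. \<forall>s\<in>{0..h}. P s"
proof -
  obtain b where b: "b > 0" "\<And>h. 0 < h \<Longrightarrow> h < b \<Longrightarrow> P h"
    using assms(1) unfolding eventually_at_right_field by auto
  have "\<forall>s\<in>{0..h}. P s" if "0 < h" "h < b" for h
  proof
    fix s assume "s \<in> {0..h}"
    then show "P s"
      using b(2)[of s] assms(2) that by (cases "s = 0") auto
  qed
  then show ?thesis
    unfolding eventually_at_right_field using b(1) by auto
qed

context steerable_control
begin

text \<open>The real bilinear form of the Riccati operator, with \<open>Q x x = V x\<close>.\<close>

definition Q :: "'x \<Rightarrow> 'x \<Rightarrow> real"
  where "Q x y = (V (x + y) - V (x - y)) / 4"

lemma Q_bilinear: "bounded_bilinear Q" and V_add: "V (x + y) = V x + 2 * Q x y + V y"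
proof -
  obtain K where K: "\<And>x. V x \<le> K * (norm x)\<^sup>2"
    using V_bound by blast
  have "bounded_bilinear (\<lambda>x y. (V (x + y) - V (x - y)) / 4)"
    by (rule jordan_von_neumann(1)[of V K]) (fact V_parallelogram V_nonneg K)+
  then show "bounded_bilinear Q"
    by (simp add: Q_def[abs_def])
  have "V (x + y) = V x + 2 * ((V (x + y) - V (x - y)) / 4) + V y"
    by (rule jordan_von_neumann(2)[of V K]) (fact V_parallelogram V_nonneg K)+
  then show "V (x + y) = V x + 2 * Q x y + V y"
    by (simp add: Q_def)
qed

sublocale Q: bounded_bilinear Q
  by (rule Q_bilinear)

text \<open>Invariance under unit scalars is what makes the feedback linear over complex scalars,
  although \<open>Q\<close> is only a real form.\<close>

lemma Q_scale: "Q (sX c x) (sX c y) = (norm c)\<^sup>2 * Q x y"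
proof -
  interpret hX: hilbert_space sX by (rule hilbert_X)
  have "V (sX c x + sX c y) = (norm c)\<^sup>2 * V (x + y)" "V (sX c x - sX c y) = (norm c)\<^sup>2 * V (x - y)"
    by (simp_all add: V_scale flip: hX.scale_right_distrib hX.scale_right_diff_distrib)
  then show ?thesis
    by (simp add: Q_def right_diff_distrib)
qed

lemma inner_scaleU: "sU c u \<bullet> sU c v = (norm c)\<^sup>2 * (u \<bullet> v)"
proof -
  interpret hU: hilbert_space sU by (rule hilbert_U)
  have polar: "a \<bullet> b = ((norm (a + b))\<^sup>2 - (norm (a - b))\<^sup>2) / 4" for a b :: 'u
    by (simp add: power2_norm_eq_inner inner_simps inner_commute)
  have "(norm (sU c u + sU c v))\<^sup>2 = (norm c)\<^sup>2 * (norm (u + v))\<^sup>2"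
    "(norm (sU c u - sU c v))\<^sup>2 = (norm c)\<^sup>2 * (norm (u - v))\<^sup>2"
    by (simp_all add: hU.norm_scale power_mult_distrib flip: hU.scale_right_distrib hU.scale_right_diff_distrib)
  then show ?thesis
    unfolding polar by (simp add: right_diff_distrib)
qed

text \<open>In operator notation this is minus the adjoint of \<open>B\<close> after the Riccati
  operator; the vector exists by Riesz, and its inner products determine it.\<close>

definition feedback_fun :: "'x \<Rightarrow> 'u"
  where "feedback_fun x = (SOME f. \<forall>v. f \<bullet> v = - Q x (B v))"

lemma inner_feedback_fun: "feedback_fun x \<bullet> v = - Q x (B v)"
proof -
  have "bounded_linear (\<lambda>v. - Q x (B v))"
    by (intro bounded_linear_minus bounded_linear_compose[OF Q.bounded_linear_right] blinfun.bounded_linear_right)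
  from riesz_closed_subspace[OF subspace_UNIV closed_UNIV this] have "\<exists>f. \<forall>v. f \<bullet> v = - Q x (B v)"
    by auto
  from someI_ex[OF this] show ?thesis
    by (simp add: feedback_fun_def)
qed

lemma feedback_fun_bounded_linear: "bounded_linear feedback_fun"
proof
  show "feedback_fun (x + y) = feedback_fun x + feedback_fun y" for x y
    by (rule iffD1[OF vector_eq_rdot]) (simp add: inner_feedback_fun inner_add_left Q.add_left)
  show "feedback_fun (r *\<^sub>R x) = r *\<^sub>R feedback_fun x" for r x
    by (rule iffD1[OF vector_eq_rdot]) (simp add: inner_feedback_fun Q.scaleR_left)
  obtain K where K: "K \<ge> 0" "\<And>x y. norm (Q x y) \<le> norm x * norm y * K"
    using Q.nonneg_bounded by blast
  have "norm (feedback_fun x) \<le> norm x * (norm B * K)" for x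
  proof -
    let ?f = "feedback_fun x"
    have "norm ?f * norm ?f = - Q x (B ?f)"
      unfolding inner_feedback_fun[symmetric] power2_norm_eq_inner[symmetric] power2_eq_square ..
    also have "\<dots> \<le> norm x * norm (B ?f) * K"
      using K(2)[of x "B ?f"] by simp
    also have "\<dots> \<le> norm x * (norm B * norm ?f) * K"
      using K(1) by (intro mult_right_mono mult_left_mono norm_blinfun) auto
    finally have "norm ?f * norm ?f \<le> norm ?f * (norm x * (norm B * K))"
      by (simp add: mult_ac)
    then show ?thesis
      using K(1) by (cases "?f = 0") auto
  qed
  then show "\<exists>K. \<forall>x. norm (feedback_fun x) \<le> norm x * K"
    by blast
qed

definition feedback :: "'x \<Rightarrow>\<^sub>L 'u"
  where "feedback = Blinfun feedback_fun"

lemma inner_feedback: "feedback x \<bullet> v = - Q x (B v)"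
  by (simp add: feedback_def bounded_linear_Blinfun_apply feedback_fun_bounded_linear inner_feedback_fun)

lemma bounded_op_feedback: "bounded_op sX sU feedback"
proof -
  interpret hX: hilbert_space sX by (rule hilbert_X)
  interpret hU: hilbert_space sU by (rule hilbert_U)
  have B_scale: "B (sU c y) = sX c (B y)" for c y
    using linear_B by (simp add: bounded_op_def Vector_Spaces.linear_iff)
  have "feedback (sX c x) = sU c (feedback x)" for c x
  proof (cases "c = 0")
    case True
    then show ?thesis
      by (simp add: blinfun.zero_right)
  next
    case False
    show ?thesis
    proof (rule iffD1[OF vector_eq_rdot], rule allI)
      fix v
      \<comment> \<open>Writing the test vector as a multiple by \<open>c\<close> puts
        \<open>c\<close> into both arguments, where it leaves each form as
        \<open>(norm c)\<^sup>2\<close>; so real inner products detect linearity over the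
        field.\<close>
      have v: "v = sU c (sU (inverse c) v)"
        using False by simp
      show "feedback (sX c x) \<bullet> v = sU c (feedback x) \<bullet> v"
        by (subst (1 2) v) (simp only: inner_feedback inner_scaleU B_scale Q_scale mult_minus_right)
    qed
  qed
  then show ?thesis
    unfolding bounded_op_def Vector_Spaces.linear_iff
    using hX.vector_space_axioms hU.vector_space_axioms by (auto simp: blinfun.add_right)
qed

text \<open>The input \<open>X 0 u h\<close> enters the optimal cost to first order through the feedback alone, uniformly in
  the control \<open>u\<close>; this is where strong continuity of the adjoint semigroup is needed.\<close>

lemma costate_estimate:
  assumes "\<eta> > 0"
  shows "\<forall>\<^sub>F h in at_right 0. \<forall>u. pc u \<longrightarrow>
    \<bar>Q (S h x) (X 0 u h) + integral {0..h} (\<lambda>s. feedback x \<bullet> u s)\<bar> \<le> \<eta> * integral {0..h} (\<lambda>s. norm (u s))"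
proof -
  obtain K where K: "K \<ge> 0" "\<And>x y. norm (Q x y) \<le> norm x * norm y * K"
    using Q.nonneg_bounded by blast
  \<comment> \<open>\<open>p\<close> is the costate at \<open>x\<close>: replacing
    \<open>S (h - s) (B v)\<close> by \<open>B v\<close> in \<open>Q x\<close> is an adjoint
    estimate at \<open>p\<close>, hence uniform in \<open>v\<close> relative to its norm.\<close>
  obtain p where p: "\<And>z. p \<bullet> z = Q x z"
    using riesz_closed_subspace[OF subspace_UNIV closed_UNIV Q.bounded_linear_right[of x]] by auto
  \<comment> \<open>\<open>c\<close> and \<open>e\<close> are chosen so that the two replacements,
    of \<open>S h x\<close> by \<open>x\<close> and of \<open>S (h - s) (B v)\<close> by
    \<open>B v\<close>, each cost half of \<open>\<eta> * norm v\<close>.\<close>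
  define c where "c = K * S_sup 1 * norm B + 1"
  have c: "c > 0"
    using K S_sup(1)[of 1] by (simp add: c_def add_nonneg_pos)
  define e where "e = \<eta> / (2 * (norm B + 1))"
  have Bpos: "norm B + 1 > 0"
    by (simp add: add_nonneg_pos)
  have e: "e > 0" "e * norm B \<le> \<eta> / 2"
    using assms Bpos by (auto simp: e_def field_simps)
  obtain d where d: "d > 0" "\<And>t z. 0 \<le> t \<Longrightarrow> t \<le> d \<Longrightarrow> \<bar>p \<bullet> S t z - p \<bullet> z\<bar> \<le> e * norm z"
    using adjoint_continuous[of p] e(1) unfolding adjoint_continuous_def by meson
  have "((\<lambda>h. norm (S h x - x)) \<longlongrightarrow> norm (x - x)) (at_right 0)"
    by (intro tendsto_intros S_right)
  then have "\<forall>\<^sub>F h in at_right 0. norm (S h x - x) < \<eta> / (2 * c)"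
    using assms c by (intro order_tendstoD(2)) auto
  moreover have "\<forall>\<^sub>F h in at_right (0::real). h < min d 1"
    using d(1) by (intro order_tendstoD(2)[OF tendsto_ident_at]) auto
  ultimately show ?thesis
    using eventually_at_right_less[of "0::real"]
  proof eventually_elim
    case (elim h)
    have h: "0 \<le> h" "h \<le> d" "h \<le> 1"
      using elim by auto
    have pointwise: "\<bar>Q (S h x) (S (h - s) (B v)) + feedback x \<bullet> v\<bar> \<le> \<eta> * norm v" if s: "s \<in> {0..h}" for s v
    proof -
      have "norm (S (h - s) (B v)) \<le> S_sup 1 * norm B * norm v"
        by (rule norm_integrand_le[OF s h(3)])
      then have "norm (S h x - x) * norm (S (h - s) (B v)) * K \<le> \<eta> / (2 * c) * (S_sup 1 * norm B * norm v) * K"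
        using elim K(1) assms c by (intro mult_right_mono mult_mono) auto
      also have "\<dots> = \<eta> / (2 * c) * (c - 1) * norm v"
        by (simp add: c_def)
      also have "\<dots> \<le> \<eta> / (2 * c) * c * norm v"
        using assms c by (intro mult_right_mono mult_left_mono) auto
      also have "\<dots> = \<eta> / 2 * norm v"
        using c by simp
      finally have 1: "\<bar>Q (S h x - x) (S (h - s) (B v))\<bar> \<le> \<eta> / 2 * norm v"
        using K(2)[of "S h x - x" "S (h - s) (B v)"] by simp
      have "\<bar>Q x (S (h - s) (B v)) - Q x (B v)\<bar> \<le> e * norm (B v)"
        using d(2)[of "h - s" "B v"] s h by (simp add: p)
      also have "\<dots> \<le> e * (norm B * norm v)"
        using e(1) by (intro mult_left_mono norm_blinfun) auto
      also have "\<dots> \<le> \<eta> / 2 * norm v"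
        using mult_right_mono[OF e(2), of "norm v"] by (simp add: mult.assoc)
      finally have 2: "\<bar>Q x (S (h - s) (B v)) - Q x (B v)\<bar> \<le> \<eta> / 2 * norm v" .
      have "Q (S h x) (S (h - s) (B v)) + feedback x \<bullet> v
          = Q (S h x - x) (S (h - s) (B v)) + (Q x (S (h - s) (B v)) - Q x (B v))"
        by (simp add: inner_feedback Q.diff_left)
      then show ?thesis
        using 1 2 by linarith
    qed
    show ?case
    proof (intro allI impI)
      fix u assume u: "pc u"
      have i: "(\<lambda>s. S (h - s) (B (u s))) integrable_on {0..h}"
        by (rule integrable_integrand[OF pc_on_pc[OF u]])
      have iQ: "(\<lambda>s. Q (S h x) (S (h - s) (B (u s)))) integrable_on {0..h}"
        using integrable_linear[OF i Q.bounded_linear_right[of "S h x"]] by (simp add: o_def)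
      have iF: "(\<lambda>s. feedback x \<bullet> u s) integrable_on {0..h}"
        by (intro pc_on_integrable pc_on_bounded_linear[OF pc_on_pc[OF u]] bounded_linear_inner_right)
      have "Q (S h x) (X 0 u h) = integral {0..h} (\<lambda>s. Q (S h x) (S (h - s) (B (u s))))"
        using integral_linear[OF i Q.bounded_linear_right[of "S h x"]]
        by (simp add: o_def mild_solution_def blinfun.zero_right)
      then have "Q (S h x) (X 0 u h) + integral {0..h} (\<lambda>s. feedback x \<bullet> u s)
          = integral {0..h} (\<lambda>s. Q (S h x) (S (h - s) (B (u s))) + feedback x \<bullet> u s)"
        using Henstock_Kurzweil_Integration.integral_add[OF iQ iF] by simp
      also have "norm \<dots> \<le> integral {0..h} (\<lambda>s. \<eta> * norm (u s))"
      proof (rule integral_norm_bound_integral)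
        show "(\<lambda>s. \<eta> * norm (u s)) integrable_on {0..h}"
          by (intro integrable_on_mult_right pc_on_integrable pc_on_norm pc_on_pc u)
      qed (use pointwise in \<open>auto intro: integrable_add iQ iF\<close>)
      finally show "\<bar>Q (S h x) (X 0 u h) + integral {0..h} (\<lambda>s. feedback x \<bullet> u s)\<bar> \<le> \<eta> * integral {0..h} (\<lambda>s. norm (u s))"
        by simp
    qed
  qed
qed

text \<open>An energy bound controls the state on a short interval even where the control is large,
  so the state part of the running cost is \<open>h * (norm x)\<^sup>2\<close> up to
  \<open>h * \<eta>\<close>, uniformly in the control.\<close>

lemma short_time_state:
  assumes "\<eta> > 0" "W \<ge> 0"
  shows "\<forall>\<^sub>F h in at_right 0. \<forall>u s. pc u \<longrightarrow> s \<in> {0..h} \<longrightarrow> integral {0..h} (\<lambda>s. (norm (u s))\<^sup>2) \<le> W \<longrightarrow>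
    \<bar>(norm (X x u s))\<^sup>2 - (norm x)\<^sup>2\<bar> \<le> \<eta>"
proof -
  define c where "c = 2 * norm x + 1"
  have c: "c > 0"
    by (simp add: c_def add_nonneg_pos)
  define \<delta> where "\<delta> = min 1 (\<eta> / c)"
  have \<delta>: "\<delta> > 0" "\<delta> \<le> 1" "\<delta> * c \<le> \<eta>"
    using assms c by (auto simp: \<delta>_def min_def field_simps)
  have "((\<lambda>h. norm (S h x - x)) \<longlongrightarrow> norm (x - x)) (at_right 0)"
    by (intro tendsto_intros S_right)
  then have "\<forall>\<^sub>F h in at_right 0. norm (S h x - x) < \<delta> / 2"
    using \<delta> by (intro order_tendstoD(2)) auto
  from eventually_right_ball[OF this]
  have "\<forall>\<^sub>F h in at_right 0. \<forall>s\<in>{0..h}. norm (S s x - x) < \<delta> / 2"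
    using \<delta> by (simp add: S_0)
  moreover have "((\<lambda>h. S_sup 1 * norm B * (sqrt h * sqrt W)) \<longlongrightarrow> S_sup 1 * norm B * (sqrt 0 * sqrt W)) (at_right 0)"
    by (intro tendsto_intros)
  then have "\<forall>\<^sub>F h in at_right 0. S_sup 1 * norm B * (sqrt h * sqrt W) < \<delta> / 2"
    using \<delta> by (intro order_tendstoD(2)) auto
  moreover have "\<forall>\<^sub>F h in at_right (0::real). h < 1"
    by (intro order_tendstoD(2)[OF tendsto_ident_at]) auto
  ultimately show ?thesis
  proof eventually_elim
    case (elim h)
    show ?case
    proof (intro allI impI)
      fix u s
      assume u: "pc u" and s: "s \<in> {0..h}" and W: "integral {0..h} (\<lambda>s. (norm (u s))\<^sup>2) \<le> W"
      have "integral {0..s} (\<lambda>s. (norm (u s))\<^sup>2) \<le> integral {0..h} (\<lambda>s. (norm (u s))\<^sup>2)"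
        using s by (intro integral_subset_le control_sq_integrable u) auto
      then have "norm (integral {0..s} (\<lambda>r. S (s - r) (B (u r)))) \<le> S_sup 1 * norm B * (sqrt s * sqrt W)"
        using s elim(3) W by (intro norm_input_le_sqrt pc_on_pc u) auto
      also have "\<dots> \<le> S_sup 1 * norm B * (sqrt h * sqrt W)"
        using s S_sup(1)[of 1] assms(2) by (intro mult_left_mono mult_right_mono) auto
      finally have "norm (integral {0..s} (\<lambda>r. S (s - r) (B (u r)))) < \<delta> / 2"
        using elim(2) by simp
      moreover have eq: "X x u s - x = (S s x - x) + integral {0..s} (\<lambda>r. S (s - r) (B (u r)))"
        by (simp add: mild_solution_def)
      moreover have "norm (S s x - x) < \<delta> / 2"
        using elim(1) s by blast
      ultimately have close: "norm (X x u s - x) \<le> \<delta>"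
        using norm_triangle_ineq[of "S s x - x" "integral {0..s} (\<lambda>r. S (s - r) (B (u r)))"]
        unfolding eq by linarith
      have "\<bar>(norm (X x u s))\<^sup>2 - (norm x)\<^sup>2\<bar> = \<bar>norm (X x u s) - norm x\<bar> * (norm (X x u s) + norm x)"
        by (simp add: power2_eq_square abs_mult square_diff_square_factored)
      also have "\<dots> \<le> \<delta> * c"
      proof (rule mult_mono)
        show "\<bar>norm (X x u s) - norm x\<bar> \<le> \<delta>"
          using norm_triangle_ineq3[of "X x u s" x] close by simp
        then show "norm (X x u s) + norm x \<le> c"
          using \<delta>(2) by (simp add: c_def)
      qed (use \<delta> in auto)
      finally show "\<bar>(norm (X x u s))\<^sup>2 - (norm x)\<^sup>2\<bar> \<le> \<eta>"
        using \<delta>(3) by simp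
    qed
  qed
qed

text \<open>Comparing a control \<open>u\<close> that is optimal up to \<open>h\<^sup>3\<close> with the constant control \<open>feedback x\<close>, and
  completing the square, shows that both have the same average on \<open>[0, h]\<close> to leading order.\<close>

lemma near_optimal_close_to_feedback:
  fixes x :: 'x
  assumes \<eta>: "0 < \<eta>" "\<eta> \<le> 1"
  defines "f \<equiv> feedback x"
  shows "\<forall>\<^sub>F h in at_right 0. \<forall>u. near_optimal x (h ^ 3) u \<longrightarrow>
    integral {0..h} (\<lambda>s. norm (u s - f)) \<le> h * (\<eta> + sqrt (\<eta> * (4 + 4 * norm f)))"
proof -
  obtain K where K: "K \<ge> 0" "\<And>x. V x \<le> K * (norm x)\<^sup>2"
    using V_bound by blast
  define c where "c = K * (S_sup 1 * norm B * norm f)\<^sup>2"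
  \<comment> \<open>An energy bound for both competitors when \<open>h < 1\<close>: the gap
    \<open>h ^ 3\<close> is below \<open>1\<close>, and the constant control has energy
    \<open>h * (norm f)\<^sup>2\<close>.\<close>
  define W where "W = max (V x + 1) ((norm f)\<^sup>2)"
  have W: "W \<ge> 0"
    by (simp add: W_def le_max_iff_disj)
  have "((\<lambda>h. c * h + h\<^sup>2) \<longlongrightarrow> c * 0 + 0\<^sup>2) (at_right 0)"
    by (intro tendsto_intros)
  then have ev: "\<forall>\<^sub>F h in at_right 0. c * h + h\<^sup>2 < \<eta>"
    using \<eta> by (intro order_tendstoD(2)) auto
  have "\<forall>\<^sub>F h in at_right (0::real). h < 1"
    by (intro order_tendstoD(2)[OF tendsto_ident_at]) auto
  with eventually_at_right_less[of "0::real"] ev costate_estimate[OF \<eta>(1), of x] short_time_state[OF \<eta>(1) W, of x]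
  show ?thesis
  proof eventually_elim
    case (elim h)
    have h: "0 < h" "h < 1" and hc: "c * h + h\<^sup>2 < \<eta>"
      using elim by auto
    have costate: "\<bar>Q (S h x) (X 0 u h) + integral {0..h} (\<lambda>s. f \<bullet> u s)\<bar> \<le> \<eta> * integral {0..h} (\<lambda>s. norm (u s))"
      if "pc u" for u
      using elim(3) that unfolding f_def by blast
    have state: "\<bar>(norm (X x u s))\<^sup>2 - (norm x)\<^sup>2\<bar> \<le> \<eta>"
      if "pc u" "s \<in> {0..h}" "integral {0..h} (\<lambda>s. (norm (u s))\<^sup>2) \<le> W" for u s
      using elim(4) that by blast
    have X_split: "X x u h = S h x + X 0 u h" for u
      by (simp add: mild_solution_def)
    have V_end: "V (X x u h) = V (S h x) + 2 * Q (S h x) (X 0 u h) + V (X 0 u h)" for u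
      unfolding X_split by (rule V_add)
    let ?v = "\<lambda>_::real. f"
    have pv: "pc ?v"
      by (intro pc_continuous continuous_intros)
    have vint: "integral {0..h} (\<lambda>s. (norm (?v s))\<^sup>2) = h * (norm f)\<^sup>2" "integral {0..h} (\<lambda>s. norm (?v s)) = h * norm f"
      "integral {0..h} (\<lambda>s. f \<bullet> ?v s) = h * (norm f)\<^sup>2"
      using h by (simp_all add: power2_norm_eq_inner)
    have vW: "integral {0..h} (\<lambda>s. (norm (?v s))\<^sup>2) \<le> W"
      unfolding vint W_def using h mult_left_le_one_le[of "(norm f)\<^sup>2" h] by (simp add: le_max_iff_disj)
    \<comment> \<open>The control energy \<open>h * (norm f)\<^sup>2\<close> and the cross term,
      nearly \<open>- 2 * h * (norm f)\<^sup>2\<close>, combine to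
      \<open>- h * (norm f)\<^sup>2\<close>; \<open>c * h\<^sup>2\<close> bounds the second-order
      term of the value.\<close>
    have upper: "V x \<le> h * ((norm x)\<^sup>2 + \<eta>) - h * (norm f)\<^sup>2 + 2 * \<eta> * (h * norm f) + V (S h x) + c * h\<^sup>2"
    proof -
      have "integral {0..h} (\<lambda>s. (norm (X x ?v s))\<^sup>2) \<le> integral {0..h} (\<lambda>s. (norm x)\<^sup>2 + \<eta>)"
        using state[OF pv _ vW]
        by (intro integral_le state_sq_integrable pv integrable_const_ivl) (auto simp: abs_le_iff algebra_simps)
      also have "\<dots> = h * ((norm x)\<^sup>2 + \<eta>)"
        using h by simp
      finally have 1: "integral {0..h} (\<lambda>s. (norm (X x ?v s))\<^sup>2) \<le> h * ((norm x)\<^sup>2 + \<eta>)" .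
      have 2: "Q (S h x) (X 0 ?v h) \<le> \<eta> * (h * norm f) - h * (norm f)\<^sup>2"
        using costate[OF pv] unfolding vint by linarith
      have "norm (X 0 ?v h) \<le> S_sup 1 * norm B * (h * norm f)"
        using norm_input_le[OF pc_on_pc[OF pv], of h 1] h by (simp add: mild_solution_def blinfun.zero_right)
      then have "(norm (X 0 ?v h))\<^sup>2 \<le> (S_sup 1 * norm B * (h * norm f))\<^sup>2"
        by (rule power_mono) simp
      then have "K * (norm (X 0 ?v h))\<^sup>2 \<le> K * (S_sup 1 * norm B * (h * norm f))\<^sup>2"
        using K(1) by (rule mult_left_mono)
      also have "\<dots> = c * h\<^sup>2"
        by (simp add: c_def power_mult_distrib)
      finally have 3: "V (X 0 ?v h) \<le> c * h\<^sup>2"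
        using K(2)[of "X 0 ?v h"] by linarith
      have "V x \<le> J h x ?v + V (X x ?v h)"
        using h by (intro V_le_step pv) auto
      then show ?thesis
        unfolding J_eq[OF pv] V_end vint using 1 2 3 by linarith
    qed
    show ?case
    proof (intro allI impI)
      fix u assume u: "near_optimal x (h ^ 3) u"
      then have p: "pc u"
        by (simp add: near_optimal_def)
      have h3: "h ^ 3 \<le> 1"
        using h by (intro power_le_one) auto
      have "J h x u \<le> V x + h ^ 3"
        using u h by (simp add: near_optimal_def)
      then have uW: "integral {0..h} (\<lambda>s. (norm (u s))\<^sup>2) \<le> W"
        using control_energy_le[OF p, of h x] h3 by (simp add: W_def le_max_iff_disj)
      have iu: "(\<lambda>s. norm (u s)) integrable_on {0..h}" "(\<lambda>s. (norm (u s))\<^sup>2) integrable_on {0..h}"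
        "(\<lambda>s. f \<bullet> u s) integrable_on {0..h}"
        by (intro pc_on_integrable pc_on_norm pc_on_norm_sq pc_on_pc p pc_on_bounded_linear[OF _ bounded_linear_inner_right])+
      have id: "(\<lambda>s. norm (u s - f)) integrable_on {0..h}" "(\<lambda>s. (norm (u s - f))\<^sup>2) integrable_on {0..h}"
        by (intro pc_on_integrable pc_on_norm pc_on_norm_sq pc_on_diff pc_on_pc[OF p] pc_on_pc[OF pv])+
      define I where "I = integral {0..h} (\<lambda>s. norm (u s - f))"
      define E where "E = integral {0..h} (\<lambda>s. (norm (u s - f))\<^sup>2)"
      define N where "N = integral {0..h} (\<lambda>s. norm (u s))"
      have I: "I \<ge> 0"
        unfolding I_def by (intro integral_nonneg id) auto
      have N: "N \<le> I + h * norm f"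
      proof -
        have "N \<le> integral {0..h} (\<lambda>s. norm (u s - f) + norm f)"
          unfolding N_def using norm_triangle_ineq[of "u _ - f" f]
          by (intro integral_le iu integrable_add id integrable_const_ivl) simp
        also have "\<dots> = I + h * norm f"
          unfolding I_def using h by (subst Henstock_Kurzweil_Integration.integral_add[OF id(1)]) auto
        finally show ?thesis .
      qed
      have E_eq: "E = integral {0..h} (\<lambda>s. (norm (u s))\<^sup>2) - 2 * integral {0..h} (\<lambda>s. f \<bullet> u s) + h * (norm f)\<^sup>2"
      proof -
        have "E = integral {0..h} (\<lambda>s. ((norm (u s))\<^sup>2 - 2 * (f \<bullet> u s)) + (norm f)\<^sup>2)"
          unfolding E_def by (rule integral_cong) (simp add: power2_norm_eq_inner inner_simps inner_commute)
        also have "\<dots> = integral {0..h} (\<lambda>s. (norm (u s))\<^sup>2 - 2 * (f \<bullet> u s)) + h * (norm f)\<^sup>2"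
          using h by (subst Henstock_Kurzweil_Integration.integral_add)
            (auto intro!: integrable_diff integrable_on_mult_right iu)
        also have "integral {0..h} (\<lambda>s. (norm (u s))\<^sup>2 - 2 * (f \<bullet> u s))
            = integral {0..h} (\<lambda>s. (norm (u s))\<^sup>2) - 2 * integral {0..h} (\<lambda>s. f \<bullet> u s)"
          by (subst Henstock_Kurzweil_Integration.integral_diff)
            (auto intro!: integrable_on_mult_right iu)
        finally show ?thesis .
      qed
      have "integral {0..h} (\<lambda>s. (norm x)\<^sup>2 - \<eta>) \<le> integral {0..h} (\<lambda>s. (norm (X x u s))\<^sup>2)"
        using state[OF p _ uW]
        by (intro integral_le state_sq_integrable p integrable_const_ivl) (auto simp: abs_le_iff algebra_simps)
      then have 1: "h * ((norm x)\<^sup>2 - \<eta>) \<le> integral {0..h} (\<lambda>s. (norm (X x u s))\<^sup>2)"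
        using h by simp
      have 2: "Q (S h x) (X 0 u h) \<ge> - integral {0..h} (\<lambda>s. f \<bullet> u s) - \<eta> * N"
        using costate[OF p] unfolding N_def by linarith
      have "J h x u + V (X x u h) \<le> V x + h ^ 3"
        using near_optimal_tail(1)[OF u, of h] h by simp
      \<comment> \<open>Energy and cross term are completed to
        \<open>E - h * (norm f)\<^sup>2\<close>, and the second-order term of the value is bounded
        below by \<open>0\<close>. Against the upper bound everything but \<open>E\<close> and the
        errors cancels.\<close>
      then have "h * ((norm x)\<^sup>2 - \<eta>) + E - h * (norm f)\<^sup>2 + V (S h x) - 2 * (\<eta> * N) \<le> V x + h ^ 3"
        unfolding J_eq[OF p] V_end E_eq using 1 2 V_nonneg[of "X 0 u h"] by linarith
      with upper have "E \<le> 2 * (\<eta> * N) + 2 * \<eta> * (h * norm f) + 2 * (h * \<eta>) + c * h\<^sup>2 + h ^ 3"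
        unfolding distrib_left right_diff_distrib by linarith
      also have "\<eta> * N \<le> \<eta> * (I + h * norm f)"
        using N \<eta> by (intro mult_left_mono) auto
      finally have "E \<le> 2 * \<eta> * I + h * (\<eta> * (2 + 4 * norm f)) + h * (c * h + h\<^sup>2)"
        by (simp add: algebra_simps power2_eq_square power3_eq_cube)
      also have "h * (c * h + h\<^sup>2) \<le> h * \<eta>"
        using h hc by (intro mult_left_mono) auto
      finally have "E \<le> 2 * \<eta> * I + h * (\<eta> * (3 + 4 * norm f))"
        by (simp add: algebra_simps)
      then have "h * E \<le> h * (2 * \<eta> * I + h * (\<eta> * (3 + 4 * norm f)))"
        using h by (intro mult_left_mono) auto
      moreover have "I\<^sup>2 \<le> h * E"
        unfolding I_def E_def using h by (intro integral_sq_le id) auto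
      \<comment> \<open>The term linear in \<open>I\<close> is absorbed by completing a second
        square; \<open>\<eta> \<le> 1\<close> then turns \<open>\<eta>\<^sup>2\<close> into
        \<open>\<eta>\<close> and the constant \<open>3\<close> into \<open>4\<close>.\<close>
      ultimately have "(I - h * \<eta>)\<^sup>2 \<le> h\<^sup>2 * (\<eta> * (3 + 4 * norm f)) + h\<^sup>2 * \<eta>\<^sup>2"
        by (simp add: power2_eq_square algebra_simps)
      also have "\<dots> \<le> h\<^sup>2 * (\<eta> * (3 + 4 * norm f)) + h\<^sup>2 * \<eta>"
        using \<eta> by (intro add_left_mono mult_left_mono) (auto simp: power2_eq_square mult_left_le)
      also have "\<dots> = h\<^sup>2 * (\<eta> * (4 + 4 * norm f))"
        by (simp add: algebra_simps)
      finally have "I - h * \<eta> \<le> sqrt (h\<^sup>2 * (\<eta> * (4 + 4 * norm f)))"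
        by (rule real_le_rsqrt)
      moreover have "sqrt (h\<^sup>2 * (\<eta> * (4 + 4 * norm f))) = h * sqrt (\<eta> * (4 + 4 * norm f))"
        using h by (subst real_sqrt_mult) simp
      ultimately show "integral {0..h} (\<lambda>s. norm (u s - f)) \<le> h * (\<eta> + sqrt (\<eta> * (4 + 4 * norm f)))"
        unfolding I_def by (simp add: distrib_left)
    qed
  qed
qed

text \<open>Three errors are each small compared with \<open>h\<close>: from the optimal to a
  near-optimal state, from there to the state under the constant control \<open>feedback x\<close>,
  and from that state to its first-order expansion, by strong continuity of
  \<open>S\<close>.\<close>

lemma optimal_state_derivative:
  "((\<lambda>h. (1 / h) *\<^sub>R (optimal_state h x - S h x)) \<longlongrightarrow> B (feedback x)) (at_right 0)"
proof (rule tendstoI)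
  fix \<epsilon> :: real assume "\<epsilon> > 0"
  define f where "f = feedback x"
  define c where "c = S_sup 1 * norm B"
  have c: "c \<ge> 0"
    using S_sup(1)[of 1] by (simp add: c_def)
  \<comment> \<open>\<open>\<eta>\<close> is fixed before \<open>h\<close>: the three summands bound
    the three errors divided by \<open>h\<close>.\<close>
  have "((\<lambda>\<eta>. c * sqrt 2 * \<eta> + c * (\<eta> + sqrt (\<eta> * (4 + 4 * norm f))) + \<eta>)
      \<longlongrightarrow> c * sqrt 2 * 0 + c * (0 + sqrt (0 * (4 + 4 * norm f))) + 0) (at_right 0)"
    by (intro tendsto_intros)
  then have "\<forall>\<^sub>F \<eta> in at_right 0. c * sqrt 2 * \<eta> + c * (\<eta> + sqrt (\<eta> * (4 + 4 * norm f))) + \<eta> < \<epsilon>"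
    using \<open>\<epsilon> > 0\<close> by (intro order_tendstoD(2)) auto
  moreover have "\<forall>\<^sub>F \<eta> in at_right (0::real). \<eta> < 1"
    by (intro order_tendstoD(2)[OF tendsto_ident_at]) auto
  ultimately have "\<forall>\<^sub>F \<eta> in at_right (0::real). 0 < \<eta> \<and> \<eta> < 1 \<and>
      c * sqrt 2 * \<eta> + c * (\<eta> + sqrt (\<eta> * (4 + 4 * norm f))) + \<eta> < \<epsilon>"
    using eventually_at_right_less[of "0::real"] by eventually_elim simp
  then obtain \<eta> where \<eta>: "0 < \<eta>" "\<eta> < 1"
      "c * sqrt 2 * \<eta> + c * (\<eta> + sqrt (\<eta> * (4 + 4 * norm f))) + \<eta> < \<epsilon>"
    using eventually_happens'[OF trivial_limit_at_right_real] by blast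
  have "((\<lambda>h. norm (S h (B f) - B f)) \<longlongrightarrow> norm (B f - B f)) (at_right 0)"
    by (intro tendsto_intros S_right)
  then have "\<forall>\<^sub>F h in at_right 0. norm (S h (B f) - B f) < \<eta>"
    using \<eta> by (intro order_tendstoD(2)) auto
  from eventually_right_ball[OF this]
  have "\<forall>\<^sub>F h in at_right 0. \<forall>s\<in>{0..h}. norm (S s (B f) - B f) < \<eta>"
    using \<eta> by (simp add: S_0)
  moreover have "\<forall>\<^sub>F h in at_right (0::real). h < \<eta>"
    using \<eta> by (intro order_tendstoD(2)[OF tendsto_ident_at]) auto
  moreover have "\<forall>\<^sub>F h in at_right 0. \<forall>u. near_optimal x (h ^ 3) u \<longrightarrow>
    integral {0..h} (\<lambda>s. norm (u s - f)) \<le> h * (\<eta> + sqrt (\<eta> * (4 + 4 * norm f)))"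
    unfolding f_def by (rule near_optimal_close_to_feedback) (use \<eta> in auto)
  ultimately show "\<forall>\<^sub>F h in at_right 0. dist ((1 / h) *\<^sub>R (optimal_state h x - S h x)) (B (feedback x)) < \<epsilon>"
    using eventually_at_right_less[of "0::real"]
  proof eventually_elim
    case (elim h)
    have h: "0 < h" "h < \<eta>" "h \<le> 1"
      using elim \<eta> by auto
    obtain u where u: "near_optimal x (h ^ 3) u"
      using near_optimal_exists[of "h ^ 3" x] h by auto
    then have p: "pc u"
      by (simp add: near_optimal_def)
    have pv: "pc (\<lambda>_. f)"
      by (intro pc_continuous continuous_intros)
    have "sqrt h * sqrt (2 * h ^ 3) = sqrt (2 * (h\<^sup>2)\<^sup>2)"
      unfolding real_sqrt_mult[symmetric] by (simp add: power2_eq_square power3_eq_cube mult_ac)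
    also have "\<dots> = sqrt 2 * h\<^sup>2"
      by (simp only: real_sqrt_mult real_sqrt_abs abs_power2)
    finally have sq: "sqrt h * sqrt (2 * h ^ 3) = sqrt 2 * h\<^sup>2" .
    have "norm (X x u h - optimal_state h x) \<le> c * (sqrt 2 * h\<^sup>2)"
      using optimal_state_diff[OF u, of h 1] h unfolding sq c_def by simp
    also have "\<dots> = h * (c * sqrt 2 * h)"
      by (simp add: power2_eq_square)
    also have "\<dots> \<le> h * (c * sqrt 2 * \<eta>)"
      using h c by (intro mult_left_mono) auto
    finally have 1: "norm (optimal_state h x - X x u h) \<le> h * (c * sqrt 2 * \<eta>)"
      by (simp add: norm_minus_commute)
    have X_diff': "X x u h - X x (\<lambda>_. f) h = integral {0..h} (\<lambda>s. S (h - s) (B (u s - f)))"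
      using X_diff[OF pc_on_pc[OF p] pc_on_pc[OF pv], of x x] by (simp add: mild_solution_def blinfun.zero_right)
    have "norm (X x u h - X x (\<lambda>_. f) h) \<le> c * integral {0..h} (\<lambda>s. norm (u s - f))"
      unfolding X_diff' c_def using h
      by (intro norm_input_le pc_on_diff pc_on_pc[OF p] pc_on_pc[OF pv]) auto
    also have "\<dots> \<le> c * (h * (\<eta> + sqrt (\<eta> * (4 + 4 * norm f))))"
      using elim(3) u c by (intro mult_left_mono) auto
    finally have 2: "norm (X x u h - X x (\<lambda>_. f) h) \<le> h * (c * (\<eta> + sqrt (\<eta> * (4 + 4 * norm f))))"
      by (simp add: mult_ac)
    have i: "(\<lambda>s. S (h - s) (B f)) integrable_on {0..h}"
      by (rule integrable_integrand[OF pc_on_pc[OF pv]])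
    have "X x (\<lambda>_. f) h - S h x - h *\<^sub>R B f = integral {0..h} (\<lambda>s. S (h - s) (B f) - B f)"
      using h by (subst Henstock_Kurzweil_Integration.integral_diff[OF i]) (auto simp: mild_solution_def)
    also have "norm \<dots> \<le> integral {0..h} (\<lambda>_. \<eta>)"
    proof (rule integral_norm_bound_integral)
      show "norm (S (h - s) (B f) - B f) \<le> \<eta>" if "s \<in> {0..h}" for s
        using elim(1) that by (auto intro!: less_imp_le)
    qed (auto intro!: integrable_diff i)
    finally have 3: "norm (X x (\<lambda>_. f) h - S h x - h *\<^sub>R B f) \<le> h * \<eta>"
      using h by simp
    have "optimal_state h x - S h x - h *\<^sub>R B f
        = (optimal_state h x - X x u h) + (X x u h - X x (\<lambda>_. f) h) + (X x (\<lambda>_. f) h - S h x - h *\<^sub>R B f)"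
      by simp
    then have "norm (optimal_state h x - S h x - h *\<^sub>R B f)
        \<le> norm (optimal_state h x - X x u h) + norm (X x u h - X x (\<lambda>_. f) h) + norm (X x (\<lambda>_. f) h - S h x - h *\<^sub>R B f)"
      by (simp only:) (rule order_trans[OF norm_triangle_ineq add_right_mono[OF norm_triangle_ineq]])
    also have "\<dots> \<le> h * (c * sqrt 2 * \<eta>) + h * (c * (\<eta> + sqrt (\<eta> * (4 + 4 * norm f)))) + h * \<eta>"
      using 1 2 3 by (intro add_mono)
    also have "\<dots> = h * (c * sqrt 2 * \<eta> + c * (\<eta> + sqrt (\<eta> * (4 + 4 * norm f))) + \<eta>)"
      by (simp add: distrib_left)
    also have "\<dots> < h * \<epsilon>"
      using h \<eta>(3) by (intro mult_strict_left_mono)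
    finally have "norm (optimal_state h x - S h x - h *\<^sub>R B f) < h * \<epsilon>" .
    moreover have "(1 / h) *\<^sub>R (optimal_state h x - S h x) - B f = (1 / h) *\<^sub>R (optimal_state h x - S h x - h *\<^sub>R B f)"
      using h by (simp add: scaleR_diff_right)
    ultimately show ?case
      using h unfolding dist_norm f_def[symmetric] by (simp add: divide_less_eq mult.commute)
  qed
qed

lemma optimal_semigroup_C0: "C0_semigroup sX optimal_semigroup"
proof -
  interpret hX: hilbert_space sX by (rule hilbert_X)
  have "bounded_op sX sX (optimal_semigroup t)" if t: "0 \<le> t" for t
    unfolding bounded_op_def Vector_Spaces.linear_iff
    using hX.vector_space_axioms t
    by (simp add: optimal_semigroup_apply optimal_state_add optimal_state_scale)
  moreover have "optimal_semigroup 0 = id_blinfun"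
  proof (rule blinfun_eqI)
    fix x
    have "(\<lambda>n. X x (near_optimal_seq x n) 0) \<longlonglongrightarrow> optimal_state 0 x"
      by (rule optimal_state_limit) simp
    then have "optimal_state 0 x = x"
      by (simp add: X_0 LIMSEQ_const_iff)
    then show "optimal_semigroup 0 x = id_blinfun x"
      by (simp add: optimal_semigroup_apply)
  qed
  moreover have "optimal_semigroup (s + t) = optimal_semigroup s o\<^sub>L optimal_semigroup t" if "0 \<le> s" "0 \<le> t" for s t
    using that by (intro blinfun_eqI) (simp add: optimal_semigroup_apply optimal_state_semigroup)
  moreover have "((\<lambda>t. optimal_semigroup t x) \<longlongrightarrow> x) (at_right 0)" for x
  proof -
    \<comment> \<open>Strong continuity is inherited from \<open>S\<close>: the optimal state is
      \<open>S h x\<close> plus \<open>h\<close> times a convergent quotient.\<close>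
    have "((\<lambda>h. h *\<^sub>R ((1 / h) *\<^sub>R (optimal_state h x - S h x)) + S h x) \<longlongrightarrow> 0 *\<^sub>R B (feedback x) + x) (at_right 0)"
      by (intro tendsto_intros optimal_state_derivative S_right)
    then have "((\<lambda>h. h *\<^sub>R ((1 / h) *\<^sub>R (optimal_state h x - S h x)) + S h x) \<longlongrightarrow> x) (at_right 0)"
      by simp
    moreover have "\<forall>\<^sub>F h in at_right 0. h *\<^sub>R ((1 / h) *\<^sub>R (optimal_state h x - S h x)) + S h x = optimal_semigroup h x"
      using eventually_at_right_less[of "0::real"]
      by eventually_elim (simp add: optimal_semigroup_apply)
    ultimately show ?thesis
      by (rule Lim_transform_eventually)
  qed
  ultimately show ?thesis
    by (simp add: C0_semigroup_def)
qed

end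

text \<open>The difference quotients of \<open>S\<close> and \<open>S'\<close> differ by a term that
  converges at every \<open>x\<close>, so they converge for the same \<open>x\<close>; equality of
  the domains and the formula for the generator come together.\<close>

lemma generates_perturbed:
  assumes S: "generates sX D A S" and S': "C0_semigroup sX S'"
    and G: "\<And>x. ((\<lambda>h. (1 / h) *\<^sub>R (S' h x - S h x)) \<longlongrightarrow> G x) (at_right 0)"
  shows "generates sX D (\<lambda>x. A x + G x) S'"
proof -
  have forward: "((\<lambda>h. (1 / h) *\<^sub>R (S' h x - x)) \<longlongrightarrow> y + G x) (at_right 0)"
    if "((\<lambda>h. (1 / h) *\<^sub>R (S h x - x)) \<longlongrightarrow> y) (at_right 0)" for x y
    using tendsto_add[OF that G[of x]] by (simp add: scaleR_diff_right)
  have backward: "((\<lambda>h. (1 / h) *\<^sub>R (S h x - x)) \<longlongrightarrow> y - G x) (at_right 0)"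
    if "((\<lambda>h. (1 / h) *\<^sub>R (S' h x - x)) \<longlongrightarrow> y) (at_right 0)" for x y
    using tendsto_diff[OF that G[of x]] by (simp add: scaleR_diff_right)
  have "D = {x. \<exists>y. ((\<lambda>h. (1 / h) *\<^sub>R (S h x - x)) \<longlongrightarrow> y) (at_right 0)}"
    using S by (simp add: generates_def)
  also have "\<dots> = {x. \<exists>y. ((\<lambda>h. (1 / h) *\<^sub>R (S' h x - x)) \<longlongrightarrow> y) (at_right 0)}"
    using forward backward by blast
  finally show ?thesis
    using S S' forward unfolding generates_def by simp
qed

text \<open>The weight \<open>exp (\<omega> * T)\<close> at the final time is compensated by a
  higher accuracy for the unweighted system; the energy of the weighted control grows by at most the
  factor \<open>E\<close>.\<close>

lemma (in bounded_control) steerable_shift: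
  assumes null: "exactly_null_controllable S B"
  obtains T C where "steerable_control sX sU (\<lambda>t. exp (\<omega> * t) *\<^sub>R S t) B T C"
proof -
  obtain T C where T: "T > 0" and C: "C \<ge> 0" and approx: "\<forall>x. \<forall>e>0. \<exists>u. continuous_on UNIV u \<and>
      integral {0..T} (\<lambda>t. (norm (u t))\<^sup>2) \<le> C * (norm x)\<^sup>2 \<and> norm (X x u T) \<le> e"
    using approximately_null_controllable[OF null] by blast
  define R where "R t = exp (\<omega> * t) *\<^sub>R S t" for t
  define E where "E = (exp (\<bar>\<omega>\<bar> * T))\<^sup>2"
  have "\<exists>u. continuous_on UNIV u \<and> integral {0..T} (\<lambda>t. (norm (u t))\<^sup>2) \<le> E * C * (norm x)\<^sup>2 \<and>
      norm (mild_solution R B x u T) \<le> norm x / 2" for x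
  proof (cases "x = 0")
    \<comment> \<open>At \<open>x = 0\<close> the accuracy demanded below would be \<open>0\<close>,
      which approximate controllability does not offer; the zero control serves.\<close>
    case True
    then show ?thesis
      by (intro exI[of _ "\<lambda>_. 0"]) (simp add: mild_solution_def blinfun.zero_right)
  next
    case False
    then have "exp (- (\<omega> * T)) * (norm x / 2) > 0"
      by simp
    from approx[rule_format, OF this] obtain u where u: "continuous_on UNIV u"
      "integral {0..T} (\<lambda>t. (norm (u t))\<^sup>2) \<le> C * (norm x)\<^sup>2" "norm (X x u T) \<le> exp (- (\<omega> * T)) * (norm x / 2)"
      by blast
    let ?v = "\<lambda>s. exp (\<omega> * s) *\<^sub>R u s"
    have v: "continuous_on UNIV ?v"
      by (intro continuous_intros u(1))
    have cont: "continuous_on {0..T} (\<lambda>t. (norm (w t))\<^sup>2)" if "continuous_on UNIV w" for w :: "real \<Rightarrow> 'u"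
      by (intro continuous_intros continuous_on_subset[OF that]) auto
    have "integral {0..T} (\<lambda>t. (norm (?v t))\<^sup>2) \<le> integral {0..T} (\<lambda>t. E * (norm (u t))\<^sup>2)"
    proof (rule integral_le)
      fix t assume t: "t \<in> {0..T}"
      have "\<omega> * t \<le> \<bar>\<omega>\<bar> * T"
        using t by (intro order_trans[OF mult_right_mono[of \<omega> "\<bar>\<omega>\<bar>" t] mult_left_mono]) auto
      then have "(exp (\<omega> * t))\<^sup>2 \<le> E"
        unfolding E_def by (intro power_mono) auto
      then show "(norm (?v t))\<^sup>2 \<le> E * (norm (u t))\<^sup>2"
        by (simp add: power_mult_distrib mult_right_mono)
    qed (intro integrable_on_mult_right integrable_continuous_real cont u(1) v)+
    also have "\<dots> \<le> E * (C * (norm x)\<^sup>2)"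
      using u(2) by (simp add: E_def mult_left_mono)
    finally have 1: "integral {0..T} (\<lambda>t. (norm (?v t))\<^sup>2) \<le> E * C * (norm x)\<^sup>2"
      by (simp add: mult.assoc)
    have "norm (mild_solution R B x ?v T) = exp (\<omega> * T) * norm (X x u T)"
      unfolding R_def mild_solution_shift by simp
    also have "\<dots> \<le> exp (\<omega> * T) * (exp (- (\<omega> * T)) * (norm x / 2))"
      using u(3) by (intro mult_left_mono) auto
    also have "\<dots> = norm x / 2"
      by (simp add: exp_minus field_simps)
    finally have "norm (mild_solution R B x ?v T) \<le> norm x / 2" .
    with 1 v show ?thesis
      by blast
  qed
  moreover have "bounded_control sX sU R B"
    using bounded_control_shift[OF bounded_control_axioms, of \<omega>] by (simp add: R_def[abs_def])
  moreover have "E * C \<ge> 0"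
    using C by (simp add: E_def)
  ultimately have "steerable_control sX sU R B T (E * C)"
    using T by (simp add: steerable_control_def steerable_control_axioms_def)
  then show ?thesis
    using that unfolding R_def[abs_def] by simp
qed

theorem theorem2p4:
  fixes sX :: "'k::real_normed_field \<Rightarrow> 'x::{real_inner,banach} \<Rightarrow> 'x"
    and sU :: "'k \<Rightarrow> 'u::{real_inner,banach} \<Rightarrow> 'u"
    and D :: "'x set" and A :: "'x \<Rightarrow> 'x"
    and S :: "real \<Rightarrow> 'x \<Rightarrow>\<^sub>L 'x" and B :: "'u \<Rightarrow>\<^sub>L 'x"
  assumes "hilbert_space sX" and "hilbert_space sU"
    and "generates sX D A S"
    and "bounded_op sU sX B"
    and "exactly_null_controllable S B"
  shows "completely_stabilizable sX sU D A B"
proof -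
  have C0: "C0_semigroup sX S"
    using assms(3) by (simp add: generates_def)
  interpret bounded_control sX sU S B
    by (rule bounded_control.intro[OF assms(1,2) C0 assms(4)])
  show ?thesis
    unfolding completely_stabilizable_def
  proof (intro allI impI)
    fix \<omega> :: real
    obtain T C where "steerable_control sX sU (\<lambda>t. exp (\<omega> * t) *\<^sub>R S t) B T C"
      by (rule steerable_shift[OF assms(5)])
    then interpret W: steerable_control sX sU "\<lambda>t. exp (\<omega> * t) *\<^sub>R S t" B T C .
    define S\<^sub>F where "S\<^sub>F t = exp (- \<omega> * t) *\<^sub>R W.optimal_semigroup t" for t
    have "bounded_control sX sU W.optimal_semigroup B"
      by (rule bounded_control.intro[OF assms(1,2) W.optimal_semigroup_C0 assms(4)])
    then have "bounded_control sX sU S\<^sub>F B"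
      unfolding S\<^sub>F_def[abs_def] by (rule bounded_control_shift)
    then have C0_F: "C0_semigroup sX S\<^sub>F"
      by (rule bounded_control.semigroup)
    have "((\<lambda>h. (1 / h) *\<^sub>R (S\<^sub>F h x - S h x)) \<longlongrightarrow> B (W.feedback x)) (at_right 0)" for x
    proof -
      \<comment> \<open>Multiplying by \<open>exp (- \<omega> * h)\<close> undoes the weight: the
        subtracted term becomes \<open>S h x\<close> itself, so no multiple of the identity is left
        in the closed-loop generator.\<close>
      let ?q = "\<lambda>h. (1 / h) *\<^sub>R (W.optimal_state h x - (exp (\<omega> * h) *\<^sub>R S h) x)"
      have "((\<lambda>h. exp (- \<omega> * h) *\<^sub>R ?q h) \<longlongrightarrow> exp (- \<omega> * 0) *\<^sub>R B (W.feedback x)) (at_right 0)"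
        by (intro tendsto_intros W.optimal_state_derivative)
      then have "((\<lambda>h. exp (- \<omega> * h) *\<^sub>R ?q h) \<longlongrightarrow> B (W.feedback x)) (at_right 0)"
        by simp
      moreover have "\<forall>\<^sub>F h in at_right 0. exp (- \<omega> * h) *\<^sub>R ?q h = (1 / h) *\<^sub>R (S\<^sub>F h x - S h x)"
        using eventually_at_right_less[of "0::real"]
      proof eventually_elim
        case (elim h)
        have "exp (- \<omega> * h) *\<^sub>R ?q h
            = (1 / h) *\<^sub>R (exp (- \<omega> * h) *\<^sub>R W.optimal_state h x - (exp (- \<omega> * h) * exp (\<omega> * h)) *\<^sub>R S h x)"
          by (simp add: blinfun.scaleR_left scaleR_diff_right)
        also have "exp (- \<omega> * h) * exp (\<omega> * h) = 1"
          by (simp flip: exp_add)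
        finally show ?case
          using elim by (simp add: S\<^sub>F_def W.optimal_semigroup_apply blinfun.scaleR_left)
      qed
      ultimately show ?thesis
        by (rule Lim_transform_eventually)
    qed
    then have gen: "generates sX D (\<lambda>x. A x + B (W.feedback x)) S\<^sub>F"
      by (rule generates_perturbed[OF assms(3) C0_F])
    \<comment> \<open>Mere boundedness for the weighted system becomes the decay rate
      \<open>\<omega>\<close> once the weight is removed.\<close>
    obtain M where M: "M \<ge> 1" "\<And>t. t \<ge> 0 \<Longrightarrow> norm (W.optimal_semigroup t) \<le> M"
      using W.optimal_semigroup_bounded by blast
    have "norm (S\<^sub>F t) \<le> M * exp (- \<omega> * t)" if "t \<ge> 0" for t
      using M(2)[OF that] by (simp add: S\<^sub>F_def mult.commute)
    then show "\<exists>F M S\<^sub>F. bounded_op sX sU F \<and> M \<ge> 1 \<and>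
      generates sX D (\<lambda>x. A x + B (F x)) S\<^sub>F \<and> (\<forall>t\<ge>0. norm (S\<^sub>F t) \<le> M * exp (- \<omega> * t))"
      using W.bounded_op_feedback gen M(1) by blast
  qed
qed

end
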